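(* Consider a three-chain linkage formed by open chains $A$, $B$, $Z$, with oriented cycle $\Gamma=AB$ and generic edge lengths, such that none of the cycles $AB$, $AZ$, $BZ$ (as polygonal linkages) has an aligned configuration. Let $P_\Gamma$ be a cyclic configuration of the polygonal linkage $\Gamma$, and let $C$ be the (non-empty) corresponding critical manifold of circular type of the oriented area function $S$ on the reduced configuration space of the three-chain, consisting of all configurations of the three-chain whose restriction to $\Gamma$ is $P_\Gamma$. Then the Bott-Morse index of $C$ equals the Morse index of the cyclic polygon $P_\Gamma$, that is, the Morse index at $P_\Gamma$ of the oriented area function on the reduced configuration space of the polygonal linkage $\Gamma$.
   Context: A linkage is a graph together with an assignment of (positive) lengths to its edges. A configuration is a realization of the linkage in the Euclidean plane (self-intersections allowed); the reduced configuration space is the space of configurations modulo orientation-preserving isometries of the plane. Edge lengths are assumed realizable (non-empty configuration space). A configuration is aligned if all its vertices lie on one straight line. An open chain is a linkage whose underlying graph is a path, oriented from its initial to its terminal vertex; a polygonal linkage is one whose underlying graph is a single cycle. A three-chain linkage is obtained from three oriented open chains $A$, $B$, $Z$ by gluing their initial points into one vertex $I$ and their terminal points into one vertex $T$. The distinguished oriented cycle $\Gamma=AB$ runs along $A$ from $I$ to $T$ and then along $B$ backwards from $T$ to $I$. When none of the three cycles has an aligned configuration, the reduced configuration spaces of the three-chain and of $\Gamma$ are smooth manifolds. The oriented area of a polygon with consecutive vertices $p_i=(x_i,y_i)$, $i=1,\dots,n$, is defined by $2S=(x_1y_2-x_2y_1)+\dots+(x_ny_1-x_1y_n)$; for the three-chain,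 $S$ is the oriented area of the polygon $\Gamma$, viewed as a function on the reduced configuration space of the three-chain. A polygon is cyclic if all its vertices lie on a circle; on the (smooth) reduced configuration space of a polygonal linkage the critical points of the oriented area are exactly the cyclic configurations. "Generic" means: outside a suitable finite union of submanifolds of codimension at least one in the parameter space of edge lengths; in particular one may assume that each cyclic configuration of $\Gamma$ is a non-degenerate critical point of the oriented area on the reduced configuration space of $\Gamma$, and that no configuration has simultaneously $\Gamma$ cyclic and $Z$ aligned. The Morse index of a non-degenerate critical point is the number of negative eigenvalues of the Hessian. A function $f$ on a manifold is Bott-Morse if near each point of every component $C$ of its critical set it is locally of the form $f=f_0-(x_1^2+\dots+x_\lambda^2)+(x_{\lambda+1}^2+\dots+x_k^2)$ in suitable local coordinates; $\lambda=\lambda(C)$ is the Bott-Morse index of $C$. Known formula for the Morse index of a (generic) cyclic configuration $P=(p_1,\dots,p_n)$ of a polygonal linkage: let $O$ be the center of the circumscribed circle, $\omega_P$ the winding number of $P$ with respect to $O$, $\alpha_i>0$ half of the (unoriented) angle between $\overrightarrow{Op_i}$ and $\overrightarrow{Op_{i+1}}$, $\varepsilon_i=1$ if $O$ lies to the left of the directed edge $p_ip_{i+1}$ and $\varepsilon_i=-1$ if it lies to the right, and $e(P)$ the number of positive entries among $\varepsilon_1,\dots,\varepsilon_n$. Then the Morse index is $e(P)-1-2\omega_P$ if $\sum_i\varepsilon_i\tan\alpha_i>0$ and $e(P)-2-2\omega_P$ otherwise. *)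

theory Defs
  imports "HOL-Analysis.Analysis"
begin

section \<open>Smooth maps between Euclidean spaces\<close>

primrec Ck_on ::
  "nat \<Rightarrow> ('a::euclidean_space \<Rightarrow> 'b::real_normed_vector) \<Rightarrow> 'a set \<Rightarrow> bool" where
  "Ck_on 0 f U \<longleftrightarrow> continuous_on U f"
| "Ck_on (Suc k) f U \<longleftrightarrow>
     (\<forall>x\<in>U. f differentiable (at x)) \<and>
     (\<forall>v. Ck_on k (\<lambda>x. frechet_derivative f (at x) v) U)"

definition smooth_on :: "('a::euclidean_space \<Rightarrow> 'b::real_normed_vector) \<Rightarrow> 'a set \<Rightarrow> bool" where
  "smooth_on f U \<longleftrightarrow> open U \<and> (\<forall>k. Ck_on k f U)"


section \<open>Linkages and their reduced configuration spaces\<close>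

text \<open>
  A linkage is given by its edges \<open>(u, v, l)\<close>, where \<open>l\<close> is the length. The plane is
  \<open>complex\<close>. A placement of the vertices is a vector in \<open>complex^'v\<close>; the type \<open>'v\<close> may contain
  labels that are not vertices of the linkage, and a configuration is set to 0 at those, so that
  linkages with different vertex sets live in the same ambient space.
\<close>

type_synonym 'v linkage = "('v \<times> 'v \<times> real) set"

definition vertices :: "'v linkage \<Rightarrow> 'v set" where
  "vertices L = (\<Union>(u, v, l)\<in>L. {u, v})"

definition configurations :: "'v::finite linkage \<Rightarrow> (complex^'v) set" where
  "configurations L =
     {p. (\<forall>(u, v, l)\<in>L. dist (p $ u) (p $ v) = l) \<and> (\<forall>v. v \<notin> vertices L \<longrightarrow> p $ v = 0)}"

definition affine_image :: "'v::finite linkage \<Rightarrow> complex \<Rightarrow> complex \<Rightarrow> complex^'v \<Rightarrow> complex^'v" where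
  "affine_image L a b p = (\<chi> v. if v \<in> vertices L then a * p $ v + b else 0)"

text \<open>
  The orientation-preserving isometries of the plane are the maps \<open>z \<mapsto> a z + b\<close> with
  \<open>\<bar>a\<bar> = 1\<close>. A point of the reduced configuration space is an orbit of configurations.
\<close>

definition congruence_class :: "'v::finite linkage \<Rightarrow> complex^'v \<Rightarrow> (complex^'v) set" where
  "congruence_class L p = {affine_image L a b p | a b. norm a = 1}"

definition reduced_space :: "'v::finite linkage \<Rightarrow> (complex^'v) set set" where
  "reduced_space L = congruence_class L ` configurations L"

text \<open>The tangent space at \<open>p\<close> of the orbit of \<open>p\<close>.\<close>

definition infinitesimal_motions :: "'v::finite linkage \<Rightarrow> complex^'v \<Rightarrow> (complex^'v) set" where
  "infinitesimal_motions L p = {affine_image L (\<i> * of_real t) b p | t b. True}"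

definition aligned :: "'v::finite linkage \<Rightarrow> complex^'v \<Rightarrow> bool" where
  "aligned L p \<longleftrightarrow> collinear (($) p ` vertices L)"

definition cyclic :: "'v::finite linkage \<Rightarrow> complex^'v \<Rightarrow> bool" where
  "cyclic L p \<longleftrightarrow> (\<exists>c r. 0 < r \<and> (\<forall>v\<in>vertices L. dist c (p $ v) = r))"


section \<open>Local coordinates, Morse index and Bott-Morse index\<close>

text \<open>
  The model space \<open>\<real>\<^sup>d\<close> is realised as \<open>span B\<close> for a set \<open>B\<close> of \<open>d\<close> standard basis vectors of the
  ambient space (\<open>d = 0\<close> is allowed); the coordinates of \<open>x\<close> are the \<open>x \<bullet> b\<close> with \<open>b \<in> B\<close>.
  Local coordinates are given by the inverse of a chart, lifted to a smooth map \<open>\<sigma>\<close> into the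
  configurations. The last three conditions say that the map \<open>x \<mapsto> congruence_class L (\<sigma> x)\<close> into
  the quotient is an immersion, is injective, and is open: a set of orbits is open in the quotient
  topology iff its union is open in the space of configurations. Hence, where the reduced
  configuration space is a smooth manifold, that map is a diffeomorphism onto an open subset.
\<close>

definition local_coordinates ::
  "'v::finite linkage \<Rightarrow> (complex^'v) set \<Rightarrow> (complex^'v) set \<Rightarrow> (complex^'v \<Rightarrow> complex^'v) \<Rightarrow> bool"
where
  "local_coordinates L B U \<sigma> \<longleftrightarrow>
     B \<subseteq> Basis \<and> smooth_on \<sigma> U \<and> \<sigma> ` (U \<inter> span B) \<subseteq> configurations L \<and>
     (\<forall>x\<in>U \<inter> span B. \<forall>v\<in>span B.
        frechet_derivative \<sigma> (at x) v \<in> infinitesimal_motions L (\<sigma> x) \<longrightarrow> v = 0) \<and>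
     inj_on (\<lambda>x. congruence_class L (\<sigma> x)) (U \<inter> span B) \<and>
     (\<forall>W. openin (top_of_set (U \<inter> span B)) W \<longrightarrow>
        openin (top_of_set (configurations L)) (\<Union>x\<in>W. congruence_class L (\<sigma> x)))"

definition partial :: "'a::euclidean_space \<Rightarrow> ('a \<Rightarrow> real) \<Rightarrow> 'a \<Rightarrow> real" where
  "partial b g x = deriv (\<lambda>t. g (x + t *\<^sub>R b)) 0"

text \<open>The operator on \<open>span B\<close> whose matrix in the basis \<open>B\<close> is the matrix of second partials.\<close>

definition hessian :: "'a::euclidean_space set \<Rightarrow> ('a \<Rightarrow> real) \<Rightarrow> 'a \<Rightarrow> 'a \<Rightarrow> 'a" where
  "hessian B g x v = (\<Sum>b\<in>B. (\<Sum>c\<in>B. partial b (partial c g) x * (v \<bullet> c)) *\<^sub>R b)"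

definition nondegenerate_critical_at :: "'a::euclidean_space set \<Rightarrow> ('a \<Rightarrow> real) \<Rightarrow> 'a \<Rightarrow> bool" where
  "nondegenerate_critical_at B g x \<longleftrightarrow>
     (\<forall>b\<in>B. partial b g x = 0) \<and> (\<forall>v\<in>span B. hessian B g x v = 0 \<longrightarrow> v = 0)"

text \<open>
  Eigenvalues are counted with multiplicity; the Hessian is symmetric, so that the geometric
  multiplicity is the algebraic one.
\<close>

definition negative_eigenvalues :: "'a::euclidean_space set \<Rightarrow> ('a \<Rightarrow> real) \<Rightarrow> 'a \<Rightarrow> nat" where
  "negative_eigenvalues B g x =
     (\<Sum>\<mu> | \<mu> < 0 \<and> (\<exists>v\<in>span B. v \<noteq> 0 \<and> hessian B g x v = \<mu> *\<^sub>R v).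
        dim {v \<in> span B. hessian B g x v = \<mu> *\<^sub>R v})"

definition nondegenerate_critical_point ::
  "'v::finite linkage \<Rightarrow> ((complex^'v) set \<Rightarrow> real) \<Rightarrow> (complex^'v) set \<Rightarrow> bool" where
  "nondegenerate_critical_point L f P \<longleftrightarrow>
     (\<exists>B U \<sigma> x. local_coordinates L B U \<sigma> \<and> x \<in> U \<inter> span B \<and> congruence_class L (\<sigma> x) = P \<and>
        nondegenerate_critical_at B (\<lambda>y. f (congruence_class L (\<sigma> y))) x)"

text \<open>
  For a smooth \<open>f\<close>, \<open>has_morse_index L f P m\<close> means that \<open>P\<close> is a non-degenerate critical point of
  \<open>f\<close> on the reduced configuration space and that its Morse index is \<open>m\<close>; the choice of the
  coordinates does not matter.
\<close>

definition has_morse_index ::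
  "'v::finite linkage \<Rightarrow> ((complex^'v) set \<Rightarrow> real) \<Rightarrow> (complex^'v) set \<Rightarrow> nat \<Rightarrow> bool" where
  "has_morse_index L f P m \<longleftrightarrow>
     (\<exists>B U \<sigma> x. local_coordinates L B U \<sigma> \<and> x \<in> U \<inter> span B \<and> congruence_class L (\<sigma> x) = P \<and>
        nondegenerate_critical_at B (\<lambda>y. f (congruence_class L (\<sigma> y))) x \<and>
        negative_eigenvalues B (\<lambda>y. f (congruence_class L (\<sigma> y))) x = m)"

text \<open>
  Near each of its points, \<open>C\<close> is the critical set of \<open>f\<close>, and \<open>f\<close> has there the Bott-Morse normal
  form with \<open>m\<close> negative squares: the coordinates in \<open>N\<close> enter with the sign \<open>-\<close>, those in \<open>Q\<close> with
  the sign \<open>+\<close>, and those in \<open>B - (N \<union> Q)\<close> are coordinates on \<open>C\<close>.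
\<close>

definition has_bott_morse_index ::
  "'v::finite linkage \<Rightarrow> ((complex^'v) set \<Rightarrow> real) \<Rightarrow> (complex^'v) set set \<Rightarrow> nat \<Rightarrow> bool" where
  "has_bott_morse_index L f C m \<longleftrightarrow>
     (\<forall>X\<in>C. \<exists>B U \<sigma> N Q. local_coordinates L B U \<sigma> \<and> 0 \<in> U \<and> congruence_class L (\<sigma> 0) = X \<and>
        N \<union> Q \<subseteq> B \<and> N \<inter> Q = {} \<and> card N = m \<and>
        (\<forall>x\<in>U \<inter> span B.
           f (congruence_class L (\<sigma> x)) = f X - (\<Sum>b\<in>N. (x \<bullet> b)\<^sup>2) + (\<Sum>b\<in>Q. (x \<bullet> b)\<^sup>2) \<and>
           (congruence_class L (\<sigma> x) \<in> C \<longleftrightarrow> (\<forall>b\<in>N \<union> Q. x \<bullet> b = 0))))"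


section \<open>Three-chain linkages\<close>

text \<open>
  An oriented chain lists its vertices from the initial to the terminal one; the \<open>i\<close>-th length is
  that of the edge between the \<open>i\<close>-th and the next vertex.
\<close>

datatype 'v chain = Chain (chain_vertices: "'v list") (chain_lengths: "real list")

definition open_chain :: "'v chain \<Rightarrow> bool" where
  "open_chain c \<longleftrightarrow>
     chain_lengths c \<noteq> [] \<and> length (chain_vertices c) = Suc (length (chain_lengths c)) \<and>
     distinct (chain_vertices c) \<and> (\<forall>l\<in>set (chain_lengths c). 0 < l)"

definition chain_linkage :: "'v chain \<Rightarrow> 'v linkage" where
  "chain_linkage c =
     {(chain_vertices c ! i, chain_vertices c ! Suc i, chain_lengths c ! i) | i.
        i < length (chain_lengths c)}"

definition glued :: "'v chain \<Rightarrow> 'v chain \<Rightarrow> bool" where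
  "glued c d \<longleftrightarrow>
     hd (chain_vertices c) = hd (chain_vertices d) \<and>
     last (chain_vertices c) = last (chain_vertices d) \<and>
     set (chain_vertices c) \<inter> set (chain_vertices d) =
       {hd (chain_vertices c), last (chain_vertices c)}"

definition three_chain :: "'v chain \<Rightarrow> 'v chain \<Rightarrow> 'v chain \<Rightarrow> bool" where
  "three_chain A B Z \<longleftrightarrow>
     open_chain A \<and> open_chain B \<and> open_chain Z \<and> glued A B \<and> glued A Z \<and> glued B Z"

definition cycle_linkage :: "'v chain \<Rightarrow> 'v chain \<Rightarrow> 'v linkage" where
  "cycle_linkage c d = chain_linkage c \<union> chain_linkage d"

definition three_chain_linkage :: "'v chain \<Rightarrow> 'v chain \<Rightarrow> 'v chain \<Rightarrow> 'v linkage" where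
  "three_chain_linkage A B Z = chain_linkage A \<union> chain_linkage B \<union> chain_linkage Z"

text \<open>The vertices of the cycle that runs along \<open>c\<close> and then backwards along \<open>d\<close>.\<close>

definition cycle_vertices :: "'v chain \<Rightarrow> 'v chain \<Rightarrow> 'v list" where
  "cycle_vertices c d = butlast (chain_vertices c) @ butlast (rev (chain_vertices d))"

definition oriented_area :: "'v list \<Rightarrow> complex^'v::finite \<Rightarrow> real" where
  "oriented_area vs p =
     (\<Sum>i<length vs.
        let q = p $ (vs ! i); r = p $ (vs ! (Suc i mod length vs)) in Re q * Im r - Re r * Im q) / 2"

text \<open>
  The oriented area is constant on each congruence class, hence a function on the reduced
  configuration space of the cycle as well as on that of the three-chain.
\<close>

definition area :: "'v::finite chain \<Rightarrow> 'v chain \<Rightarrow> (complex^'v) set \<Rightarrow> real" where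
  "area A B X = the_elem (oriented_area (cycle_vertices A B) ` X)"

definition restriction :: "'v::finite linkage \<Rightarrow> complex^'v \<Rightarrow> complex^'v" where
  "restriction L q = (\<chi> v. if v \<in> vertices L then q $ v else 0)"

definition circular_manifold ::
  "'v::finite chain \<Rightarrow> 'v chain \<Rightarrow> 'v chain \<Rightarrow> (complex^'v) set \<Rightarrow> (complex^'v) set set" where
  "circular_manifold A B Z P =
     congruence_class (three_chain_linkage A B Z) `
       {q \<in> configurations (three_chain_linkage A B Z). restriction (cycle_linkage A B) q \<in> P}"

definition generic :: "'v::finite chain \<Rightarrow> 'v chain \<Rightarrow> 'v chain \<Rightarrow> bool" where
  "generic A B Z \<longleftrightarrow>
     (\<forall>p\<in>configurations (cycle_linkage A B). cyclic (cycle_linkage A B) p \<longrightarrow>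
        nondegenerate_critical_point (cycle_linkage A B) (area A B)
          (congruence_class (cycle_linkage A B) p)) \<and>
     (\<forall>q\<in>configurations (three_chain_linkage A B Z).
        \<not> (cyclic (cycle_linkage A B) q \<and> aligned (chain_linkage Z) q))"

end

theory Submission
  imports Defs
begin

text \<open>
  Near a point of the circular manifold, a configuration of the three-chain is a configuration of
  \<open>\<Gamma>\<close> together with a realization of \<open>Z\<close> whose end points are prescribed. As \<open>Z\<close> is not aligned,
  two of its edges are not parallel; the directions of the others can be varied freely, and
  these two are then the sides of a triangle whose base is determined by all the rest. So the reduced
  configuration space of the three-chain is locally a product of that of \<open>\<Gamma>\<close> and a space of free
  angles. The area depends on the first factor only, where the Morse lemma puts it into normal
  form; the angles are the coordinates along the critical manifold.
\<close>

section \<open>Calculus of smooth maps\<close>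

text \<open>The obstacle is the rigid form of charts: \<open>local_coordinates\<close> wants a map
  that is smooth on an open set of the ambient space \<open>complex^'v\<close>, with coordinates
  named by standard basis vectors. Changes of coordinates are therefore maps of the ambient space
  that carry one coordinate subspace into another. A given chart of \<Gamma> may occupy any basis
  vectors, also those of vertices of \<open>Z\<close>. An immersion into the placements of the
  vertices of \<Gamma> cannot have more coordinates than these placements, so the chart can be moved
  to basis vectors of \<Gamma>; the interior vertices of \<open>Z\<close> then supply vectors for
  the angles. Smoothness means all orders, so the inverse function theorem and the integral
  remainder are raised to every order by induction. A chart must also be open into the quotient; for
  the extended chart this comes from a continuous inverse: the inverse chart of \<Gamma> gives the
  first factor, comparison of one edge gives the rotation, and the principal argument gives the
  angles. Genericity enters by excluding an aligned \<open>Z\<close> over a cyclic \<Gamma>.\<close>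

lemma Ck_on_Suc_has_derivative:
  assumes "Ck_on (Suc k) f U" "x \<in> U"
  shows "(f has_derivative frechet_derivative f (at x)) (at x)"
  using assms by (simp add: frechet_derivative_works)

text \<open>A derivative at a point of an open set sees only nearby values, so agreement on
  \<open>U\<close> passes to the derivatives; the induction therefore varies both functions.\<close>

lemma Ck_on_cong:
  assumes "open U" "\<And>x. x \<in> U \<Longrightarrow> f x = g x" "Ck_on k f U"
  shows "Ck_on k g U"
  using assms(2,3)
proof (induction k arbitrary: f g)
  case 0
  then show ?case by (metis Ck_on.simps(1) continuous_on_cong)
next
  case (Suc k)
  have der: "(g has_derivative frechet_derivative f (at x)) (at x)" if "x \<in> U" for x
    using has_derivative_transform_within_open[OF Ck_on_Suc_has_derivative[OF Suc.prems(2) that]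
        \<open>open U\<close> that] Suc.prems(1) by auto
  have eq: "frechet_derivative f (at x) = frechet_derivative g (at x)" if "x \<in> U" for x
    by (rule frechet_derivative_at[OF der[OF that]])
  have "Ck_on k (\<lambda>x. frechet_derivative g (at x) v) U" for v
    by (rule Suc.IH[of "\<lambda>x. frechet_derivative f (at x) v"]) (use eq Suc.prems(2) in simp_all)
  moreover have "\<forall>x\<in>U. g differentiable (at x)"
    using der by (auto simp: differentiable_def)
  ultimately show ?case by simp
qed

text \<open>Derivatives at interior points are unique, so any explicit derivative may replace
  \<open>frechet_derivative\<close>; the closure lemmas below rest on this and on the usual
  differentiation rules.\<close>

lemma Ck_on_Suc_intro:
  assumes "open U" and der: "\<And>x. x \<in> U \<Longrightarrow> (f has_derivative f' x) (at x)"
    and "\<And>v. Ck_on k (\<lambda>x. f' x v) U"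
  shows "Ck_on (Suc k) f U"
proof -
  have eq: "f' x = frechet_derivative f (at x)" if "x \<in> U" for x
    by (rule frechet_derivative_at[OF der[OF that]])
  have "Ck_on k (\<lambda>x. frechet_derivative f (at x) v) U" for v
    by (rule Ck_on_cong[OF \<open>open U\<close> _ assms(3)[of v]]) (simp add: eq)
  moreover have "\<forall>x\<in>U. f differentiable (at x)"
    using der by (auto simp: differentiable_def)
  ultimately show ?thesis by simp
qed

lemma Ck_on_subset: "Ck_on k f U \<Longrightarrow> V \<subseteq> U \<Longrightarrow> Ck_on k f V"
  by (induction k arbitrary: f) (auto intro: continuous_on_subset)

lemma Ck_on_Suc_imp: "Ck_on (Suc k) f U \<Longrightarrow> Ck_on k f U"
proof (induction k arbitrary: f)
  case 0
  then show ?case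
    by (auto intro!: continuous_at_imp_continuous_on differentiable_imp_continuous_within)
next
  case (Suc k)
  have "Ck_on (Suc k) (\<lambda>x. frechet_derivative f (at x) v) U" for v
    using Suc.prems by (subst (asm) Ck_on.simps(2)) blast
  then have "Ck_on k (\<lambda>x. frechet_derivative f (at x) v) U" for v
    by (rule Suc.IH)
  moreover have "\<forall>x\<in>U. f differentiable (at x)"
    using Suc.prems by (subst (asm) Ck_on.simps(2)) blast
  ultimately show ?case by simp
qed

lemma Ck_on_imp_continuous_on: "Ck_on k f U \<Longrightarrow> continuous_on U f"
  by (induction k) (auto dest: Ck_on_Suc_imp simp del: Ck_on.simps(2))

lemma Ck_on_const: "open U \<Longrightarrow> Ck_on k (\<lambda>x. c) U"
proof (induction k arbitrary: c)
  case (Suc k)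
  show ?case by (rule Ck_on_Suc_intro[where f' = "\<lambda>_ _. 0"]) (use Suc in auto)
qed auto

lemma Ck_on_bounded_linear_compose:
  assumes "open U" "bounded_linear h" "Ck_on k f U"
  shows "Ck_on k (\<lambda>x. h (f x)) U"
  using assms(3)
proof (induction k arbitrary: f)
  case 0
  then show ?case
    using assms(2) by (simp add: bounded_linear.continuous_on)
next
  case (Suc k)
  show ?case
  proof (rule Ck_on_Suc_intro[OF \<open>open U\<close>])
    fix x assume "x \<in> U"
    show "((\<lambda>x. h (f x)) has_derivative (\<lambda>v. h (frechet_derivative f (at x) v))) (at x)"
      by (rule bounded_linear.has_derivative[OF assms(2) Ck_on_Suc_has_derivative[OF Suc.prems \<open>x \<in> U\<close>]])
  qed (use Suc \<open>open U\<close> in auto)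
qed

lemma Ck_on_id: "open U \<Longrightarrow> Ck_on k (\<lambda>x. x) U"
proof (cases k)
  case (Suc j)
  assume "open U"
  then show ?thesis unfolding Suc
    by (intro Ck_on_Suc_intro[where f' = "\<lambda>_ v. v"]) (auto intro: Ck_on_const)
qed auto

lemma Ck_on_bounded_linear:
  assumes "open U" "bounded_linear h"
  shows "Ck_on k h U"
  using Ck_on_bounded_linear_compose[OF assms Ck_on_id[OF assms(1)]] .

lemma Ck_on_add:
  assumes "open U" "Ck_on k f U" "Ck_on k g U"
  shows "Ck_on k (\<lambda>x. f x + g x) U"
  using assms(2,3)
proof (induction k arbitrary: f g)
  case 0
  then show ?case by (simp add: continuous_on_add)
next
  case (Suc k)
  show ?case
    by (rule Ck_on_Suc_intro[OF \<open>open U\<close> has_derivative_add[OF Ck_on_Suc_has_derivative[OF Suc.prems(1)]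
         Ck_on_Suc_has_derivative[OF Suc.prems(2)]]])
       (use Suc \<open>open U\<close> in auto)
qed

lemma Ck_on_sum:
  assumes "open U" "\<And>i. i \<in> I \<Longrightarrow> Ck_on k (f i) U"
  shows "Ck_on k (\<lambda>x. \<Sum>i\<in>I. f i x) U"
  using assms(2)
  by (induction I rule: infinite_finite_induct) (auto intro: Ck_on_add Ck_on_const assms(1))

text \<open>The product rule yields two terms of the same shape, each with one factor differentiated
  and the other kept. Hence the induction varies both factors and lowers the order of the kept
  one.\<close>

lemma Ck_on_bilinear:
  assumes "open U" "bounded_bilinear h" "Ck_on k f U" "Ck_on k g U"
  shows "Ck_on k (\<lambda>x. h (f x) (g x)) U"
  using assms(3,4)
proof (induction k arbitrary: f g)
  case 0
  then show ?case using assms(2) by (simp add: bounded_bilinear.continuous_on)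
next
  case (Suc k)
  show ?case
  proof (rule Ck_on_Suc_intro[OF \<open>open U\<close> bounded_bilinear.FDERIV[OF assms(2)
           Ck_on_Suc_has_derivative[OF Suc.prems(1)] Ck_on_Suc_has_derivative[OF Suc.prems(2)]]])
    fix v
    show "Ck_on k (\<lambda>x. h (f x) (frechet_derivative g (at x) v) + h (frechet_derivative f (at x) v) (g x)) U"
      using Suc.prems by (intro Ck_on_add[OF \<open>open U\<close>] Suc.IH)
         (auto dest: Ck_on_Suc_imp simp del: Ck_on.simps(2), auto)
  qed (use \<open>open U\<close> in auto)
qed

lemmas Ck_on_mult = Ck_on_bilinear[OF _ bounded_bilinear_mult]
lemmas Ck_on_scaleR = Ck_on_bilinear[OF _ bounded_bilinear_scaleR]
lemmas Ck_on_inner = Ck_on_bilinear[OF _ bounded_bilinear_inner]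

lemma Ck_on_minus: "open U \<Longrightarrow> Ck_on k f U \<Longrightarrow> Ck_on k (\<lambda>x. - f x) U"
  by (rule Ck_on_bounded_linear_compose[OF _ bounded_linear_minus[OF bounded_linear_ident]])

lemma Ck_on_diff: "open U \<Longrightarrow> Ck_on k f U \<Longrightarrow> Ck_on k g U \<Longrightarrow> Ck_on k (\<lambda>x. f x - g x) U"
  using Ck_on_add[OF _ _ Ck_on_minus, of U k f g] by simp

text \<open>\<open>Ck_on\<close> controls derivatives in fixed directions only, while the chain rule
  feeds the outer derivative a direction that moves with \<open>x\<close>. Expanding this direction
  in \<open>Basis\<close> leaves fixed directions with scalar coefficients of class
  \<open>k\<close>.\<close>

lemma Ck_on_compose:
  fixes f :: "'a::euclidean_space \<Rightarrow> 'b::euclidean_space"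
  assumes "open U" "open V" "f ` U \<subseteq> V" "Ck_on k g V" "Ck_on k f U"
  shows "Ck_on k (\<lambda>x. g (f x)) U"
  using assms(4,5)
proof (induction k arbitrary: g)
  case 0
  then show ?case using assms(3) by (auto intro: continuous_on_compose2)
next
  case (Suc k)
  let ?f' = "\<lambda>x. frechet_derivative f (at x)" and ?g' = "\<lambda>y. frechet_derivative g (at y)"
  show ?case
  proof (rule Ck_on_Suc_intro[OF \<open>open U\<close>, where f' = "\<lambda>x v. \<Sum>b\<in>Basis. (?f' x v \<bullet> b) *\<^sub>R ?g' (f x) b"])
    fix x assume x: "x \<in> U"
    have g: "(g has_derivative ?g' (f x)) (at (f x))"
      by (rule Ck_on_Suc_has_derivative[OF Suc.prems(1)]) (use x assms(3) in blast)
    have "((\<lambda>x. g (f x)) has_derivative (\<lambda>v. ?g' (f x) (?f' x v))) (at x)"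
      by (rule has_derivative_compose[OF Ck_on_Suc_has_derivative[OF Suc.prems(2) x] g])
    moreover have "?g' (f x) w = (\<Sum>b\<in>Basis. (w \<bullet> b) *\<^sub>R ?g' (f x) b)" for w
    proof -
      have "?g' (f x) w = ?g' (f x) (\<Sum>b\<in>Basis. (w \<bullet> b) *\<^sub>R b)"
        by (simp only: euclidean_representation)
      also have "\<dots> = (\<Sum>b\<in>Basis. ?g' (f x) ((w \<bullet> b) *\<^sub>R b))"
        by (rule linear_sum[OF has_derivative_linear[OF g]])
      also have "\<dots> = (\<Sum>b\<in>Basis. (w \<bullet> b) *\<^sub>R ?g' (f x) b)"
        by (simp only: linear_cmul[OF has_derivative_linear[OF g]])
      finally show ?thesis .
    qed
    ultimately show "((\<lambda>x. g (f x)) has_derivative (\<lambda>v. \<Sum>b\<in>Basis. (?f' x v \<bullet> b) *\<^sub>R ?g' (f x) b)) (at x)"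
      by (rule has_derivative_eq_rhs[OF _ ext])
  next
    fix v
    have "Ck_on k f U" using Suc.prems(2) by (rule Ck_on_Suc_imp)
    then have "Ck_on k (\<lambda>x. ?g' (f x) b) U" for b
      using Suc.IH[of "\<lambda>y. ?g' y b"] Suc.prems(1) by simp
    moreover have "Ck_on k (\<lambda>x. ?f' x v) U" using Suc.prems(2) by simp
    ultimately show "Ck_on k (\<lambda>x. \<Sum>b\<in>Basis. (?f' x v \<bullet> b) *\<^sub>R ?g' (f x) b) U"
      by (intro Ck_on_sum Ck_on_scaleR Ck_on_inner Ck_on_const \<open>open U\<close>)
  qed
qed

text \<open>The derivative of \<open>inverse (f x)\<close> is a product that contains
  \<open>inverse (f x)\<close> itself, already controlled one order lower. The same bootstrap works
  for \<open>sqrt\<close> and \<open>cis\<close> below.\<close>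

lemma Ck_on_inverse:
  fixes f :: "'a::euclidean_space \<Rightarrow> 'b::real_normed_field"
  assumes "open U" "\<And>x. x \<in> U \<Longrightarrow> f x \<noteq> 0" "Ck_on k f U"
  shows "Ck_on k (\<lambda>x. inverse (f x)) U"
  using assms(3)
proof (induction k)
  case 0
  then show ?case using assms(2) by (auto intro!: continuous_on_inverse)
next
  case (Suc k)
  let ?f' = "\<lambda>x. frechet_derivative f (at x)"
  have "Ck_on k (\<lambda>x. inverse (f x)) U" using Suc Ck_on_Suc_imp by blast
  moreover have "Ck_on k (\<lambda>x. ?f' x v) U" for v using Suc.prems by auto
  ultimately have "Ck_on k (\<lambda>x. - (inverse (f x) * ?f' x v * inverse (f x))) U" for v
    by (intro Ck_on_minus Ck_on_mult \<open>open U\<close>)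
  then show ?case
    by (intro Ck_on_Suc_intro[OF \<open>open U\<close> Deriv.has_derivative_inverse[OF assms(2) 
          Ck_on_Suc_has_derivative[OF Suc.prems]]] \<open>open U\<close>)
qed

lemma Ck_on_divide:
  fixes f :: "'a::euclidean_space \<Rightarrow> 'b::real_normed_field"
  assumes "open U" "\<And>x. x \<in> U \<Longrightarrow> g x \<noteq> 0" "Ck_on k f U" "Ck_on k g U"
  shows "Ck_on k (\<lambda>x. f x / g x) U"
  unfolding divide_inverse using assms by (intro Ck_on_mult Ck_on_inverse) auto

lemma Ck_on_sqrt:
  assumes "open U" "\<And>x. x \<in> U \<Longrightarrow> f x > 0" "Ck_on k f U"
  shows "Ck_on k (\<lambda>x. sqrt (f x)) U"
  using assms(3)
proof (induction k)
  case 0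
  then show ?case by (auto intro!: continuous_on_real_sqrt)
next
  case (Suc k)
  let ?f' = "\<lambda>x. frechet_derivative f (at x)"
  have "Ck_on k (\<lambda>x. sqrt (f x)) U" using Suc Ck_on_Suc_imp by blast
  moreover have "Ck_on k (\<lambda>x. ?f' x v) U" for v using Suc.prems by auto
  ultimately have *: "Ck_on k (\<lambda>x. ?f' x v * (inverse (sqrt (f x)) * (1 / 2))) U" for v
    using assms(2) by (intro Ck_on_mult Ck_on_inverse Ck_on_const \<open>open U\<close>) fastforce+
  show ?case
  proof (rule Ck_on_Suc_intro[OF \<open>open U\<close> _ *])
    fix x assume x: "x \<in> U"
    show "((\<lambda>x. sqrt (f x)) has_derivative (\<lambda>v. ?f' x v * (inverse (sqrt (f x)) * (1 / 2)))) (at x)"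
      using has_derivative_real_sqrt[OF assms(2)[OF x] Ck_on_Suc_has_derivative[OF Suc.prems x]]
      by (simp add: mult.commute mult.left_commute field_simps)
  qed
qed

lemma has_derivative_cis: "(cis has_derivative (\<lambda>t. t *\<^sub>R (\<i> * cis a))) (at a)"
proof -
  have "((\<lambda>t. \<i> * complex_of_real t) has_derivative (\<lambda>t. \<i> * of_real t)) (at a)"
    by (auto intro!: derivative_eq_intros)
  from has_derivative_compose[OF this DERIV_exp[unfolded has_field_derivative_def]]
  show ?thesis by (simp add: cis_conv_exp[abs_def] scaleR_conv_of_real mult_ac)
qed

lemma Ck_on_cis:
  assumes "open U" "Ck_on k f U"
  shows "Ck_on k (\<lambda>x. cis (f x)) U"
  using assms(2)
proof (induction k)
  case 0
  then show ?case by (auto intro!: continuous_intros)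
next
  case (Suc k)
  let ?f' = "\<lambda>x. frechet_derivative f (at x)"
  have "Ck_on k (\<lambda>x. cis (f x)) U" using Suc Ck_on_Suc_imp by blast
  moreover have "Ck_on k (\<lambda>x. ?f' x v) U" for v using Suc.prems by auto
  ultimately have *: "Ck_on k (\<lambda>x. ?f' x v *\<^sub>R (\<i> * cis (f x))) U" for v
    by (intro Ck_on_mult Ck_on_scaleR Ck_on_const \<open>open U\<close>)
  show ?case
  proof (rule Ck_on_Suc_intro[OF \<open>open U\<close> _ *])
    fix x assume x: "x \<in> U"
    from has_derivative_compose[OF Ck_on_Suc_has_derivative[OF Suc.prems x] has_derivative_cis]
    show "((\<lambda>x. cis (f x)) has_derivative (\<lambda>v. ?f' x v *\<^sub>R (\<i> * cis (f x)))) (at x)" .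
  qed
qed

lemma bounded_linear_axis: "bounded_linear (axis i :: 'b::euclidean_space \<Rightarrow> 'b ^ 'n)"
  by (rule linear_conv_bounded_linear[THEN iffD1], rule linearI)
     (simp_all add: vec_eq_iff axis_def)

lemma Ck_on_vec:
  fixes f :: "'a::euclidean_space \<Rightarrow> 'b::euclidean_space ^ 'n"
  assumes "open U" "\<And>i. Ck_on k (\<lambda>x. f x $ i) U"
  shows "Ck_on k f U"
proof (rule Ck_on_cong[OF \<open>open U\<close>])
  show "Ck_on k (\<lambda>x. \<Sum>i\<in>UNIV. axis i (f x $ i)) U"
    by (intro Ck_on_sum Ck_on_bounded_linear_compose[OF \<open>open U\<close> bounded_linear_axis] assms)
  show "(\<Sum>i\<in>UNIV. axis i (f x $ i)) = f x" for x
    by (simp add: vec_eq_iff axis_def if_distrib sum.delta cong: if_cong)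
qed

lemma smooth_onD: "smooth_on f U \<Longrightarrow> Ck_on k f U" "smooth_on f U \<Longrightarrow> open U"
  by (simp_all add: smooth_on_def)

lemma smooth_on_has_derivative:
  "smooth_on f U \<Longrightarrow> x \<in> U \<Longrightarrow> (f has_derivative frechet_derivative f (at x)) (at x)"
  using Ck_on_Suc_has_derivative smooth_onD(1) by blast

lemma smooth_on_subset: "smooth_on f U \<Longrightarrow> V \<subseteq> U \<Longrightarrow> open V \<Longrightarrow> smooth_on f V"
  by (auto simp: smooth_on_def intro: Ck_on_subset)

lemma smooth_on_frechet_derivative:
  "smooth_on f U \<Longrightarrow> smooth_on (\<lambda>x. frechet_derivative f (at x) v) U"
  unfolding smooth_on_def using Ck_on.simps(2) by blast

lemma smooth_on_continuous_on: "smooth_on f U \<Longrightarrow> continuous_on U f"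
  using Ck_on_imp_continuous_on smooth_onD(1) by blast

lemma smooth_on_compose:
  fixes f :: "'a::euclidean_space \<Rightarrow> 'b::euclidean_space"
  assumes "smooth_on f U" "smooth_on g V" "f ` U \<subseteq> V"
  shows "smooth_on (\<lambda>x. g (f x)) U"
  using assms by (auto simp: smooth_on_def intro: Ck_on_compose)

lemma smooth_on_mult:
  fixes f g :: "'a::euclidean_space \<Rightarrow> 'b::real_normed_algebra"
  shows "smooth_on f U \<Longrightarrow> smooth_on g U \<Longrightarrow> smooth_on (\<lambda>x. f x * g x) U"
  by (simp add: smooth_on_def Ck_on_mult)

lemma smooth_on_scaleR:
  "smooth_on f U \<Longrightarrow> smooth_on g U \<Longrightarrow> smooth_on (\<lambda>x. f x *\<^sub>R g x) U"
  by (simp add: smooth_on_def Ck_on_scaleR)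

lemma smooth_on_divide:
  fixes f g :: "'a::euclidean_space \<Rightarrow> 'b::real_normed_field"
  shows "smooth_on f U \<Longrightarrow> smooth_on g U \<Longrightarrow> (\<And>x. x \<in> U \<Longrightarrow> g x \<noteq> 0) \<Longrightarrow>
    smooth_on (\<lambda>x. f x / g x) U"
  by (simp add: smooth_on_def Ck_on_divide)

lemma smooth_on_sqrt:
  "smooth_on f U \<Longrightarrow> (\<And>x. x \<in> U \<Longrightarrow> f x > 0) \<Longrightarrow> smooth_on (\<lambda>x. sqrt (f x)) U"
  by (simp add: smooth_on_def Ck_on_sqrt)

lemma smooth_on_add: "smooth_on f U \<Longrightarrow> smooth_on g U \<Longrightarrow> smooth_on (\<lambda>x. f x + g x) U"
  by (simp add: smooth_on_def Ck_on_add)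

lemma smooth_on_diff: "smooth_on f U \<Longrightarrow> smooth_on g U \<Longrightarrow> smooth_on (\<lambda>x. f x - g x) U"
  by (simp add: smooth_on_def Ck_on_diff)

lemma smooth_on_const: "open U \<Longrightarrow> smooth_on (\<lambda>x. c) U"
  by (simp add: smooth_on_def Ck_on_const)

lemma smooth_on_sum:
  "open U \<Longrightarrow> (\<And>i. i \<in> I \<Longrightarrow> smooth_on (f i) U) \<Longrightarrow> smooth_on (\<lambda>x. \<Sum>i\<in>I. f i x) U"
  by (simp add: smooth_on_def Ck_on_sum)

lemma smooth_on_bounded_linear: "open U \<Longrightarrow> bounded_linear h \<Longrightarrow> smooth_on h U"
  by (simp add: smooth_on_def Ck_on_bounded_linear)

lemma smooth_on_inner_const: "open U \<Longrightarrow> smooth_on (\<lambda>x. x \<bullet> c) U"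
  by (rule smooth_on_bounded_linear[OF _ bounded_linear_inner_left])

section \<open>Second derivatives and Hadamard's expansion\<close>

text \<open>With the direction as first argument, \<open>dir_deriv v\<close> is an operator on
  functions and can be iterated to form mixed second derivatives.\<close>

definition dir_deriv ::
  "'a::euclidean_space \<Rightarrow> ('a \<Rightarrow> 'b::real_normed_vector) \<Rightarrow> 'a \<Rightarrow> 'b" where
  "dir_deriv v f x = frechet_derivative f (at x) v"

lemma smooth_on_dir_deriv: "smooth_on f U \<Longrightarrow> smooth_on (dir_deriv v f) U"
  using smooth_on_frechet_derivative[of f U v] by (simp add: dir_deriv_def[abs_def])

lemma smooth_on_has_dir_deriv:
  "smooth_on f U \<Longrightarrow> x \<in> U \<Longrightarrow> (f has_derivative (\<lambda>v. dir_deriv v f x)) (at x)"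
  using smooth_on_has_derivative[of f U x] by (simp add: dir_deriv_def)

lemma smooth_on_line_derivative:
  fixes f :: "'a::euclidean_space \<Rightarrow> 'b::real_normed_vector"
  assumes "smooth_on f U" "x + t *\<^sub>R v \<in> U"
  shows "((\<lambda>s. f (x + s *\<^sub>R v)) has_vector_derivative dir_deriv v f (x + t *\<^sub>R v)) (at t within T)"
proof -
  have "((\<lambda>s. x + s *\<^sub>R v) has_derivative (\<lambda>s. s *\<^sub>R v)) (at t within T)"
    by (auto intro!: derivative_eq_intros)
  from has_derivative_compose[OF this smooth_on_has_dir_deriv[OF assms]]
  have "((\<lambda>s. f (x + s *\<^sub>R v)) has_derivative (\<lambda>s. dir_deriv (s *\<^sub>R v) f (x + t *\<^sub>R v))) (at t within T)" .
  moreover have "dir_deriv (s *\<^sub>R v) f (x + t *\<^sub>R v) = s *\<^sub>R dir_deriv v f (x + t *\<^sub>R v)" for s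
    using linear_cmul[OF has_derivative_linear[OF smooth_on_has_dir_deriv[OF assms]]] .
  ultimately show ?thesis by (simp add: has_vector_derivative_def)
qed

lemma dir_deriv_sum:
  assumes "smooth_on f U" "x \<in> U"
  shows "dir_deriv (\<Sum>b\<in>S. c b *\<^sub>R b) f x = (\<Sum>b\<in>S. c b *\<^sub>R dir_deriv b f x)"
proof -
  note lin = has_derivative_linear[OF smooth_on_has_dir_deriv[OF assms]]
  show ?thesis by (simp only: linear_sum[OF lin] linear_cmul[OF lin])
qed

text \<open>The mean value theorem is applied twice: to the increment in direction \<open>b\<close>
  as a function of the step along \<open>a\<close>, then along \<open>b\<close> to the derivative so
  obtained. The second difference is symmetric in \<open>a\<close> and \<open>b\<close>, which makes
  the two mixed derivatives comparable.\<close>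

lemma second_difference_mvt:
  fixes G :: "'a::euclidean_space \<Rightarrow> real"
  assumes G: "smooth_on G U" and U: "ball x e \<subseteq> U" and t: "t > 0" "t * (norm a + norm b) < e"
  shows "\<exists>p\<in>ball x e. G (x + t *\<^sub>R a + t *\<^sub>R b) - G (x + t *\<^sub>R a) - G (x + t *\<^sub>R b) + G x
            = t * t * dir_deriv b (dir_deriv a G) p"
proof -
  have inU: "x + s *\<^sub>R a + r *\<^sub>R b \<in> ball x e" if "0 \<le> s" "s \<le> t" "0 \<le> r" "r \<le> t" for s r
  proof -
    have "norm (s *\<^sub>R a + r *\<^sub>R b) \<le> s * norm a + r * norm b"
      using that norm_triangle_ineq[of "s *\<^sub>R a" "r *\<^sub>R b"] by simp
    also have "\<dots> \<le> t * norm a + t * norm b"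
      using that by (intro add_mono mult_right_mono) auto
    also have "\<dots> < e" using t(2) by (simp add: distrib_left)
    finally have "norm (s *\<^sub>R a + r *\<^sub>R b) < e" .
    moreover have "dist x (x + s *\<^sub>R a + r *\<^sub>R b) = norm (s *\<^sub>R a + r *\<^sub>R b)"
      by (simp only: dist_norm norm_minus_commute[of x]) (simp add: add.assoc)
    ultimately show ?thesis by simp
  qed
  let ?h = "\<lambda>s. G (x + s *\<^sub>R a + t *\<^sub>R b) - G (x + s *\<^sub>R a)"
  have h: "(?h has_real_derivative
             dir_deriv a G (x + s *\<^sub>R a + t *\<^sub>R b) - dir_deriv a G (x + s *\<^sub>R a)) (at s)"
    if "0 \<le> s" "s \<le> t" for s
    using smooth_on_line_derivative[OF G, of "x + t *\<^sub>R b" s a UNIV] inU[of s t]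
          smooth_on_line_derivative[OF G, of x s a UNIV] inU[of s 0] that t U
    unfolding has_real_derivative_iff_has_vector_derivative
    by (auto intro!: has_vector_derivative_diff simp: algebra_simps)
  obtain s where s: "0 < s" "s < t" "?h t - ?h 0 =
      (t - 0) * (dir_deriv a G (x + s *\<^sub>R a + t *\<^sub>R b) - dir_deriv a G (x + s *\<^sub>R a))"
    using MVT2[of 0 t ?h "\<lambda>s. dir_deriv a G (x + s *\<^sub>R a + t *\<^sub>R b) - dir_deriv a G (x + s *\<^sub>R a)"] h t
    by blast
  let ?k = "\<lambda>r. dir_deriv a G (x + s *\<^sub>R a + r *\<^sub>R b)"
  have k: "(?k has_real_derivative dir_deriv b (dir_deriv a G) (x + s *\<^sub>R a + r *\<^sub>R b)) (at r)"
    if "0 \<le> r" "r \<le> t" for r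
    using smooth_on_line_derivative[OF smooth_on_dir_deriv[OF G], of "x + s *\<^sub>R a" r b a UNIV]
      inU[of s r] that s U
    unfolding has_real_derivative_iff_has_vector_derivative by auto
  obtain r where r: "0 < r" "r < t" "?k t - ?k 0 =
      (t - 0) * dir_deriv b (dir_deriv a G) (x + s *\<^sub>R a + r *\<^sub>R b)"
    using MVT2[of 0 t ?k "\<lambda>r. dir_deriv b (dir_deriv a G) (x + s *\<^sub>R a + r *\<^sub>R b)"] k t by blast
  show ?thesis
    using s(3) r(3) inU[of s r] s(1,2) r(1,2) by (intro bexI[of _ "x + s *\<^sub>R a + r *\<^sub>R b"]) auto
qed

text \<open>Schwarz's theorem. The symmetric second difference is \<open>t * t\<close> times either
  mixed derivative at some point of a small ball; so the two agree at points tending to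
  \<open>x\<close>, and both are continuous.\<close>

lemma dir_deriv_commute:
  fixes G :: "'a::euclidean_space \<Rightarrow> real"
  assumes G: "smooth_on G U" and x: "x \<in> U"
  shows "dir_deriv b (dir_deriv a G) x = dir_deriv a (dir_deriv b G) x"
proof -
  obtain e where e: "e > 0" "ball x e \<subseteq> U"
    using smooth_onD(2)[OF G] x openE by blast
  have ex: "\<exists>p q. p \<in> ball x (e / Suc n) \<and> q \<in> ball x (e / Suc n) \<and>
      dir_deriv b (dir_deriv a G) p = dir_deriv a (dir_deriv b G) q" for n
  proof -
    define d where "d = e / Suc n"
    have d: "d > 0" "ball x d \<subseteq> U"
      using e by (auto simp: d_def field_simps intro!: subset_trans[OF subset_ball e(2)])
    \<comment> \<open>This makes \<open>t * (norm a + norm b)\<close> at most \<open>d / 2\<close>;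
      the summand 1 keeps the denominator positive when both directions vanish.\<close>
    define t where "t = d / (2 * (norm a + norm b + 1))"
    have n: "norm a + norm b + 1 > 0" by (simp add: add_nonneg_pos)
    have t: "t > 0" using d n by (simp add: t_def)
    have "t * (norm a + norm b) \<le> t * (norm a + norm b + 1)"
      using t by simp
    also have "\<dots> = d / 2" using n by (simp add: t_def field_simps)
    also have "\<dots> < d" using d by simp
    finally have td: "t * (norm a + norm b) < d" .
    obtain p where p: "p \<in> ball x d" "G (x + t *\<^sub>R a + t *\<^sub>R b) - G (x + t *\<^sub>R a) - G (x + t *\<^sub>R b) + G x
            = t * t * dir_deriv b (dir_deriv a G) p"
      using second_difference_mvt[OF G d(2) t td] by blast
    obtain q where q: "q \<in> ball x d" "G (x + t *\<^sub>R b + t *\<^sub>R a) - G (x + t *\<^sub>R b) - G (x + t *\<^sub>R a) + G x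
            = t * t * dir_deriv a (dir_deriv b G) q"
      using second_difference_mvt[OF G d(2) t, of b a] td by (auto simp: add.commute)
    have "t * t * dir_deriv b (dir_deriv a G) p = t * t * dir_deriv a (dir_deriv b G) q"
      using p(2) q(2) by (simp add: algebra_simps)
    then show ?thesis using t p(1) q(1) by (auto simp: d_def)
  qed
  obtain p q where pq: "\<And>n. p n \<in> ball x (e / Suc n)" "\<And>n. q n \<in> ball x (e / Suc n)"
     "\<And>n. dir_deriv b (dir_deriv a G) (p n) = dir_deriv a (dir_deriv b G) (q n)"
    using ex by metis
  have lim: "f \<longlonglongrightarrow> x" if "\<And>n. f n \<in> ball x (e / Suc n)" for f
  proof -
    have "(\<lambda>n. e / Suc n) \<longlonglongrightarrow> 0" using LIMSEQ_Suc[OF lim_const_over_n[of e]] by simp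
    moreover have "norm (dist (f n) x) \<le> e / Suc n" for n
      using that[of n] by (simp add: dist_commute)
    ultimately have "(\<lambda>n. dist (f n) x) \<longlonglongrightarrow> 0"
      by (rule Lim_null_comparison[OF always_eventually, OF allI, rotated])
    then show ?thesis by (rule tendsto_dist_iff[THEN iffD2])
  qed
  have c: "isCont (dir_deriv u (dir_deriv v G)) x" for u v
    using smooth_on_continuous_on[OF smooth_on_dir_deriv[OF smooth_on_dir_deriv[OF G]]]
      smooth_onD(2)[OF G] x continuous_on_eq_continuous_at by blast
  have "(\<lambda>n. dir_deriv b (dir_deriv a G) (p n)) \<longlonglongrightarrow> dir_deriv b (dir_deriv a G) x"
    using isCont_tendsto_compose[OF c[of b a] lim[of p]] pq(1) by blast
  moreover have "(\<lambda>n. dir_deriv a (dir_deriv b G) (q n)) \<longlonglongrightarrow> dir_deriv a (dir_deriv b G) x"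
    using isCont_tendsto_compose[OF c[of a b] lim[of q]] pq(2) by blast
  ultimately show ?thesis unfolding pq(3) using LIMSEQ_unique by blast
qed

text \<open>Differentiating \<open>h (t *\<^sub>R x)\<close> with respect to \<open>x\<close>
  produces a factor \<open>t\<close>. The weight \<open>w\<close> absorbs it, so the derivative is
  again an integral of this form and the induction closes. Convexity keeps the segment from 0 to
  \<open>x\<close> inside \<open>U\<close>.\<close>

lemma Ck_on_scaled_integral:
  fixes h :: "'a::euclidean_space \<Rightarrow> 'b::euclidean_space" and w :: "real \<Rightarrow> real"
  assumes U: "open U" "convex U" "0 \<in> U" and "continuous_on {0..1} w" "Ck_on k h U"
  shows "Ck_on k (\<lambda>x. integral {0..1} (\<lambda>t. w t *\<^sub>R h (t *\<^sub>R x))) U"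
  using assms(4,5)
proof (induction k arbitrary: w h)
  case (0 w h)
  have inU: "t *\<^sub>R x \<in> U" if "x \<in> U" "t \<in> {0..1}" for t x
    using convexD[OF U(2) that(1) U(3), of t "1 - t"] that(2) by simp
  have "continuous_on (U \<times> {0..1}) (\<lambda>p. w (snd p) *\<^sub>R h (snd p *\<^sub>R fst p))"
    using 0 inU by (auto intro!: continuous_intros continuous_on_compose2[of U h] continuous_on_compose2[of "{0..1}" w])
  then show ?case
    using integral_continuous_on_param[of U 0 1 "\<lambda>x t. w t *\<^sub>R h (t *\<^sub>R x)"]
    by (simp add: case_prod_unfold)
next
  case (Suc k w h)
  have inU: "t *\<^sub>R x \<in> U" if "x \<in> U" "t \<in> {0..1}" for t x
    using convexD[OF U(2) that(1) U(3), of t "1 - t"] that(2) by simp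
  let ?h' = "\<lambda>y. frechet_derivative h (at y)"
  \<comment> \<open>Differentiation under the integral sign asks for a derivative that is continuous
    as a bounded operator; in finite dimension this can be checked on basis vectors.\<close>
  define fx where "fx x t = (w t * t) *\<^sub>R Blinfun (?h' (t *\<^sub>R x))" for x t
  have bl: "bounded_linear (?h' y)" if "y \<in> U" for y
    using has_derivative_bounded_linear[OF Ck_on_Suc_has_derivative[OF Suc.prems(2) that]] .
  have fx: "blinfun_apply (fx x t) v = (w t * t) *\<^sub>R ?h' (t *\<^sub>R x) v" if "x \<in> U" "t \<in> {0..1}" for x t v
    using bl[OF inU[OF that]] by (simp add: fx_def blinfun.scaleR_left bounded_linear_Blinfun_apply)
  have der: "((\<lambda>x. w t *\<^sub>R h (t *\<^sub>R x)) has_derivative blinfun_apply (fx x t)) (at x within U)"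
    if "x \<in> U" "t \<in> cbox 0 1" for x t
  proof -
    have t: "t \<in> {0..1}" using that by simp
    have "((\<lambda>x. t *\<^sub>R x) has_derivative (\<lambda>v. t *\<^sub>R v)) (at x within U)"
      by (auto intro!: derivative_eq_intros)
    from has_derivative_compose[OF this Ck_on_Suc_has_derivative[OF Suc.prems(2) inU[OF that(1) t]]]
    have "((\<lambda>x. w t *\<^sub>R h (t *\<^sub>R x)) has_derivative (\<lambda>v. w t *\<^sub>R ?h' (t *\<^sub>R x) (t *\<^sub>R v))) (at x within U)"
      by (rule has_derivative_scaleR_right)
    then show ?thesis
      by (rule has_derivative_eq_rhs)
         (auto simp: fx[OF that(1) t] linear_cmul[OF bounded_linear.linear[OF bl[OF inU[OF that(1) t]]]])
  qed
  have ch: "continuous_on U h" using Ck_on_imp_continuous_on[OF Suc.prems(2)] .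
  have intg: "(\<lambda>t. w t *\<^sub>R h (t *\<^sub>R x)) integrable_on cbox 0 1" if "x \<in> U" for x
    using inU[OF that] ch Suc.prems(1)
    by (auto intro!: integrable_continuous_real continuous_intros continuous_on_compose2[of U h])
  have ch': "continuous_on U (\<lambda>y. ?h' y v)" for v
    using Ck_on_imp_continuous_on[of k "\<lambda>y. ?h' y v" U] Suc.prems(2) by simp
  have cont: "continuous_on (U \<times> cbox 0 1) (\<lambda>(x, t). fx x t)"
  proof (rule continuous_on_blinfun_componentwise)
    fix i :: 'a assume "i \<in> Basis"
    have "continuous_on (U \<times> {0..1}) (\<lambda>p. (w (snd p) * snd p) *\<^sub>R ?h' (snd p *\<^sub>R fst p) i)"
      using Suc.prems(1) inU
      by (auto intro!: continuous_intros continuous_on_compose2[of U "\<lambda>y. ?h' y i"]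
           continuous_on_compose2[of "{0..1}" w] ch')
    then show "continuous_on (U \<times> cbox 0 1) (\<lambda>x. blinfun_apply (case x of (x, t) \<Rightarrow> fx x t) i)"
      by (rule continuous_on_cong[THEN iffD1, rotated -1]) (auto simp: fx)
  qed
  show ?case
  proof (rule Ck_on_Suc_intro[OF \<open>open U\<close>,
        where f' = "\<lambda>x v. integral {0..1} (\<lambda>t. (w t * t) *\<^sub>R ?h' (t *\<^sub>R x) v)"])
    fix x assume x: "x \<in> U"
    have "((\<lambda>x. integral (cbox 0 1) (\<lambda>t. w t *\<^sub>R h (t *\<^sub>R x))) has_derivative
            blinfun_apply (integral (cbox 0 1) (fx x))) (at x within U)"
      using leibniz_rule[OF der intg cont x U(2)] by simp
    then have *: "((\<lambda>x. integral {0..1} (\<lambda>t. w t *\<^sub>R h (t *\<^sub>R x))) has_derivative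
            blinfun_apply (integral {0..1} (fx x))) (at x)"
      by (simp only: cbox_interval at_within_open[OF x \<open>open U\<close>])
    have "continuous_on {0..1} (\<lambda>t. fx x t)"
      using continuous_on_compose2[OF cont, of "{0..1}" "\<lambda>t. (x, t)"] x
      by (simp add: image_subset_iff continuous_on_Pair)
    then have "fx x integrable_on {0..1}" by (rule integrable_continuous_real)
    from blinfun_apply_integral[OF this]
    have "blinfun_apply (integral {0..1} (fx x)) v
        = integral {0..1} (\<lambda>t. (w t * t) *\<^sub>R ?h' (t *\<^sub>R x) v)" for v
      by (simp only:) (rule integral_cong, rule fx[OF x])
    then show "((\<lambda>x. integral {0..1} (\<lambda>t. w t *\<^sub>R h (t *\<^sub>R x))) has_derivative
        (\<lambda>v. integral {0..1} (\<lambda>t. (w t * t) *\<^sub>R ?h' (t *\<^sub>R x) v))) (at x)"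
      by (intro has_derivative_eq_rhs[OF *]) auto
  next
    fix v
    have "continuous_on {0..1} (\<lambda>t. w t * t)" using Suc.prems(1) by (intro continuous_intros)
    moreover have "Ck_on k (\<lambda>y. ?h' y v) U" using Suc.prems(2) by simp
    ultimately show "Ck_on k (\<lambda>x. integral {0..1} (\<lambda>t. (w t * t) *\<^sub>R ?h' (t *\<^sub>R x) v)) U"
      by (rule Suc.IH)
  qed
qed

lemma span_Basis_representation:
  fixes x :: "'a::euclidean_space"
  assumes "S \<subseteq> Basis" "x \<in> span S"
  shows "x = (\<Sum>b\<in>S. (x \<bullet> b) *\<^sub>R b)"
proof -
  have "x \<bullet> i = 0" if "i \<in> Basis" "i \<notin> S" for i
    using assms(2) that unfolding span_substd_basis[OF assms(1)] by auto
  then have "(\<Sum>b\<in>S. (x \<bullet> b) *\<^sub>R b) = (\<Sum>b\<in>Basis. (x \<bullet> b) *\<^sub>R b)"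
    using assms(1) by (intro sum.mono_neutral_left) auto
  then show ?thesis by (simp add: euclidean_representation)
qed

text \<open>Taylor's formula with integral remainder along the segment from 0 to \<open>x\<close>.
  The linear term vanishes because 0 is critical in the directions of \<open>S\<close>, and the
  remainder is a quadratic form with coefficients depending on \<open>x\<close>.\<close>

lemma hadamard_expansion:
  fixes G :: "'a::euclidean_space \<Rightarrow> real"
  assumes G: "smooth_on G U" and U: "convex U" "0 \<in> U" and S: "S \<subseteq> Basis"
    and crit: "\<And>b. b \<in> S \<Longrightarrow> dir_deriv b G 0 = 0" and x: "x \<in> U" "x \<in> span S"
  shows "G x = G 0 + (\<Sum>b\<in>S. \<Sum>c\<in>S.
     integral {0..1} (\<lambda>t. (1 - t) *\<^sub>R dir_deriv b (dir_deriv c G) (t *\<^sub>R x)) * ((x \<bullet> b) * (x \<bullet> c)))"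
proof -
  have inU: "t *\<^sub>R x \<in> U" if "t \<in> {0..1}" for t
    using convexD[OF U(1) x(1) U(2), of t "1 - t"] that by simp
  have xs: "x = (\<Sum>b\<in>S. (x \<bullet> b) *\<^sub>R b)" by (rule span_Basis_representation[OF S x(2)])
  have exp: "dir_deriv x f y = (\<Sum>b\<in>S. (x \<bullet> b) * dir_deriv b f y)"
    if "smooth_on f U" "y \<in> U" for f :: "'a \<Rightarrow> real" and y
    by (subst xs) (simp only: dir_deriv_sum[OF that] real_scaleR_def)
  let ?h2 = "\<lambda>t. dir_deriv x (dir_deriv x G) (t *\<^sub>R x)"
  have h2: "?h2 t = (\<Sum>b\<in>S. \<Sum>c\<in>S. dir_deriv b (dir_deriv c G) (t *\<^sub>R x) * ((x \<bullet> b) * (x \<bullet> c)))"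
    if "t \<in> {0..1}" for t
  proof -
    have "?h2 t = (\<Sum>c\<in>S. (x \<bullet> c) * dir_deriv c (dir_deriv x G) (t *\<^sub>R x))"
      by (rule exp[OF smooth_on_dir_deriv[OF G] inU[OF that]])
    also have "\<dots> = (\<Sum>c\<in>S. (x \<bullet> c) * dir_deriv x (dir_deriv c G) (t *\<^sub>R x))"
      by (simp only: dir_deriv_commute[OF G inU[OF that], of _ x])
    also have "\<dots> = (\<Sum>c\<in>S. (x \<bullet> c) * (\<Sum>b\<in>S. (x \<bullet> b) * dir_deriv b (dir_deriv c G) (t *\<^sub>R x)))"
      by (simp only: exp[OF smooth_on_dir_deriv[OF G] inU[OF that]])
    also have "\<dots> = (\<Sum>c\<in>S. \<Sum>b\<in>S. dir_deriv b (dir_deriv c G) (t *\<^sub>R x) * ((x \<bullet> b) * (x \<bullet> c)))"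
      by (simp only: sum_distrib_left mult_ac)
    finally show ?thesis by (subst sum.swap)
  qed
  \<comment> \<open>Chosen so that the two first-order terms cancel in the derivative and only
    \<open>1 - t\<close> times the second derivative remains.\<close>
  let ?H = "\<lambda>t. (1 - t) *\<^sub>R dir_deriv x G (t *\<^sub>R x) + G (t *\<^sub>R x)"
  have "((\<lambda>t. (1 - t) *\<^sub>R ?h2 t) has_integral ?H 1 - ?H 0) {0..1}"
  proof (rule fundamental_theorem_of_calculus[where f = ?H])
    fix t :: real assume t: "t \<in> {0..1}"
    have 1: "((\<lambda>s. dir_deriv x G (s *\<^sub>R x)) has_vector_derivative ?h2 t) (at t within {0..1})"
      using smooth_on_line_derivative[OF smooth_on_dir_deriv[OF G], of 0 t x x] inU[OF t] by simp
    have 2: "((\<lambda>s. G (s *\<^sub>R x)) has_vector_derivative dir_deriv x G (t *\<^sub>R x)) (at t within {0..1})"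
      using smooth_on_line_derivative[OF G, of 0 t x] inU[OF t] by simp
    show "(?H has_vector_derivative (1 - t) *\<^sub>R ?h2 t) (at t within {0..1})"
      using 1 2 unfolding has_real_derivative_iff_has_vector_derivative[symmetric] real_scaleR_def
      by (auto intro!: derivative_eq_intros)
  qed auto
  moreover have "dir_deriv x G 0 = 0"
    using exp[OF G U(2)] crit by simp
  ultimately have I: "((\<lambda>t. (1 - t) *\<^sub>R ?h2 t) has_integral G x - G 0) {0..1}" by simp
  have "((\<lambda>t. (1 - t) *\<^sub>R dir_deriv b (dir_deriv c G) (t *\<^sub>R x)) has_integral
      integral {0..1} (\<lambda>t. (1 - t) *\<^sub>R dir_deriv b (dir_deriv c G) (t *\<^sub>R x))) {0..1}" for b c
  proof (rule integrable_integral, rule integrable_continuous_real)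
    show "continuous_on {0..1} (\<lambda>t. (1 - t) *\<^sub>R dir_deriv b (dir_deriv c G) (t *\<^sub>R x))"
      using inU smooth_on_continuous_on[OF smooth_on_dir_deriv[OF smooth_on_dir_deriv[OF G]], of b c]
      by (auto intro!: continuous_intros continuous_on_compose2[of U "dir_deriv b (dir_deriv c G)"])
  qed
  then have "((\<lambda>t. \<Sum>b\<in>S. \<Sum>c\<in>S. (1 - t) *\<^sub>R dir_deriv b (dir_deriv c G) (t *\<^sub>R x) * ((x \<bullet> b) * (x \<bullet> c)))
     has_integral (\<Sum>b\<in>S. \<Sum>c\<in>S.
     integral {0..1} (\<lambda>t. (1 - t) *\<^sub>R dir_deriv b (dir_deriv c G) (t *\<^sub>R x)) * ((x \<bullet> b) * (x \<bullet> c)))) {0..1}"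
    using finite_subset[OF S finite_Basis]
    by (intro has_integral_sum has_integral_mult_left) auto
  moreover have "(\<Sum>b\<in>S. \<Sum>c\<in>S. (1 - t) *\<^sub>R dir_deriv b (dir_deriv c G) (t *\<^sub>R x) * ((x \<bullet> b) * (x \<bullet> c)))
      = (1 - t) *\<^sub>R ?h2 t" if "t \<in> {0..1}" for t
    unfolding h2[OF that] by (simp add: sum_distrib_left mult_ac)
  ultimately have "((\<lambda>t. (1 - t) *\<^sub>R ?h2 t) has_integral (\<Sum>b\<in>S. \<Sum>c\<in>S.
     integral {0..1} (\<lambda>t. (1 - t) *\<^sub>R dir_deriv b (dir_deriv c G) (t *\<^sub>R x)) * ((x \<bullet> b) * (x \<bullet> c)))) {0..1}"
    using has_integral_cong[of "{0..1}"] by (metis (no_types, lifting))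
  from has_integral_unique[OF this I] show ?thesis by simp
qed

section \<open>Smooth inverse functions\<close>

text \<open>A product rule with a merely continuous second factor: \<open>f\<close> is of first
  order near \<open>x\<close>, so replacing \<open>g y\<close> by \<open>g x\<close> costs less than
  first order. It differentiates inverse families, whose differentiability is still open at that
  stage, and the new coordinates at 0 when squares are completed.\<close>

lemma has_derivative_scaleR_vanishing:
  fixes f :: "'a::real_normed_vector \<Rightarrow> real" and g :: "'a \<Rightarrow> 'b::real_normed_vector"
  assumes f: "(f has_derivative f') (at x)" and f0: "f x = 0" and g: "isCont g x"
  shows "((\<lambda>y. f y *\<^sub>R g y) has_derivative (\<lambda>h. f' h *\<^sub>R g x)) (at x)"
proof -
  interpret f': bounded_linear f' using f by (rule has_derivative_bounded_linear)
  obtain K where K: "K > 0" "\<And>h. norm (f' h) \<le> norm h * K" using f'.pos_bounded by blast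
  have "((\<lambda>y. f y *\<^sub>R (g y - g x)) has_derivative (\<lambda>h. 0)) (at x)"
    unfolding has_derivative_at_alt
  proof (intro conjI allI impI)
    fix e :: real assume e: "e > 0"
    \<comment> \<open>Tolerance 1 in the derivative estimate bounds \<open>\<bar>f y\<bar>\<close>
      by \<open>(K + 1) * norm (y - x)\<close>; hence the tolerance \<open>e / (K + 1)\<close> for
      \<open>g\<close>.\<close>
    obtain d1 where d1: "d1 > 0" "\<And>y. norm (y - x) < d1 \<Longrightarrow> norm (f y - f x - f' (y - x)) \<le> 1 * norm (y - x)"
      using f unfolding has_derivative_at_alt by (metis zero_less_one)
    have "e / (K + 1) > 0" using e K by simp
    then obtain d2 where d2: "d2 > 0" "\<And>y. dist y x < d2 \<Longrightarrow> dist (g y) (g x) < e / (K + 1)"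
      using g unfolding continuous_at_eps_delta by metis
    show "\<exists>d>0. \<forall>y. norm (y - x) < d \<longrightarrow>
        norm (f y *\<^sub>R (g y - g x) - f x *\<^sub>R (g x - g x) - 0) \<le> e * norm (y - x)"
    proof (intro exI[of _ "min d1 d2"] conjI allI impI)
      fix y assume y: "norm (y - x) < min d1 d2"
      have "\<bar>f y\<bar> \<le> norm (f y - f x - f' (y - x)) + norm (f' (y - x))"
        using f0 norm_triangle_ineq[of "f y - f x - f' (y - x)" "f' (y - x)"] by simp
      also have "\<dots> \<le> (K + 1) * norm (y - x)"
        using d1(2)[of y] K(2)[of "y - x"] y by (simp add: algebra_simps)
      finally have 1: "\<bar>f y\<bar> \<le> (K + 1) * norm (y - x)" .
      have 2: "norm (g y - g x) \<le> e / (K + 1)"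
        using d2(2)[of y] y by (simp add: dist_norm)
      have "norm (f y *\<^sub>R (g y - g x)) \<le> ((K + 1) * norm (y - x)) * (e / (K + 1))"
        using 1 2 K by (simp del: times_divide_eq_right) (intro mult_mono, auto)
      also have "\<dots> = e * norm (y - x)" using K by (simp add: field_simps)
      finally show "norm (f y *\<^sub>R (g y - g x) - f x *\<^sub>R (g x - g x) - 0) \<le> e * norm (y - x)" by simp
    qed (use d1 d2 in auto)
  qed simp
  moreover have "((\<lambda>y. f y *\<^sub>R g x) has_derivative (\<lambda>h. f' h *\<^sub>R g x)) (at x)"
    using f by (rule has_derivative_scaleR_left)
  ultimately have "((\<lambda>y. f y *\<^sub>R g x + f y *\<^sub>R (g y - g x)) has_derivative (\<lambda>h. f' h *\<^sub>R g x + 0)) (at x)"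
    by (intro has_derivative_add)
  then show ?thesis by (simp add: algebra_simps)
qed

lemma linear_Basis_expansion:
  fixes f :: "'a::euclidean_space \<Rightarrow> 'b::real_vector"
  assumes "linear f"
  shows "f u = (\<Sum>b\<in>Basis. (u \<bullet> b) *\<^sub>R f b)"
proof -
  have "f u = f (\<Sum>b\<in>Basis. (u \<bullet> b) *\<^sub>R b)" by (simp only: euclidean_representation)
  then show ?thesis by (simp only: linear_sum[OF assms] linear_cmul[OF assms])
qed

text \<open>The constant is a minimum over a compact set, a closed ball around \<open>x0\<close>
  times the unit sphere; injectivity makes it positive. Joint continuity follows from continuity for
  each fixed vector by expansion in \<open>Basis\<close>.\<close>

lemma invertible_family_lower_bound:
  fixes A :: "'a::euclidean_space \<Rightarrow> 'b::euclidean_space \<Rightarrow> 'b"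
  assumes U: "open U" "x0 \<in> U" and lin: "\<And>x. x \<in> U \<Longrightarrow> linear (A x)"
    and inj: "\<And>x u. x \<in> U \<Longrightarrow> A x u = 0 \<Longrightarrow> u = 0" and cont: "\<And>v. continuous_on U (\<lambda>x. A x v)"
  shows "\<exists>c>0. \<exists>r>0. cball x0 r \<subseteq> U \<and> (\<forall>x\<in>cball x0 r. \<forall>u. c * norm u \<le> norm (A x u))"
proof -
  obtain r where r: "r > 0" "cball x0 r \<subseteq> U" using U open_contains_cball by blast
  define K where "K = cball x0 r \<times> (sphere 0 1 :: 'b set)"
  have "compact K" unfolding K_def by (intro compact_Times) auto
  moreover have "K \<noteq> {}" using r by (auto simp: K_def)
  moreover have "continuous_on K (\<lambda>p. norm (A (fst p) (snd p)))"
  proof -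
    have "continuous_on K (\<lambda>p. \<Sum>b\<in>Basis. (snd p \<bullet> b) *\<^sub>R A (fst p) b)"
      using r by (auto intro!: continuous_intros continuous_on_compose2[OF cont] simp: K_def)
    moreover have "(\<Sum>b\<in>Basis. (snd p \<bullet> b) *\<^sub>R A (fst p) b) = A (fst p) (snd p)" if "p \<in> K" for p
      using linear_Basis_expansion[OF lin, of "fst p" "snd p"] r that by (auto simp: K_def)
    ultimately have "continuous_on K (\<lambda>p. A (fst p) (snd p))"
      by (metis (no_types, lifting) continuous_on_cong)
    then show ?thesis by (intro continuous_intros)
  qed
  ultimately obtain p where p: "p \<in> K" "\<And>q. q \<in> K \<Longrightarrow> norm (A (fst p) (snd p)) \<le> norm (A (fst q) (snd q))"
    using continuous_attains_inf[of K] by blast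
  define c where "c = norm (A (fst p) (snd p))"
  have "snd p \<noteq> 0" "fst p \<in> U" using p(1) r by (auto simp: K_def)
  then have c: "c > 0" using inj by (auto simp: c_def)
  have "c * norm u \<le> norm (A x u)" if x: "x \<in> cball x0 r" for x u
  proof (cases "u = 0")
    case False
    have "linear (A x)" using lin x r by auto
    then have "A x u = norm u *\<^sub>R A x (inverse (norm u) *\<^sub>R u)"
      using False by (simp add: linear_cmul)
    moreover have "c \<le> norm (A x (inverse (norm u) *\<^sub>R u))"
      using p(2)[of "(x, inverse (norm u) *\<^sub>R u)"] x False by (auto simp: K_def c_def)
    ultimately show ?thesis using mult_left_mono[of c "norm (A x (inverse (norm u) *\<^sub>R u))" "norm u"]
      by (simp add: mult.commute)
  qed auto
  then show ?thesis using c r by blast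
qed

text \<open>The key identity is \<open>B x v = B x0 v - B x (A x (B x0 v) - v)\<close>. With a lower
  bound on \<open>A\<close> near \<open>x0\<close> it gives continuity of \<open>B\<close>. As the
  last argument vanishes at \<open>x0\<close>, continuity of \<open>B\<close> is then enough to
  differentiate, and the resulting formula involves only \<open>B\<close> and the derivative of
  \<open>A\<close>, which drives the induction.\<close>

lemma Ck_on_inverse_family:
  fixes A B :: "'a::euclidean_space \<Rightarrow> 'b::euclidean_space \<Rightarrow> 'b"
  assumes U: "open U" and linA: "\<And>x. x \<in> U \<Longrightarrow> linear (A x)" and linB: "\<And>x. x \<in> U \<Longrightarrow> linear (B x)"
    and AB: "\<And>x v. x \<in> U \<Longrightarrow> A x (B x v) = v" and BA: "\<And>x v. x \<in> U \<Longrightarrow> B x (A x v) = v"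
    and A: "\<And>v. Ck_on (Suc k) (\<lambda>x. A x v) U"
  shows "Ck_on k (\<lambda>x. B x v) U"
proof -
  let ?A' = "\<lambda>v x. frechet_derivative (\<lambda>x. A x v) (at x)"
  have contA: "continuous_on U (\<lambda>x. A x v)" for v using Ck_on_imp_continuous_on[OF A] .
  have inj: "u = 0" if "x \<in> U" "A x u = 0" for x u
    using BA[OF that(1), of u] that(2) linear_0[OF linB[OF that(1)]] by simp
  have diff_eq: "B x v - B x0 v = - B x (A x (B x0 v) - A x0 (B x0 v))" if "x \<in> U" "x0 \<in> U" for x x0 v
    using that by (simp add: linear_diff[OF linB] AB BA)
  have contB: "isCont (\<lambda>x. B x v) x0" if x0: "x0 \<in> U" for x0 v
  proof -
    have "\<exists>c>0. \<exists>r>0. cball x0 r \<subseteq> U \<and> (\<forall>x\<in>cball x0 r. \<forall>u. c * norm u \<le> norm (A x u))"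
      by (rule invertible_family_lower_bound[OF U x0 linA]) (use inj contA in auto)
    then obtain c r where cr: "c > 0" "r > 0" "cball x0 r \<subseteq> U"
      "\<And>x u. x \<in> cball x0 r \<Longrightarrow> c * norm u \<le> norm (A x u)" by blast
    have "((\<lambda>x. B x v - B x0 v) \<longlongrightarrow> 0) (at x0)"
    proof (rule Lim_null_comparison)
      show "\<forall>\<^sub>F x in at x0. norm (B x v - B x0 v) \<le> norm (A x (B x0 v) - A x0 (B x0 v)) / c"
      proof (rule eventually_at_topological[THEN iffD2], intro exI[of _ "ball x0 r"] conjI ballI impI)
        fix x assume x: "x \<in> ball x0 r"
        then have xU: "x \<in> U" and xc: "x \<in> cball x0 r" using cr by auto
        have "c * norm (B x v - B x0 v) \<le> norm (A x (B x v - B x0 v))" using cr(4)[OF xc] .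
        also have "A x (B x v - B x0 v) = - (A x (B x0 v) - A x0 (B x0 v))"
          using x0 xU by (simp add: linear_diff[OF linA] AB)
        finally show "norm (B x v - B x0 v) \<le> norm (A x (B x0 v) - A x0 (B x0 v)) / c"
          using cr(1) by (simp only: norm_minus_cancel pos_le_divide_eq mult.commute)
      qed (use cr in auto)
      have "((\<lambda>x. A x (B x0 v)) \<longlongrightarrow> A x0 (B x0 v)) (at x0)"
        using contA U x0 by (simp add: continuous_on_eq_continuous_at isCont_def)
      then have "((\<lambda>x. norm (A x (B x0 v) - A x0 (B x0 v)) / c) \<longlongrightarrow> norm (A x0 (B x0 v) - A x0 (B x0 v)) / c) (at x0)"
        using cr(1) by (intro tendsto_intros) auto
      then show "((\<lambda>x. norm (A x (B x0 v) - A x0 (B x0 v)) / c) \<longlongrightarrow> 0) (at x0)" by simp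
    qed
    then show ?thesis by (simp add: isCont_def LIM_zero_iff)
  qed
  have derB: "((\<lambda>x. B x v) has_derivative
      (\<lambda>h. - (\<Sum>b\<in>Basis. ((\<Sum>c\<in>Basis. (B x0 v \<bullet> c) *\<^sub>R ?A' c x0 h) \<bullet> b) *\<^sub>R B x0 b))) (at x0)"
    if x0: "x0 \<in> U" for x0 v
  proof -
    \<comment> \<open>This is \<open>A x (B x0 v) - v\<close> with \<open>A x\<close> evaluated at
      basis vectors, where its derivative is known.\<close>
    let ?w = "\<lambda>x. (\<Sum>c\<in>Basis. (B x0 v \<bullet> c) *\<^sub>R A x c) - v"
    have w: "?w x = A x (B x0 v) - A x0 (B x0 v)" if "x \<in> U" for x
      using linear_Basis_expansion[OF linA[OF that], of "B x0 v"] x0 by (simp add: AB)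
    have dw: "(?w has_derivative (\<lambda>h. \<Sum>c\<in>Basis. (B x0 v \<bullet> c) *\<^sub>R ?A' c x0 h)) (at x0)"
      by (rule has_derivative_eq_rhs[OF has_derivative_diff[OF has_derivative_sum[OF
            has_derivative_scaleR_right[OF Ck_on_Suc_has_derivative[OF A x0]]] has_derivative_const]]) simp
    have "((\<lambda>x. (?w x \<bullet> b) *\<^sub>R B x b) has_derivative
        (\<lambda>h. ((\<Sum>c\<in>Basis. (B x0 v \<bullet> c) *\<^sub>R ?A' c x0 h) \<bullet> b) *\<^sub>R B x0 b)) (at x0)" for b
      by (rule has_derivative_scaleR_vanishing[OF has_derivative_inner_left[OF dw] _ contB[OF x0]])
         (simp add: w[OF x0])
    then have "((\<lambda>x. B x0 v - (\<Sum>b\<in>Basis. (?w x \<bullet> b) *\<^sub>R B x b)) has_derivative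
      (\<lambda>h. 0 - (\<Sum>b\<in>Basis. ((\<Sum>c\<in>Basis. (B x0 v \<bullet> c) *\<^sub>R ?A' c x0 h) \<bullet> b) *\<^sub>R B x0 b))) (at x0)"
      by (intro has_derivative_diff has_derivative_sum has_derivative_const)
    moreover have "B x0 v - (\<Sum>b\<in>Basis. (?w x \<bullet> b) *\<^sub>R B x b) = B x v" if x: "x \<in> U" for x
    proof -
      have "(\<Sum>b\<in>Basis. (?w x \<bullet> b) *\<^sub>R B x b) = B x (?w x)"
        by (rule linear_Basis_expansion[OF linB[OF x], symmetric])
      also have "\<dots> = B x0 v - B x v" unfolding w[OF x] using diff_eq[OF x x0, of v]
        by (metis minus_diff_eq minus_minus)
      finally show ?thesis by simp
    qed
    ultimately show ?thesis
      using has_derivative_transform_within_open[OF _ U x0] by fastforce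
  qed
  show ?thesis using A
  proof (induction k arbitrary: v)
    case 0
    then show ?case using contB by (simp add: continuous_at_imp_continuous_on)
  next
    case (Suc k)
    have "Ck_on (Suc k) (\<lambda>x. A x v) U" for v using Suc.prems by (rule Ck_on_Suc_imp)
    then have B: "Ck_on k (\<lambda>x. B x v) U" for v by (rule Suc.IH)
    have A': "Ck_on k (\<lambda>x. ?A' c x h) U" for c h
    proof -
      have "Ck_on (Suc k) (\<lambda>x. ?A' c x h) U"
        using Suc.prems[of c] by (subst (asm) Ck_on.simps(2)) blast
      then show ?thesis by (rule Ck_on_Suc_imp)
    qed
    show ?case
    proof (rule Ck_on_Suc_intro[OF U derB])
      fix h
      show "Ck_on k (\<lambda>x. - (\<Sum>b\<in>Basis. ((\<Sum>c\<in>Basis. (B x v \<bullet> c) *\<^sub>R ?A' c x h) \<bullet> b) *\<^sub>R B x b)) U"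
        by (intro Ck_on_minus Ck_on_sum Ck_on_scaleR Ck_on_inner Ck_on_const B A' U)
    qed (use U in auto)
  qed
qed

text \<open>The inverse function theorem of first order gives a continuous \<open>g\<close> whose
  derivative is the inverse of the derivative of \<open>f\<close> at \<open>g y\<close>. If
  \<open>g\<close> has class \<open>k\<close>, so does this expression, and \<open>g\<close> has
  class \<open>Suc k\<close>. Injectivity of the derivative of \<open>g\<close> is recorded because
  coordinate changes must preserve immersions.\<close>

lemma smooth_inverse_function:
  fixes f :: "'a::euclidean_space \<Rightarrow> 'a"
  assumes f: "smooth_on f U" and x0: "x0 \<in> U"
    and inj: "\<And>v. frechet_derivative f (at x0) v = 0 \<Longrightarrow> v = 0"
  obtains U' V g where "open U'" "x0 \<in> U'" "U' \<subseteq> U" "open V" "homeomorphism U' V f g" "smooth_on g V"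
    "\<And>y v. y \<in> V \<Longrightarrow> frechet_derivative g (at y) v = 0 \<Longrightarrow> v = 0"
proof -
  let ?f' = "\<lambda>x. frechet_derivative f (at x)"
  note U = smooth_onD(2)[OF f]
  have bl: "bounded_linear (?f' x)" if "x \<in> U" for x
    using has_derivative_bounded_linear[OF smooth_on_has_derivative[OF f that]] .
  define F where "F x = Blinfun (?f' x)" for x
  have F: "blinfun_apply (F x) = ?f' x" if "x \<in> U" for x
    by (simp add: F_def bounded_linear_Blinfun_apply bl[OF that])
  have contF: "continuous_on U F"
  proof (rule continuous_on_blinfun_componentwise)
    fix i :: 'a
    have "continuous_on U (\<lambda>x. ?f' x i)"
      using smooth_on_continuous_on[OF smooth_on_frechet_derivative[OF f]] .
    then show "continuous_on U (\<lambda>x. blinfun_apply (F x) i)"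
      by (rule continuous_on_cong[THEN iffD1, rotated -1]) (auto simp: F)
  qed
  have lin0: "linear (?f' x0)" using bl[OF x0] by (rule bounded_linear.linear)
  have "inj (?f' x0)"
    using inj by (simp add: linear_injective_0[OF lin0])
  then obtain h where h: "linear h" "h \<circ> ?f' x0 = id"
    using linear_injective_left_inverse[OF lin0] by blast
  define invf where "invf = Blinfun h"
  have "blinfun_apply invf = h"
    using h(1) by (simp add: invf_def bounded_linear_Blinfun_apply linear_conv_bounded_linear)
  then have "invf o\<^sub>L F x0 = id_blinfun"
    using h(2) by (intro blinfun_eqI) (simp add: F[OF x0] fun_eq_iff)
  then obtain U' V g g' where *: "open U'" "U' \<subseteq> U" "x0 \<in> U'" "open V" "homeomorphism U' V f g"
      "\<And>y. y \<in> V \<Longrightarrow> (g has_derivative g' y) (at y)"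
      "\<And>y. y \<in> V \<Longrightarrow> g' y = inv (blinfun_apply (F (g y)))"
      "\<And>y. y \<in> V \<Longrightarrow> bij (blinfun_apply (F (g y)))"
    using inverse_function_theorem[OF U _ contF x0] smooth_on_has_derivative[OF f] F by metis
  have gV: "g ` V = U'" and fU: "f ` U' = V"
    and gf: "\<And>x. x \<in> U' \<Longrightarrow> g (f x) = x" and cg: "continuous_on V g"
    using *(5) by (auto simp: homeomorphism_def)
  have bij: "bij (?f' x)" if "x \<in> U'" for x
    using *(8)[of "f x"] F that gf fU *(2) by fastforce
  have g': "g' y = inv (?f' (g y))" if "y \<in> V" for y
    using *(7)[OF that] F that gV *(2) by (metis imageI subsetD)
  have Binv: "Ck_on k (\<lambda>x. inv (?f' x) v) U'" for k v
  proof (rule Ck_on_inverse_family[where A = ?f', OF *(1)])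
    fix x assume x: "x \<in> U'"
    show lin: "linear (?f' x)" using bl x *(2) bounded_linear.linear by blast
    show "linear (inv (?f' x))"
      using lin bij_is_inj[OF bij[OF x]] bij_is_surj[OF bij[OF x]]
      by (intro linearI inv_f_eq) (auto simp: linear_add linear_cmul surj_f_inv_f)
    show "?f' x (inv (?f' x) w) = w" "inv (?f' x) (?f' x w) = w" for w
      using bij[OF x] by (auto simp: bij_is_surj surj_f_inv_f bij_is_inj)
  next
    fix w
    show "Ck_on (Suc k) (\<lambda>x. ?f' x w) U'"
      using smooth_onD(1)[OF smooth_on_frechet_derivative[OF f]] Ck_on_subset *(2) by blast
  qed
  have Ckg: "Ck_on k g V" for k
  proof (induction k)
    case 0
    then show ?case using cg by simp
  next
    case (Suc k)
    show ?case
    proof (rule Ck_on_Suc_intro[OF *(4,6)])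
      fix v
      have "Ck_on k (\<lambda>y. inv (?f' (g y)) v) V"
        by (rule Ck_on_compose[OF *(4) *(1) _ Binv Suc.IH]) (use gV in simp)
      then show "Ck_on k (\<lambda>y. g' y v) V"
        by (rule Ck_on_cong[OF *(4), rotated]) (simp add: g')
    qed (use *(4) in auto)
  qed
  have "v = 0" if y: "y \<in> V" and "frechet_derivative g (at y) v = 0" for y v
  proof -
    have gy: "g y \<in> U'" using y gV by auto
    have "frechet_derivative g (at y) = g' y"
      using frechet_derivative_at[OF *(6)[OF y]] by simp
    then have "inv (?f' (g y)) v = 0" using that g'[OF y] by simp
    then have "v = ?f' (g y) 0"
      using surj_f_inv_f[OF bij_is_surj[OF bij[OF gy]], of v] by simp
    also have "\<dots> = 0" using bl[of "g y"] gy *(2) linear_0 bounded_linear.linear by blast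
    finally show ?thesis .
  qed
  then show ?thesis
    using that *(1-5) Ckg by (simp add: smooth_on_def)
qed

section \<open>The Morse lemma\<close>

text \<open>
  The \<open>L D L\<^sup>T\<close> factorisation of \<open>H\<close> with coefficients depending smoothly on \<open>x\<close>: since the
  coefficients of the quadratic form, and not the variables, are modified, one inversion at the
  end yields Morse coordinates.
\<close>

lemma complete_squares:
  fixes H :: "'a::euclidean_space \<Rightarrow> 'a \<Rightarrow> 'a \<Rightarrow> real"
  assumes "finite S" "open U" "0 \<in> U"
    and "\<And>b c. b \<in> S \<Longrightarrow> c \<in> S \<Longrightarrow> smooth_on (H b c) U"
    and "\<And>b c x. b \<in> S \<Longrightarrow> c \<in> S \<Longrightarrow> x \<in> U \<Longrightarrow> H b c x = H c b x"
    and "\<And>b c. b \<in> S \<Longrightarrow> c \<in> S \<Longrightarrow> b \<noteq> c \<Longrightarrow> H b c 0 = 0"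
    and "\<And>b. b \<in> S \<Longrightarrow> H b b 0 \<noteq> 0"
  shows "\<exists>U' y. open U' \<and> 0 \<in> U' \<and> U' \<subseteq> U \<and>
     (\<forall>b\<in>S. smooth_on (y b) U' \<and> y b 0 = 0 \<and>
        (y b has_derivative (\<lambda>v. sqrt \<bar>H b b 0\<bar> * (v \<bullet> b))) (at 0)) \<and>
     (\<forall>x\<in>U'. (\<Sum>b\<in>S. \<Sum>c\<in>S. H b c x * ((x \<bullet> b) * (x \<bullet> c))) =
        (\<Sum>b\<in>S. sgn (H b b 0) * (y b x)\<^sup>2))"
  using assms
proof (induction S arbitrary: H U rule: finite_induct)
  case empty
  then show ?case by (intro exI[of _ U]) auto
next
  case (insert a F)
  \<comment> \<open>On \<open>U1\<close> the pivot coefficient keeps its sign at 0, so that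
    \<open>s * H a a x\<close> has a smooth square root there.\<close>
  define s where "s = sgn (H a a 0)"
  have s: "s * s = 1" "s * H a a 0 = \<bar>H a a 0\<bar>" "\<bar>H a a 0\<bar> > 0"
    using insert.prems(6)[of a] by (auto simp: s_def sgn_if)
  define U1 where "U1 = {x\<in>U. s * H a a x > 0}"
  note U = \<open>open U\<close>
  have U1: "open U1"
  proof -
    have "continuous_on U (\<lambda>x. s * H a a x)"
      using smooth_on_continuous_on[OF insert.prems(3)[of a a]] by (auto intro: continuous_intros)
    then have "open (U \<inter> (\<lambda>x. s * H a a x) -` {0<..})"
      using U by (intro continuous_open_preimage) auto
    moreover have "U \<inter> (\<lambda>x. s * H a a x) -` {0<..} = U1" by (auto simp: U1_def)
    ultimately show ?thesis by simp
  qed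
  have U1U: "U1 \<subseteq> U" and zU1: "0 \<in> U1" using s insert.prems(2) by (auto simp: U1_def)
  have nz: "H a a x \<noteq> 0" if "x \<in> U1" for x using that by (auto simp: U1_def)
  have sm: "smooth_on (H b c) U1" if "b \<in> insert a F" "c \<in> insert a F" for b c
    using smooth_on_subset[OF insert.prems(3)[OF that] U1U U1] .
  have H0: "H a c 0 = 0" if "c \<in> F" for c
    using insert.prems(5)[of a c] that insert.hyps(2) by auto
  \<comment> \<open>\<open>H'\<close> is the Schur complement of the pivot, and
    \<open>H a a x\<close> times the square of \<open>l x\<close> absorbs all terms containing
    \<open>x \<bullet> a\<close>. As \<open>H\<close> is diagonal at 0, the correction vanishes
    there, so no later pivot degenerates and all signs persist.\<close>
  define H' where "H' b c x = H b c x - H a b x * H a c x / H a a x" for b c x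
  define l where "l x = x \<bullet> a + (\<Sum>c\<in>F. (x \<bullet> c) * (H a c x / H a a x))" for x
  define ya where "ya x = sqrt (s * H a a x) * l x" for x
  have H'0: "H' b c 0 = H b c 0" if "b \<in> F" "c \<in> F" for b c
    using H0 that by (simp add: H'_def)
  have "\<exists>U' y. open U' \<and> 0 \<in> U' \<and> U' \<subseteq> U1 \<and>
     (\<forall>b\<in>F. smooth_on (y b) U' \<and> y b 0 = 0 \<and>
        (y b has_derivative (\<lambda>v. sqrt \<bar>H' b b 0\<bar> * (v \<bullet> b))) (at 0)) \<and>
     (\<forall>x\<in>U'. (\<Sum>b\<in>F. \<Sum>c\<in>F. H' b c x * ((x \<bullet> b) * (x \<bullet> c))) =
        (\<Sum>b\<in>F. sgn (H' b b 0) * (y b x)\<^sup>2))"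
  proof (rule insert.IH[OF U1 zU1])
    show "smooth_on (H' b c) U1" if "b \<in> F" "c \<in> F" for b c
      unfolding H'_def[abs_def] using that nz
      by (intro smooth_on_diff smooth_on_divide smooth_on_mult sm) auto
    show "H' b c x = H' c b x" if "b \<in> F" "c \<in> F" "x \<in> U1" for b c x
      using insert.prems(4)[of b c x] that U1U by (auto simp: H'_def)
    show "H' b c 0 = 0" if "b \<in> F" "c \<in> F" "b \<noteq> c" for b c
      using insert.prems(5)[of b c] that by (simp add: H'0)
    show "H' b b 0 \<noteq> 0" if "b \<in> F" for b
      using insert.prems(6)[of b] that by (simp add: H'0)
  qed
  then obtain U' y where U': "open U'" "0 \<in> U'" "U' \<subseteq> U1"
    and y: "\<And>b. b \<in> F \<Longrightarrow> smooth_on (y b) U'" "\<And>b. b \<in> F \<Longrightarrow> y b 0 = 0"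
      "\<And>b. b \<in> F \<Longrightarrow> (y b has_derivative (\<lambda>v. sqrt \<bar>H' b b 0\<bar> * (v \<bullet> b))) (at 0)"
    and sq: "\<And>x. x \<in> U' \<Longrightarrow> (\<Sum>b\<in>F. \<Sum>c\<in>F. H' b c x * ((x \<bullet> b) * (x \<bullet> c))) =
        (\<Sum>b\<in>F. sgn (H' b b 0) * (y b x)\<^sup>2)"
    by blast
  have sratio: "smooth_on (\<lambda>x. H a c x / H a a x) U1" if "c \<in> F" for c
    using nz that by (intro smooth_on_divide sm) auto
  have ssqrt: "smooth_on (\<lambda>x. sqrt (s * H a a x)) U1"
    using U1 by (intro smooth_on_sqrt smooth_on_mult smooth_on_const sm) (auto simp: U1_def)
  have sl: "smooth_on l U1"
    unfolding l_def[abs_def] using U1 sratio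
    by (intro smooth_on_add smooth_on_sum smooth_on_mult smooth_on_inner_const) auto
  have sya: "smooth_on ya U'"
    unfolding ya_def[abs_def]
    by (intro smooth_on_subset[OF smooth_on_mult[OF ssqrt sl] U'(3,1)])
  have isC: "isCont f 0" if "smooth_on f U1" for f :: "'a \<Rightarrow> real"
    using smooth_on_continuous_on[OF that] U1 zU1 by (simp add: continuous_on_eq_continuous_at)
  \<comment> \<open>The ratios \<open>H a c x / H a a x\<close> vanish at 0, so to first order
    \<open>l\<close> is the coordinate \<open>x \<bullet> a\<close> alone.\<close>
  have dc: "((\<lambda>x. (x \<bullet> c) *\<^sub>R (H a c x / H a a x)) has_derivative
               (\<lambda>h. (h \<bullet> c) *\<^sub>R (H a c 0 / H a a 0))) (at 0)" if "c \<in> F" for c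
    by (rule has_derivative_scaleR_vanishing[OF _ _ isC[OF sratio[OF that]]])
       (auto intro!: derivative_eq_intros)
  have "((\<lambda>x. x \<bullet> a + (\<Sum>c\<in>F. (x \<bullet> c) *\<^sub>R (H a c x / H a a x))) has_derivative
       (\<lambda>h. h \<bullet> a + (\<Sum>c\<in>F. (h \<bullet> c) *\<^sub>R (H a c 0 / H a a 0)))) (at 0)"
    by (intro has_derivative_add has_derivative_sum dc has_derivative_inner_left has_derivative_ident)
  then have dl: "(l has_derivative (\<lambda>h. h \<bullet> a)) (at 0)"
    by (simp add: l_def[abs_def] H0)
  have "((\<lambda>x. l x *\<^sub>R sqrt (s * H a a x)) has_derivative (\<lambda>h. (h \<bullet> a) *\<^sub>R sqrt (s * H a a 0))) (at 0)"
    by (rule has_derivative_scaleR_vanishing[OF dl _ isC[OF ssqrt]]) (simp add: l_def)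
  then have dya: "(ya has_derivative (\<lambda>h. sqrt \<bar>H a a 0\<bar> * (h \<bullet> a))) (at 0)"
    by (simp add: ya_def[abs_def] s(2) mult.commute)
  have main: "(\<Sum>b\<in>insert a F. \<Sum>c\<in>insert a F. H b c x * ((x \<bullet> b) * (x \<bullet> c))) =
      s * (ya x)\<^sup>2 + (\<Sum>b\<in>F. \<Sum>c\<in>F. H' b c x * ((x \<bullet> b) * (x \<bullet> c)))" if x: "x \<in> U'" for x
  proof -
    define h where "h = H a a x"
    define T where "T = (\<Sum>c\<in>F. H a c x * (x \<bullet> c))"
    define R where "R = (\<Sum>b\<in>F. \<Sum>c\<in>F. H b c x * ((x \<bullet> b) * (x \<bullet> c)))"
    have xU: "x \<in> U" and h: "h \<noteq> 0" and sh: "s * h > 0"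
      using x U'(3) U1U nz by (auto simp: h_def U1_def)
    have sym: "H c a x = H a c x" if "c \<in> F" for c
      using insert.prems(4)[of c a x] that xU by simp
    have L: "(\<Sum>b\<in>insert a F. \<Sum>c\<in>insert a F. H b c x * ((x \<bullet> b) * (x \<bullet> c)))
        = h * (x \<bullet> a)\<^sup>2 + 2 * (x \<bullet> a) * T + R"
    proof -
      have "(\<Sum>c\<in>F. H a c x * ((x \<bullet> a) * (x \<bullet> c))) = (x \<bullet> a) * T"
        by (simp add: T_def sum_distrib_left mult_ac)
      moreover have "(\<Sum>b\<in>F. H b a x * ((x \<bullet> b) * (x \<bullet> a))) = (x \<bullet> a) * T"
        by (simp add: T_def sum_distrib_left mult_ac sym)
      ultimately show ?thesis
        using insert.hyps by (simp add: sum.distrib h_def R_def power2_eq_square)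
    qed
    have "(\<Sum>b\<in>F. \<Sum>c\<in>F. H a b x * H a c x / h * ((x \<bullet> b) * (x \<bullet> c))) = T * T / h"
      by (simp add: T_def sum_product sum_divide_distrib mult_ac)
    then have e1: "(\<Sum>b\<in>F. \<Sum>c\<in>F. H' b c x * ((x \<bullet> b) * (x \<bullet> c))) = R - T * T / h"
      by (simp add: H'_def R_def h_def left_diff_distrib sum_subtractf)
    have e2: "l x = x \<bullet> a + T / h"
      by (simp add: l_def T_def h_def sum_divide_distrib mult_ac)
    have e3: "s * (ya x)\<^sup>2 = h * (l x)\<^sup>2"
    proof -
      have "(ya x)\<^sup>2 = (s * h) * (l x)\<^sup>2" using sh by (simp add: ya_def h_def power_mult_distrib)
      then show ?thesis using s(1) by (simp add: mult.assoc[symmetric])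
    qed
    show ?thesis unfolding L e1 e3 e2 using h by (simp add: power2_eq_square field_simps)
  qed
  show ?case
  proof (intro exI[of _ U'] exI[of _ "y(a := ya)"] conjI ballI)
    fix b assume b: "b \<in> insert a F"
    show "smooth_on ((y(a := ya)) b) U'" using b y(1) sya by auto
    show "(y(a := ya)) b 0 = 0" using b y(2) by (auto simp: ya_def l_def)
    show "((y(a := ya)) b has_derivative (\<lambda>v. sqrt \<bar>H b b 0\<bar> * (v \<bullet> b))) (at 0)"
      using b y(3)[of b] dya H'0[of b b] insert.hyps(2) by (cases "b = a") auto
  next
    fix x assume x: "x \<in> U'"
    have "(\<Sum>b\<in>F. sgn (H' b b 0) * (y b x)\<^sup>2) = (\<Sum>b\<in>F. sgn (H b b 0) * ((y(a := ya)) b x)\<^sup>2)"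
      using insert.hyps(2) by (intro sum.cong) (auto simp: H'0)
    then show "(\<Sum>b\<in>insert a F. \<Sum>c\<in>insert a F. H b c x * ((x \<bullet> b) * (x \<bullet> c))) =
        (\<Sum>b\<in>insert a F. sgn (H b b 0) * ((y(a := ya)) b x)\<^sup>2)"
      using main[OF x] sq[OF x] insert.hyps by (simp add: s_def)
  qed (use U' U1U in auto)
qed

text \<open>On \<open>span S\<close> the expansion of \<open>G\<close> is a quadratic form, and
  completing squares supplies the coordinates in \<open>S\<close>. Those outside \<open>S\<close>
  are kept, which makes \<open>Y\<close> a map of the whole ambient space with invertible derivative
  at 0; for the same reason its inverse \<open>\<psi>\<close> preserves
  \<open>span S\<close>.\<close>

lemma morse_normal_form_diagonal:
  fixes G :: "'a::euclidean_space \<Rightarrow> real"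
  assumes G: "smooth_on G U" and U0: "0 \<in> U" and S: "S \<subseteq> Basis"
    and "\<forall>b\<in>S. dir_deriv b G 0 = 0"
    and "\<forall>b\<in>S. \<forall>c\<in>S. b \<noteq> c \<longrightarrow> dir_deriv b (dir_deriv c G) 0 = 0"
    and "\<forall>b\<in>S. dir_deriv b (dir_deriv b G) 0 \<noteq> 0"
  obtains V W \<psi> Y where "open V" "0 \<in> V" "open W" "W \<subseteq> U" "smooth_on \<psi> V" "homeomorphism W V Y \<psi>" "\<psi> 0 = 0"
    "\<And>y v. y \<in> V \<Longrightarrow> frechet_derivative \<psi> (at y) v = 0 \<Longrightarrow> v = 0"
    "\<And>y b. y \<in> V \<Longrightarrow> b \<in> Basis - S \<Longrightarrow> \<psi> y \<bullet> b = y \<bullet> b"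
    "\<And>y. y \<in> V \<inter> span S \<Longrightarrow>
       G (\<psi> y) = G 0 + (\<Sum>b\<in>S. sgn (dir_deriv b (dir_deriv b G) 0) * (y \<bullet> b)\<^sup>2)"
proof -
  have crit: "dir_deriv b G 0 = 0" and diag: "dir_deriv b (dir_deriv b G) 0 \<noteq> 0" if "b \<in> S" for b
    using assms(4,6) that by auto
  have off: "dir_deriv b (dir_deriv c G) 0 = 0" if "b \<in> S" "c \<in> S" "b \<noteq> c" for b c
    using assms(5) that by auto
  \<comment> \<open>A ball, because the expansion runs along segments to the origin.\<close>
  obtain r where r: "r > 0" "ball 0 r \<subseteq> U" using smooth_onD(2)[OF G] U0 openE by blast
  let ?D = "\<lambda>b c. dir_deriv b (dir_deriv c G)"
  have G': "smooth_on G (ball 0 r)" using smooth_on_subset[OF G r(2)] by simp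
  define H where "H b c x = integral {0..1} (\<lambda>t. (1 - t) *\<^sub>R ?D b c (t *\<^sub>R x))" for b c x
  have fin: "finite S" using S finite_Basis finite_subset by blast
  \<comment> \<open>The factor is the integral of \<open>1 - t\<close> over the unit interval; being
    positive, it leaves signs and zeros unchanged.\<close>
  have H0: "H b c 0 = ?D b c 0 / 2" for b c
  proof -
    have "((\<lambda>t. (1 - t) * ?D b c 0) has_integral (1 - 1 / 2) * ?D b c 0) {0..1}"
      using ident_has_integral[of 0 1] has_integral_const_real[of "1::real" 0 1]
      by (intro has_integral_mult_left has_integral_diff) auto
    then have "H b c 0 = (1 - 1 / 2) * ?D b c 0"
      unfolding H_def scaleR_zero_right real_scaleR_def by (rule integral_unique)
    then show ?thesis by simp
  qed
  have smH: "smooth_on (H b c) (ball 0 r)" for b c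
    unfolding H_def[abs_def] smooth_on_def
    using r smooth_onD(1)[OF smooth_on_dir_deriv[OF smooth_on_dir_deriv[OF G']]]
    by (intro conjI allI Ck_on_scaled_integral) (auto intro!: continuous_intros)
  have symH: "H b c x = H c b x" if x: "x \<in> ball 0 r" for b c x
    unfolding H_def
  proof (rule integral_cong)
    fix t :: real assume t: "t \<in> {0..1}"
    have "t *\<^sub>R x \<in> ball 0 r"
      using convexD[OF convex_ball[of 0 r] x, of 0 t "1 - t"] t r by simp
    then show "(1 - t) *\<^sub>R ?D b c (t *\<^sub>R x) = (1 - t) *\<^sub>R ?D c b (t *\<^sub>R x)"
      using dir_deriv_commute[OF G'] by simp
  qed
  have "\<exists>U' y. open U' \<and> 0 \<in> U' \<and> U' \<subseteq> ball 0 r \<and>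
     (\<forall>b\<in>S. smooth_on (y b) U' \<and> y b 0 = 0 \<and>
        (y b has_derivative (\<lambda>v. sqrt \<bar>H b b 0\<bar> * (v \<bullet> b))) (at 0)) \<and>
     (\<forall>x\<in>U'. (\<Sum>b\<in>S. \<Sum>c\<in>S. H b c x * ((x \<bullet> b) * (x \<bullet> c))) =
        (\<Sum>b\<in>S. sgn (H b b 0) * (y b x)\<^sup>2))"
    by (rule complete_squares[OF fin]) (use r smH symH off diag in \<open>auto simp: H0\<close>)
  then obtain U' y where U': "open U'" "0 \<in> U'" "U' \<subseteq> ball 0 r"
    and y: "\<And>b. b \<in> S \<Longrightarrow> smooth_on (y b) U'" "\<And>b. b \<in> S \<Longrightarrow> y b 0 = 0"
      "\<And>b. b \<in> S \<Longrightarrow> (y b has_derivative (\<lambda>v. sqrt \<bar>H b b 0\<bar> * (v \<bullet> b))) (at 0)"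
    and sq: "\<And>x. x \<in> U' \<Longrightarrow> (\<Sum>b\<in>S. \<Sum>c\<in>S. H b c x * ((x \<bullet> b) * (x \<bullet> c))) =
        (\<Sum>b\<in>S. sgn (H b b 0) * (y b x)\<^sup>2)"
    by blast
  define Y where "Y x = (\<Sum>b\<in>S. y b x *\<^sub>R b) + (\<Sum>b\<in>Basis - S. (x \<bullet> b) *\<^sub>R b)" for x
  have comp: "((\<Sum>b\<in>S. p b *\<^sub>R b) + (\<Sum>b\<in>Basis - S. q b *\<^sub>R b)) \<bullet> c = (if c \<in> S then p c else q c)"
    if "c \<in> Basis" for p q c
  proof -
    have "(\<Sum>b\<in>S. p b *\<^sub>R b) \<bullet> c = (\<Sum>b\<in>S. if b = c then p b else 0)"
      using S that unfolding inner_sum_left by (intro sum.cong) (auto simp: inner_Basis)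
    moreover have "(\<Sum>b\<in>Basis - S. q b *\<^sub>R b) \<bullet> c = (\<Sum>b\<in>Basis - S. if b = c then q b else 0)"
      using that unfolding inner_sum_left by (intro sum.cong) (auto simp: inner_Basis)
    ultimately show ?thesis using fin that by (auto simp: inner_add_left)
  qed
  have smY: "smooth_on Y U'"
    unfolding Y_def[abs_def] using U'(1) y(1)
    by (intro smooth_on_add smooth_on_sum smooth_on_scaleR smooth_on_const smooth_on_inner_const) auto
  have "(Y has_derivative (\<lambda>v. (\<Sum>b\<in>S. (sqrt \<bar>H b b 0\<bar> * (v \<bullet> b)) *\<^sub>R b) + (\<Sum>b\<in>Basis - S. (v \<bullet> b) *\<^sub>R b))) (at 0)"
    unfolding Y_def[abs_def]
    by (intro has_derivative_add has_derivative_sum has_derivative_scaleR_left y(3)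
        has_derivative_inner_left has_derivative_ident)
  note dY0 = frechet_derivative_at[OF this, symmetric]
  have dY: "frechet_derivative Y (at 0) v \<bullet> c = (if c \<in> S then sqrt \<bar>H c c 0\<bar> * (v \<bullet> c) else v \<bullet> c)"
    if "c \<in> Basis" for v c
    unfolding dY0 by (rule comp[OF that])
  have injY: "v = 0" if "frechet_derivative Y (at 0) v = 0" for v
  proof (rule euclidean_eqI)
    fix c :: 'a assume c: "c \<in> Basis"
    have "H c c 0 \<noteq> 0" if "c \<in> S" using diag[OF that] by (simp add: H0)
    then show "v \<bullet> c = 0 \<bullet> c" using dY[OF c, of v] that by (auto split: if_splits)
  qed
  obtain W V \<psi> where W: "open W" "0 \<in> W" "W \<subseteq> U'" "open V" "homeomorphism W V Y \<psi>" "smooth_on \<psi> V"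
    "\<And>y v. y \<in> V \<Longrightarrow> frechet_derivative \<psi> (at y) v = 0 \<Longrightarrow> v = 0"
    using smooth_inverse_function[OF smY U'(2) injY] by metis
  have hom: "\<And>x. x \<in> W \<Longrightarrow> \<psi> (Y x) = x" "\<And>z. z \<in> V \<Longrightarrow> Y (\<psi> z) = z" "Y ` W = V" "\<psi> ` V = W"
    using W(5) by (auto simp: homeomorphism_def)
  have "Y 0 = 0" by (simp add: Y_def y(2))
  then have V0: "0 \<in> V" "\<psi> 0 = 0" using hom W(2) by force+
  have Yc: "Y x \<bullet> c = (if c \<in> S then y c x else x \<bullet> c)" if "c \<in> Basis" for x c
    unfolding Y_def by (rule comp[OF that])
  have rest: "\<psi> z \<bullet> b = z \<bullet> b" if "z \<in> V" "b \<in> Basis - S" for z b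
    using Yc[of b "\<psi> z"] that hom(2)[of z] by auto
  have "G (\<psi> z) = G 0 + (\<Sum>b\<in>S. sgn (?D b b 0) * (z \<bullet> b)\<^sup>2)" if z: "z \<in> V \<inter> span S" for z
  proof -
    have w: "\<psi> z \<in> W" using z hom(4) by auto
    then have b: "\<psi> z \<in> ball 0 r" "\<psi> z \<in> U'" using W(3) U'(3) by auto
    have sp: "\<psi> z \<in> span S"
      using z rest unfolding span_substd_basis[OF S] by auto
    have "G (\<psi> z) = G 0 + (\<Sum>b\<in>S. \<Sum>c\<in>S. H b c (\<psi> z) * ((\<psi> z \<bullet> b) * (\<psi> z \<bullet> c)))"
      unfolding H_def
      by (rule hadamard_expansion[OF G' convex_ball _ S crit b(1) sp]) (use r in auto)
    also have "\<dots> = G 0 + (\<Sum>b\<in>S. sgn (H b b 0) * (y b (\<psi> z))\<^sup>2)" using sq[OF b(2)] by simp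
    also have "\<dots> = G 0 + (\<Sum>b\<in>S. sgn (?D b b 0) * (z \<bullet> b)\<^sup>2)"
    proof -
      have "sgn (H b b 0) * (y b (\<psi> z))\<^sup>2 = sgn (?D b b 0) * (z \<bullet> b)\<^sup>2" if "b \<in> S" for b
      proof -
        have "y b (\<psi> z) = z \<bullet> b"
          using Yc[of b "\<psi> z"] that S hom(2)[of z] z by auto
        then show ?thesis by (simp add: H0 sgn_divide)
      qed
      then show ?thesis by simp
    qed
    finally show ?thesis .
  qed
  then show ?thesis
    using that[of V W \<psi> Y] W V0 rest U'(3) r(2) by blast
qed

section \<open>Eigenvectors of a symmetric operator and the count of negative eigenvalues\<close>

text \<open>A maximiser of \<open>v \<bullet> T v\<close> on the unit sphere of \<open>S\<close> is
  an eigenvector, and its orthogonal complement in \<open>S\<close> is invariant and of smaller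
  dimension. Since the induction descends to subspaces, invariance and symmetry are relative to
  \<open>S\<close>.\<close>

lemma symmetric_orthonormal_eigenbasis:
  fixes T :: "'a::euclidean_space \<Rightarrow> 'a"
  assumes T: "linear T" and "subspace S" "\<And>v. v \<in> S \<Longrightarrow> T v \<in> S"
    and "\<And>u v. u \<in> S \<Longrightarrow> v \<in> S \<Longrightarrow> u \<bullet> T v = T u \<bullet> v"
  shows "\<exists>E. E \<subseteq> S \<and> pairwise orthogonal E \<and> (\<forall>e\<in>E. norm e = 1) \<and> span E = S \<and>
           (\<forall>e\<in>E. \<exists>\<mu>. T e = \<mu> *\<^sub>R e)"
  using assms(2-)
proof (induction "dim S" arbitrary: S rule: less_induct)
  case less
  note S = \<open>subspace S\<close>
  show ?case
  proof (cases "S = {0}")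
    case True
    then show ?thesis by (intro exI[of _ "{}"]) auto
  next
    case False
    then obtain w where w: "w \<in> S" "w \<noteq> 0" using subspace_0[OF S] by blast
    define K where "K = S \<inter> sphere 0 1"
    have "compact K" unfolding K_def
      by (intro closed_Int_compact closed_subspace[OF S] compact_sphere)
    moreover have "inverse (norm w) *\<^sub>R w \<in> K"
      using w subspace_scale[OF S] by (simp add: K_def)
    moreover have "continuous_on K (\<lambda>v. v \<bullet> T v)"
      using linear_continuous_on[OF linear_conv_bounded_linear[THEN iffD1, OF T]]
      by (intro continuous_intros)
    ultimately obtain e where e: "e \<in> K" "\<And>v. v \<in> K \<Longrightarrow> v \<bullet> T v \<le> e \<bullet> T e"
      using continuous_attains_sup[of K "\<lambda>v. v \<bullet> T v"] by blast
    define \<mu> where "\<mu> = e \<bullet> T e"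
    have eS: "e \<in> S" and ne: "norm e = 1" and ee: "e \<bullet> e = 1"
      using e(1) by (auto simp: K_def norm_eq_sqrt_inner)
    have max: "v \<bullet> T v \<le> \<mu> * (v \<bullet> v)" if "v \<in> S" for v
    proof (cases "v = 0")
      case False
      have "(inverse (norm v) *\<^sub>R v) \<bullet> T (inverse (norm v) *\<^sub>R v) \<le> \<mu>"
        unfolding \<mu>_def using that False subspace_scale[OF S] by (intro e(2)) (simp add: K_def)
      then have "inverse (norm v) * (inverse (norm v) * (v \<bullet> T v)) \<le> \<mu>"
        by (simp add: linear_cmul[OF T])
      then show ?thesis using False
        by (simp add: field_simps flip: power2_norm_eq_inner) (simp add: power2_eq_square mult_ac)
    qed (simp add: linear_0[OF T])
    have orth: "u \<bullet> T e = 0" if u: "u \<in> S" "u \<bullet> e = 0" for u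
    proof (rule ccontr)
      assume nz: "u \<bullet> T e \<noteq> 0"
      define p where "p = u \<bullet> T e"
      define q where "q = u \<bullet> T u - \<mu> * (u \<bullet> u)"
      \<comment> \<open>Variation of the maximiser \<open>e\<close> by \<open>t *\<^sub>R u\<close>:
        \<open>p\<close> is half the linear and \<open>q\<close> the quadratic coefficient in
        \<open>t\<close>.\<close>
      have *: "2 * t * p + t * t * q \<le> 0" for t
      proof -
        have "e + t *\<^sub>R u \<in> S" using eS u(1) S by (simp add: subspace_add subspace_scale)
        from max[OF this]
        have "(e + t *\<^sub>R u) \<bullet> (T e + t *\<^sub>R T u) \<le> \<mu> * ((e + t *\<^sub>R u) \<bullet> (e + t *\<^sub>R u))"
          by (simp add: linear_add[OF T] linear_cmul[OF T])
        moreover have "e \<bullet> T u = p"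
          using less.prems(3)[OF eS u(1)] by (simp add: p_def inner_commute)
        moreover have "e \<bullet> u = 0" using u(2) by (simp add: inner_commute)
        ultimately show ?thesis
          using u(2) ee by (simp add: inner_add_left inner_add_right p_def q_def \<mu>_def algebra_simps)
      qed
      \<comment> \<open>For this \<open>t\<close> the linear term equals
        \<open>2 * t * t * (\<bar>q\<bar> + 1)\<close>, which outweighs \<open>t * t * q\<close>;
        the summand 1 avoids division by zero.\<close>
      define t where "t = p / (\<bar>q\<bar> + 1)"
      have "\<bar>q\<bar> + 1 > 0" by arith
      then have "t * (\<bar>q\<bar> + 1) = p" by (simp add: t_def)
      then have "t * p = t * t * (\<bar>q\<bar> + 1)" by (simp only: mult.assoc)
      moreover have "t * t > 0"
        using nz \<open>\<bar>q\<bar> + 1 > 0\<close> by (auto simp: t_def p_def zero_less_mult_iff zero_less_divide_iff divide_less_0_iff)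
      moreover have "t * t * (- \<bar>q\<bar>) \<le> t * t * q" by (intro mult_left_mono) auto
      moreover have "0 \<le> t * t * \<bar>q\<bar>" by simp
      ultimately show False using *[of t] by (simp add: algebra_simps)
    qed
    have Te: "T e = \<mu> *\<^sub>R e"
    proof -
      define u where "u = T e - \<mu> *\<^sub>R e"
      have "u \<in> S" using eS less.prems(2) S by (simp add: u_def subspace_diff subspace_scale)
      moreover have ue: "u \<bullet> e = 0" by (simp add: u_def inner_diff_left inner_diff_right ee \<mu>_def inner_commute)
      ultimately have "u \<bullet> T e = 0" by (rule orth)
      then have "u \<bullet> u = 0" using ue by (simp add: u_def inner_diff_right)
      then show ?thesis by (simp add: u_def)
    qed
    define S' where "S' = {v \<in> S. v \<bullet> e = 0}"
    have S': "subspace S'"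
      using S unfolding subspace_def S'_def by (auto simp: inner_add_left)
    have "S' \<subseteq> S" "e \<notin> S'" using ee by (auto simp: S'_def)
    then have "S' \<subset> S" using eS by blast
    then have "dim S' < dim S"
      using S S' by (intro dim_psubset) (simp add: span_eq_iff[THEN iffD2])
    moreover have "T v \<in> S'" if "v \<in> S'" for v
      using that less.prems(2) less.prems(3)[of v e] eS Te by (auto simp: S'_def)
    ultimately obtain E where E: "E \<subseteq> S'" "pairwise orthogonal E" "\<forall>e\<in>E. norm e = 1" "span E = S'"
        "\<forall>e\<in>E. \<exists>\<mu>. T e = \<mu> *\<^sub>R e"
      using less.hyps[OF _ S'] less.prems(3) unfolding S'_def by (metis (no_types, lifting) mem_Collect_eq)
    show ?thesis
    proof (intro exI[of _ "insert e E"] conjI)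
      show "insert e E \<subseteq> S" using E(1) eS by (auto simp: S'_def)
      show "pairwise orthogonal (insert e E)"
        using E(1,2) by (auto simp: pairwise_insert orthogonal_def S'_def inner_commute)
      show "span (insert e E) = S"
      proof
        show "span (insert e E) \<subseteq> S"
          using E(1) eS S by (intro span_minimal) (auto simp: S'_def)
        show "S \<subseteq> span (insert e E)"
        proof
          fix v assume v: "v \<in> S"
          have "v - (v \<bullet> e) *\<^sub>R e \<in> S'"
            using v eS S ee by (simp add: S'_def subspace_diff subspace_scale inner_diff_left)
          then have "v - (v \<bullet> e) *\<^sub>R e \<in> span E" using E(4) by simp
          then show "v \<in> span (insert e E)" by (auto simp: span_insert)
        qed
      qed
    qed (use E ne Te in auto)
  qed
qed

lemma orthonormal_expansion:
  fixes E :: "'a::euclidean_space set"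
  assumes E: "pairwise orthogonal E" "\<forall>e\<in>E. norm e = 1"
  shows "finite E" "independent E" "\<And>e e'. e \<in> E \<Longrightarrow> e' \<in> E \<Longrightarrow> e \<bullet> e' = (if e = e' then 1 else 0)"
    "\<And>v. v \<in> span E \<Longrightarrow> v = (\<Sum>e\<in>E. (v \<bullet> e) *\<^sub>R e)"
proof -
  show ind: "independent E"
    using E by (intro pairwise_orthogonal_independent) (auto dest: bspec[of E _ 0])
  show fin: "finite E" using pairwise_orthogonal_imp_finite[OF E(1)] .
  show ip: "e \<bullet> e' = (if e = e' then 1 else 0)" if "e \<in> E" "e' \<in> E" for e e'
    using that E by (auto simp: pairwise_def orthogonal_def norm_eq_1)
  fix v assume "v \<in> span E"
  then obtain r where v: "v = (\<Sum>e\<in>E. r e *\<^sub>R e)" using span_finite[OF fin] by auto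
  have "v \<bullet> e = r e" if "e \<in> E" for e
  proof -
    have "v \<bullet> e = (\<Sum>e'\<in>E. if e' = e then r e' else 0)"
      unfolding v inner_sum_left using that by (intro sum.cong) (auto simp: ip)
    then show ?thesis using fin that by simp
  qed
  then show "v = (\<Sum>e\<in>E. (v \<bullet> e) *\<^sub>R e)" using v by simp
qed

text \<open>Comparing coefficients in the orthonormal eigenbasis shows that each eigenspace is
  spanned by the basis vectors with that eigenvalue. This turns the sum that defines
  \<open>negative_eigenvalues\<close> into a count of basis vectors.\<close>

lemma sum_eigenspace_dims:
  fixes T :: "'a::euclidean_space \<Rightarrow> 'a"
  assumes T: "linear T" and E: "pairwise orthogonal E" "\<forall>e\<in>E. norm e = 1"
    and ev: "\<And>e. e \<in> E \<Longrightarrow> T e = l e *\<^sub>R e"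
  shows "(\<Sum>\<mu> | \<mu> < 0 \<and> (\<exists>v\<in>span E. v \<noteq> 0 \<and> T v = \<mu> *\<^sub>R v). dim {v \<in> span E. T v = \<mu> *\<^sub>R v})
     = card {e \<in> E. l e < 0}"
proof -
  note on = orthonormal_expansion[OF E]
  have eig: "{v \<in> span E. T v = \<mu> *\<^sub>R v} = span {e\<in>E. l e = \<mu>}" for \<mu>
  proof
    show "span {e \<in> E. l e = \<mu>} \<subseteq> {v \<in> span E. T v = \<mu> *\<^sub>R v}"
    proof (rule span_minimal)
      show "{e \<in> E. l e = \<mu>} \<subseteq> {v \<in> span E. T v = \<mu> *\<^sub>R v}"
        using ev by (auto intro: span_base)
      show "subspace {v \<in> span E. T v = \<mu> *\<^sub>R v}"
        unfolding subspace_def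
        by (auto simp: linear_0[OF T] linear_add[OF T] linear_cmul[OF T] scaleR_add_right
            span_zero intro: span_add span_scale)
    qed
    show "{v \<in> span E. T v = \<mu> *\<^sub>R v} \<subseteq> span {e \<in> E. l e = \<mu>}"
    proof safe
      fix v assume v: "v \<in> span E" "T v = \<mu> *\<^sub>R v"
      have z: "v \<bullet> e = 0" if e: "e \<in> E" "l e \<noteq> \<mu>" for e
      proof -
        have "T v = T (\<Sum>e\<in>E. (v \<bullet> e) *\<^sub>R e)" using on(4)[OF v(1)] by simp
        also have "\<dots> = (\<Sum>e\<in>E. (v \<bullet> e) *\<^sub>R (l e *\<^sub>R e))"
          by (simp add: linear_sum[OF T] linear_cmul[OF T] ev)
        finally have "T v \<bullet> e = (\<Sum>e'\<in>E. if e' = e then (v \<bullet> e) * l e else 0)"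
          unfolding inner_sum_left using e(1)
          by (simp only: inner_sum_left) (intro sum.cong, auto simp: on(3))
        then have "\<mu> * (v \<bullet> e) = (v \<bullet> e) * l e" using v(2) on(1) e(1) by simp
        then show ?thesis using e(2) by auto
      qed
      have "v = (\<Sum>e\<in>E. (v \<bullet> e) *\<^sub>R e)" by (rule on(4)[OF v(1)])
      also have "\<dots> = (\<Sum>e\<in>{e \<in> E. l e = \<mu>}. (v \<bullet> e) *\<^sub>R e)"
        using on(1) z by (intro sum.mono_neutral_right) auto
      also have "\<dots> \<in> span {e \<in> E. l e = \<mu>}"
        by (intro span_sum span_scale span_base)
      finally show "v \<in> span {e \<in> E. l e = \<mu>}" .
    qed
  qed
  have dimE: "dim {v \<in> span E. T v = \<mu> *\<^sub>R v} = card {e \<in> E. l e = \<mu>}" for \<mu>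
    unfolding eig dim_span
    by (rule dim_eq_card_independent) (rule independent_mono[OF on(2)], auto)
  have ex: "(\<exists>v\<in>span E. v \<noteq> 0 \<and> T v = \<mu> *\<^sub>R v) \<longleftrightarrow> \<mu> \<in> l ` E" for \<mu>
  proof
    assume "\<mu> \<in> l ` E"
    then obtain e where "e \<in> E" "\<mu> = l e" by auto
    then show "\<exists>v\<in>span E. v \<noteq> 0 \<and> T v = \<mu> *\<^sub>R v"
      using bspec[OF E(2), of e] ev[of e] by (intro bexI[of _ e]) (auto intro: span_base)
  next
    assume "\<exists>v\<in>span E. v \<noteq> 0 \<and> T v = \<mu> *\<^sub>R v"
    then obtain v where "v \<in> span {e\<in>E. l e = \<mu>}" "v \<noteq> 0" using eig[of \<mu>] by blast
    then have "{e\<in>E. l e = \<mu>} \<noteq> {}" by (metis singletonD span_empty)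
    then show "\<mu> \<in> l ` E" by auto
  qed
  have idx: "{\<mu>. \<mu> < 0 \<and> (\<exists>v\<in>span E. v \<noteq> 0 \<and> T v = \<mu> *\<^sub>R v)} = l ` {e\<in>E. l e < 0}"
    using ex by auto
  have "card {e \<in> E. l e < 0} = card (\<Union>\<mu>\<in>l ` {e\<in>E. l e < 0}. {e\<in>E. l e = \<mu>})"
    by (rule arg_cong[where f = card]) auto
  also have "\<dots> = (\<Sum>\<mu>\<in>l ` {e\<in>E. l e < 0}. card {e\<in>E. l e = \<mu>})"
    using on(1) by (intro card_UN_disjoint) auto
  finally show ?thesis unfolding idx dimE by simp
qed

section \<open>Partial derivatives, directional derivatives and the Hessian operator\<close>

lemma partial_eq_dir_deriv:
  assumes g: "smooth_on g U" and x: "x \<in> U"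
  shows "partial b g x = dir_deriv b g x"
  using smooth_on_line_derivative[OF g, of x 0 b UNIV] x
  unfolding partial_def has_real_derivative_iff_has_vector_derivative[symmetric]
  by (auto intro: DERIV_imp_deriv)

text \<open>\<open>partial c g\<close> is identified with a directional derivative only on
  \<open>U\<close>; along a line through \<open>x\<close> this covers all small parameters, which
  suffices for the second derivative.\<close>

lemma second_partial_eq_dir_deriv:
  assumes g: "smooth_on g U" and x: "x \<in> U"
  shows "partial b (partial c g) x = dir_deriv b (dir_deriv c g) x"
proof -
  have "((\<lambda>t. dir_deriv c g (x + t *\<^sub>R b)) has_real_derivative dir_deriv b (dir_deriv c g) x) (at 0)"
    using smooth_on_line_derivative[OF smooth_on_dir_deriv[OF g], of x 0 b c UNIV] x
    unfolding has_real_derivative_iff_has_vector_derivative by simp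
  moreover have "open ((\<lambda>t. x + t *\<^sub>R b) -` U)"
    using smooth_onD(2)[OF g] by (intro continuous_open_vimage) (auto intro!: continuous_intros)
  ultimately have "((\<lambda>t. partial c g (x + t *\<^sub>R b)) has_real_derivative dir_deriv b (dir_deriv c g) x) (at 0)"
    using x partial_eq_dir_deriv[OF g]
    by (elim has_field_derivative_transform_within_open) auto
  then show ?thesis unfolding partial_def[of b] by (rule DERIV_imp_deriv)
qed

text \<open>Both directions are expanded in \<open>B\<close>. For the inner one the two derivatives
  are first commuted, so that it becomes the outer direction, in which the derivative is
  linear.\<close>

lemma second_dir_deriv_eq_hessian:
  assumes g: "smooth_on g U" and x: "x \<in> U" and B: "B \<subseteq> Basis" and uv: "u \<in> span B" "v \<in> span B"
  shows "dir_deriv u (dir_deriv v g) x = u \<bullet> hessian B g x v"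
proof -
  have exp: "dir_deriv w f x = (\<Sum>b\<in>B. (w \<bullet> b) * dir_deriv b f x)"
    if "w \<in> span B" "smooth_on f U" for f :: "'a \<Rightarrow> real" and w
    by (subst span_Basis_representation[OF B that(1)]) (simp only: dir_deriv_sum[OF that(2) x] real_scaleR_def)
  have "dir_deriv u (dir_deriv v g) x = (\<Sum>b\<in>B. (u \<bullet> b) * dir_deriv b (dir_deriv v g) x)"
    by (rule exp[OF uv(1) smooth_on_dir_deriv[OF g]])
  also have "\<dots> = (\<Sum>b\<in>B. (u \<bullet> b) * (\<Sum>c\<in>B. (v \<bullet> c) * dir_deriv b (dir_deriv c g) x))"
  proof -
    have "dir_deriv b (dir_deriv v g) x = (\<Sum>c\<in>B. (v \<bullet> c) * dir_deriv b (dir_deriv c g) x)" for b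
    proof -
      have "dir_deriv b (dir_deriv v g) x = dir_deriv v (dir_deriv b g) x"
        by (rule dir_deriv_commute[OF g x])
      also have "\<dots> = (\<Sum>c\<in>B. (v \<bullet> c) * dir_deriv c (dir_deriv b g) x)"
        by (rule exp[OF uv(2) smooth_on_dir_deriv[OF g]])
      also have "\<dots> = (\<Sum>c\<in>B. (v \<bullet> c) * dir_deriv b (dir_deriv c g) x)"
        using dir_deriv_commute[OF g x, of b] by (intro sum.cong) simp_all
      finally show ?thesis .
    qed
    then show ?thesis by simp
  qed
  also have "\<dots> = u \<bullet> hessian B g x v"
    by (simp add: hessian_def inner_sum_right second_partial_eq_dir_deriv[OF g x] mult_ac)
  finally show ?thesis .
qed

lemma dir_deriv_affine:
  fixes M :: "'a::euclidean_space \<Rightarrow> 'b::euclidean_space"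
  assumes g: "smooth_on g U" and M: "linear M" and y: "x + M y \<in> U"
  shows "dir_deriv b (\<lambda>y. g (x + M y)) y = dir_deriv (M b) g (x + M y)"
proof -
  have "((\<lambda>y. x + M y) has_derivative M) (at y)"
    using bounded_linear_imp_has_derivative[OF linear_conv_bounded_linear[THEN iffD1, OF M]]
    by (auto intro!: derivative_eq_intros)
  from has_derivative_compose[OF this smooth_on_has_dir_deriv[OF g y]]
  have "((\<lambda>y. g (x + M y)) has_derivative (\<lambda>v. dir_deriv (M v) g (x + M y))) (at y)" .
  from frechet_derivative_at[OF this, symmetric] show ?thesis
    by (simp add: dir_deriv_def)
qed

lemma frechet_derivative_cong_open:
  assumes "open O'" "y \<in> O'" "\<And>z. z \<in> O' \<Longrightarrow> f z = h z"
  shows "frechet_derivative f (at y) = frechet_derivative h (at y)"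
proof -
  have "(f has_derivative D) (at y) \<longleftrightarrow> (h has_derivative D) (at y)" for D
    using has_derivative_transform_within_open[of f D y UNIV O' h]
      has_derivative_transform_within_open[of h D y UNIV O' f] assms by auto
  then show ?thesis by (simp add: frechet_derivative_def)
qed

section \<open>Morse coordinates at a non-degenerate critical point\<close>

text \<open>Matching the vectors of \<open>S\<close> with an orthonormal eigenbasis of the Hessian
  makes the second derivatives diagonal with non-zero entries. The coordinates move from
  \<open>B\<close> to a prescribed \<open>S\<close> of the same size, so that it can be controlled
  later which basis vectors are occupied.\<close>

theorem morse_coordinates:
  fixes g :: "'a::euclidean_space \<Rightarrow> real" and S :: "'a set"
  assumes g: "smooth_on g U" and x: "x \<in> U \<inter> span B" and B: "B \<subseteq> Basis"
    and nd: "nondegenerate_critical_at B g x" and m: "negative_eigenvalues B g x = m"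
    and S: "S \<subseteq> Basis" "card S = card B"
  obtains V \<phi> N where "open V" "0 \<in> V" "smooth_on \<phi> V" "\<phi> ` V \<subseteq> U" "\<phi> 0 = x"
    "\<phi> ` (V \<inter> span S) \<subseteq> span B" "inj_on \<phi> (V \<inter> span S)"
    "\<And>y v. y \<in> V \<inter> span S \<Longrightarrow> v \<in> span S \<Longrightarrow> frechet_derivative \<phi> (at y) v \<in> span B"
    "\<And>y v. y \<in> V \<inter> span S \<Longrightarrow> v \<in> span S \<Longrightarrow> frechet_derivative \<phi> (at y) v = 0 \<Longrightarrow> v = 0"
    "\<And>W. openin (top_of_set (V \<inter> span S)) W \<Longrightarrow> openin (top_of_set (U \<inter> span B)) (\<phi> ` W)"
    "N \<subseteq> S" "card N = m"
    "\<And>y. y \<in> V \<inter> span S \<Longrightarrow> g (\<phi> y) = g x - (\<Sum>b\<in>N. (y \<bullet> b)\<^sup>2) + (\<Sum>b\<in>S - N. (y \<bullet> b)\<^sup>2)"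
proof -
  let ?T = "hessian B g x"
  have xU: "x \<in> U" and xB: "x \<in> span B" using x by auto
  have finS: "finite S" using S(1) finite_Basis finite_subset by blast
  have T: "linear ?T"
    unfolding hessian_def
    by (rule linearI) (simp_all add: inner_add_left distrib_left sum.distrib scaleR_add_left
        scaleR_sum_right sum_distrib_left mult_ac)
  have TB: "?T v \<in> span B" for v
    unfolding hessian_def by (intro span_sum span_scale span_base)
  have symT: "u \<bullet> ?T v = ?T u \<bullet> v" if "u \<in> span B" "v \<in> span B" for u v
    using second_dir_deriv_eq_hessian[OF g xU B that] second_dir_deriv_eq_hessian[OF g xU B that(2,1)]
      dir_deriv_commute[OF g xU, of u v] by (simp add: inner_commute)
  have "\<exists>E. E \<subseteq> span B \<and> pairwise orthogonal E \<and> (\<forall>e\<in>E. norm e = 1) \<and> span E = span B \<and>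
           (\<forall>e\<in>E. \<exists>\<mu>. ?T e = \<mu> *\<^sub>R e)"
    by (rule symmetric_orthonormal_eigenbasis[OF T subspace_span TB symT])
  then obtain E where EB: "E \<subseteq> span B" and E: "pairwise orthogonal E" "\<forall>e\<in>E. norm e = 1"
    and spE: "span E = span B" and "\<forall>e\<in>E. \<exists>\<mu>. ?T e = \<mu> *\<^sub>R e" by blast
  then obtain l where l: "\<And>e. e \<in> E \<Longrightarrow> ?T e = l e *\<^sub>R e" by metis
  note on = orthonormal_expansion[OF E]
  have lnz: "l e \<noteq> 0" if "e \<in> E" for e
    using nd l[OF that] EB E(2) that unfolding nondegenerate_critical_at_def by fastforce
  have cN: "card {e \<in> E. l e < 0} = m"
    using sum_eigenspace_dims[OF T E l] m unfolding negative_eigenvalues_def spE by simp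
  have "card E = card B"
    using dim_eq_card_independent[OF on(2)] dim_eq_card_independent[OF independent_substdbasis[OF B]]
      spE dim_span by metis
  then obtain \<pi> where \<pi>: "bij_betw \<pi> S E"
    using finite_same_card_bij[OF finS on(1)] S(2) by auto
  have \<pi>E: "\<pi> b \<in> E" if "b \<in> S" for b using \<pi> that by (auto simp: bij_betw_def)
  have \<pi>ip: "\<pi> b \<bullet> \<pi> c = (if b = c then 1 else 0)" if "b \<in> S" "c \<in> S" for b c
    using on(3)[OF \<pi>E[OF that(1)] \<pi>E[OF that(2)]] \<pi> that by (auto simp: bij_betw_def inj_on_eq_iff)
  \<comment> \<open>\<open>M\<close> maps \<open>span S\<close> isometrically onto
    \<open>span B\<close>, taking \<open>b\<close> to the eigenvector \<open>\<pi> b\<close>;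
    \<open>M'\<close> is inverse to it between these subspaces.\<close>
  define M where "M y = (\<Sum>b\<in>S. (y \<bullet> b) *\<^sub>R \<pi> b)" for y :: 'a
  define M' where "M' z = (\<Sum>b\<in>S. (z \<bullet> \<pi> b) *\<^sub>R b)" for z :: 'a
  have M: "linear M" unfolding M_def
    by (rule linearI) (simp_all add: inner_add_left scaleR_add_left sum.distrib scaleR_sum_right)
  have M': "linear M'" unfolding M'_def
    by (rule linearI) (simp_all add: inner_add_left scaleR_add_left sum.distrib scaleR_sum_right)
  note blM = linear_conv_bounded_linear[THEN iffD1, OF M]
  note blM' = linear_conv_bounded_linear[THEN iffD1, OF M']
  have Mb: "M b = \<pi> b" if "b \<in> S" for b
  proof -
    have "M b = (\<Sum>c\<in>S. if c = b then \<pi> b else 0)"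
      unfolding M_def using S(1) that by (intro sum.cong) (auto simp: inner_Basis subset_iff)
    then show ?thesis using finS that by simp
  qed
  have MB: "M y \<in> span B" for y
    unfolding M_def using \<pi>E EB by (intro span_sum span_scale) auto
  have Mip: "M y \<bullet> \<pi> b = y \<bullet> b" if "b \<in> S" for y b
  proof -
    have "M y \<bullet> \<pi> b = (\<Sum>c\<in>S. if c = b then y \<bullet> b else 0)"
      unfolding M_def inner_sum_left using that by (intro sum.cong) (auto simp: \<pi>ip)
    then show ?thesis using finS that by simp
  qed
  have M'M: "M' (M y) = y" if "y \<in> span S" for y
    using span_Basis_representation[OF S(1) that] by (simp add: M'_def Mip)
  have M'S: "M' z \<in> span S" for z
    unfolding M'_def by (intro span_sum span_scale span_base)
  have MM': "M (M' z) = z" if "z \<in> span B" for z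
  proof -
    have "M (M' z) = (\<Sum>b\<in>S. (z \<bullet> \<pi> b) *\<^sub>R \<pi> b)"
      unfolding M'_def by (simp add: linear_sum[OF M] linear_cmul[OF M] Mb)
    also have "\<dots> = (\<Sum>e\<in>E. (z \<bullet> e) *\<^sub>R e)"
      using sum.reindex_bij_betw[OF \<pi>, of "\<lambda>e. (z \<bullet> e) *\<^sub>R e"] .
    also have "\<dots> = z" using on(4)[of z] that spE by simp
    finally show ?thesis .
  qed
  define U0 where "U0 = (\<lambda>y. x + M y) -` U"
  define G where "G y = g (x + M y)" for y
  have smM: "smooth_on (\<lambda>y. x + M y) U0'" if "open U0'" for U0'
    using that blM by (intro smooth_on_add smooth_on_const smooth_on_bounded_linear)
  have U0: "open U0"
    unfolding U0_def using smooth_onD(2)[OF g] linear_continuous_on[OF blM]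
    by (intro continuous_open_vimage) (auto intro!: continuous_intros linear_continuous_at[OF blM])
  have G: "smooth_on G U0"
    unfolding G_def[abs_def] by (rule smooth_on_compose[OF smM[OF U0] g]) (auto simp: U0_def)
  have zU0: "0 \<in> U0" using xU by (simp add: U0_def linear_0[OF M])
  have d1: "dir_deriv b G y = dir_deriv (\<pi> b) g (x + M y)" if "b \<in> S" "y \<in> U0" for b y
    using dir_deriv_affine[OF g M, of x y b] that by (simp add: G_def[abs_def] U0_def Mb)
  have d2: "dir_deriv b (dir_deriv c G) 0 = \<pi> b \<bullet> ?T (\<pi> c)" if "b \<in> S" "c \<in> S" for b c
  proof -
    \<comment> \<open>The formula for the inner derivative holds on the neighbourhood
      \<open>U0\<close> of 0, so it may be differentiated once more at 0.\<close>
    have "dir_deriv b (dir_deriv c G) 0 = dir_deriv b (\<lambda>y. dir_deriv (\<pi> c) g (x + M y)) 0"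
      unfolding dir_deriv_def[of b]
      by (subst frechet_derivative_cong_open[OF U0 zU0 d1[OF that(2)]]) simp_all
    also have "\<dots> = dir_deriv (\<pi> b) (dir_deriv (\<pi> c) g) x"
      using dir_deriv_affine[OF smooth_on_dir_deriv[OF g] M, of x 0 b "\<pi> c"] xU that
      by (simp add: linear_0[OF M] Mb)
    also have "\<dots> = \<pi> b \<bullet> ?T (\<pi> c)"
      using second_dir_deriv_eq_hessian[OF g xU B] \<pi>E that EB by blast
    finally show ?thesis .
  qed
  have d2': "dir_deriv b (dir_deriv c G) 0 = (if b = c then l (\<pi> b) else 0)" if "b \<in> S" "c \<in> S" for b c
    using d2[OF that] l[OF \<pi>E[OF that(2)]] \<pi>ip[OF that] by simp
  have crit: "dir_deriv b G 0 = 0" if "b \<in> S" for b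
  proof -
    have "dir_deriv b G 0 = dir_deriv (\<pi> b) g x"
      using d1[OF that zU0] by (simp add: linear_0[OF M])
    also have "\<dots> = (\<Sum>c\<in>B. (\<pi> b \<bullet> c) * dir_deriv c g x)"
    proof -
      have "\<pi> b \<in> span B" using \<pi>E that EB by blast
      from span_Basis_representation[OF B this] show ?thesis
        using dir_deriv_sum[OF g xU, of "\<lambda>c. \<pi> b \<bullet> c" B] by simp
    qed
    also have "\<dots> = 0"
      using nd partial_eq_dir_deriv[OF g xU] by (simp add: nondegenerate_critical_at_def)
    finally show ?thesis .
  qed
  have critS: "\<forall>b\<in>S. dir_deriv b G 0 = 0" using crit by blast
  have off: "\<forall>b\<in>S. \<forall>c\<in>S. b \<noteq> c \<longrightarrow> dir_deriv b (dir_deriv c G) 0 = 0"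
    using d2' by simp
  have diag: "\<forall>b\<in>S. dir_deriv b (dir_deriv b G) 0 \<noteq> 0"
    using d2' lnz[OF \<pi>E] by simp
  obtain V W \<psi> Y where V: "open V" "0 \<in> V" "open W" "W \<subseteq> U0" "smooth_on \<psi> V" "homeomorphism W V Y \<psi>"
    "\<psi> 0 = 0" "\<And>y v. y \<in> V \<Longrightarrow> frechet_derivative \<psi> (at y) v = 0 \<Longrightarrow> v = 0"
    "\<And>y b. y \<in> V \<Longrightarrow> b \<in> Basis - S \<Longrightarrow> \<psi> y \<bullet> b = y \<bullet> b"
    "\<And>y. y \<in> V \<inter> span S \<Longrightarrow>
       G (\<psi> y) = G 0 + (\<Sum>b\<in>S. sgn (dir_deriv b (dir_deriv b G) 0) * (y \<bullet> b)\<^sup>2)"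
    by (rule morse_normal_form_diagonal[OF G zU0 S(1) critS off diag]) blast
  have hom: "\<And>x. x \<in> W \<Longrightarrow> \<psi> (Y x) = x" "\<And>z. z \<in> V \<Longrightarrow> Y (\<psi> z) = z" "Y ` W = V" "\<psi> ` V = W"
    and contY: "continuous_on W Y"
    using V(6) by (auto simp: homeomorphism_def)
  have \<psi>S: "\<psi> y \<in> span S \<longleftrightarrow> y \<in> span S" if "y \<in> V" for y
    using V(9)[OF that] unfolding span_substd_basis[OF S(1)] by auto
  define \<phi> where "\<phi> y = x + M (\<psi> y)" for y
  have \<phi>V: "\<phi> y \<in> U" if "y \<in> V" for y
    using hom(4) V(4) that by (auto simp: \<phi>_def U0_def)
  have \<phi>der: "frechet_derivative \<phi> (at y) v = M (frechet_derivative \<psi> (at y) v)" if "y \<in> V" for y v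
  proof -
    have "(\<phi> has_derivative (\<lambda>v. 0 + M (frechet_derivative \<psi> (at y) v))) (at y)"
      unfolding \<phi>_def[abs_def]
      by (intro has_derivative_add has_derivative_const
          bounded_linear.has_derivative[OF blM smooth_on_has_derivative[OF V(5) that]])
    from frechet_derivative_at[OF this, symmetric] show ?thesis by simp
  qed
  \<comment> \<open>The components of \<open>\<psi>\<close> outside \<open>S\<close> are coordinates
    of its argument, hence so are those of its derivative.\<close>
  have d\<psi>S: "frechet_derivative \<psi> (at y) v \<in> span S" if "y \<in> V" "v \<in> span S" for y v
    unfolding span_substd_basis[OF S(1)]
  proof (intro CollectI ballI impI)
    fix b :: 'a assume b: "b \<in> Basis" "b \<notin> S"
    have "((\<lambda>z. \<psi> z \<bullet> b) has_derivative (\<lambda>v. frechet_derivative \<psi> (at y) v \<bullet> b)) (at y)"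
      by (rule has_derivative_inner_left[OF smooth_on_has_derivative[OF V(5) that(1)]])
    then have "((\<lambda>z. z \<bullet> b) has_derivative (\<lambda>v. frechet_derivative \<psi> (at y) v \<bullet> b)) (at y)"
      by (rule has_derivative_transform_within_open[OF _ V(1) that(1)]) (use V(9) b in auto)
    moreover have "((\<lambda>z. z \<bullet> b) has_derivative (\<lambda>v. v \<bullet> b)) (at y)"
      by (intro has_derivative_inner_left has_derivative_ident)
    ultimately have "frechet_derivative \<psi> (at y) v \<bullet> b = v \<bullet> b"
      using has_derivative_unique by metis
    then show "frechet_derivative \<psi> (at y) v \<bullet> b = 0"
      using that(2) b unfolding span_substd_basis[OF S(1)] by auto
  qed
  define N where "N = {b\<in>S. l (\<pi> b) < 0}"
  have "bij_betw \<pi> N {e\<in>E. l e < 0}"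
    using \<pi> unfolding N_def bij_betw_def by (auto intro: inj_on_subset)
  then have cardN: "card N = m" using bij_betw_same_card cN by metis
  show ?thesis
  proof (rule that[of V \<phi> N])
    show "open V" "0 \<in> V" "\<phi> 0 = x" using V by (auto simp: \<phi>_def linear_0[OF M])
    show "smooth_on \<phi> V"
      unfolding \<phi>_def[abs_def]
      by (rule smooth_on_compose[OF V(5) smM[OF open_UNIV]]) auto
    show "\<phi> ` V \<subseteq> U" using \<phi>V by auto
    show "\<phi> ` (V \<inter> span S) \<subseteq> span B" using MB xB by (auto simp: \<phi>_def intro: span_add)
    show "inj_on \<phi> (V \<inter> span S)"
    proof (rule inj_onI)
      fix y z assume "y \<in> V \<inter> span S" "z \<in> V \<inter> span S" "\<phi> y = \<phi> z"
      then have "M' (M (\<psi> y)) = M' (M (\<psi> z))" "y \<in> V" "z \<in> V" "\<psi> y \<in> span S" "\<psi> z \<in> span S"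
        using \<psi>S by (auto simp: \<phi>_def)
      then show "y = z" using M'M hom(2) by metis
    qed
    show "frechet_derivative \<phi> (at y) v \<in> span B" if "y \<in> V \<inter> span S" "v \<in> span S" for y v
      using \<phi>der[of y v] that MB by simp
    show "v = 0" if "y \<in> V \<inter> span S" "v \<in> span S" "frechet_derivative \<phi> (at y) v = 0" for y v
    proof -
      have "M' (M (frechet_derivative \<psi> (at y) v)) = M' 0"
        using \<phi>der[of y v] that by simp
      then have "frechet_derivative \<psi> (at y) v = 0"
        using M'M[OF d\<psi>S[of y v]] that linear_0[OF M'] by simp
      then show ?thesis using V(8) that by blast
    qed
    show "openin (top_of_set (U \<inter> span B)) (\<phi> ` R)" if R: "openin (top_of_set (V \<inter> span S)) R" for R
    proof -
      obtain Q where Q: "open Q" "R = V \<inter> span S \<inter> Q" using R by (auto simp: openin_open)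
      \<comment> \<open>As the inverse of the continuous \<open>Y\<close> on the open set
        \<open>W\<close>, \<open>\<psi>\<close> is an open map; pulling back along \<open>M'\<close>
        carries openness over to \<open>span B\<close>.\<close>
      have "\<psi> ` (V \<inter> Q) = W \<inter> Y -` Q"
      proof (intro equalityI subsetI)
        fix w assume "w \<in> \<psi> ` (V \<inter> Q)"
        then obtain y where "y \<in> V" "y \<in> Q" "w = \<psi> y" by blast
        then show "w \<in> W \<inter> Y -` Q" using hom(2)[of y] hom(4) by auto
      next
        fix w assume w: "w \<in> W \<inter> Y -` Q"
        then have "w = \<psi> (Y w)" "Y w \<in> V \<inter> Q" using hom(1)[of w] hom(3) by auto
        then show "w \<in> \<psi> ` (V \<inter> Q)" by blast
      qed
      then have oQ: "open (\<psi> ` (V \<inter> Q))"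
        using continuous_open_preimage[OF contY V(3) Q(1)] by simp
      have "open ((\<lambda>z. M' (z - x)) -` (\<psi> ` (V \<inter> Q)))"
        by (rule open_vimage[OF oQ bounded_linear.continuous_on[OF blM']])
           (intro continuous_intros)
      moreover have "\<phi> ` R = U \<inter> span B \<inter> ((\<lambda>z. M' (z - x)) -` (\<psi> ` (V \<inter> Q)))"
      proof (intro equalityI subsetI)
        fix z assume "z \<in> \<phi> ` R"
        then obtain y where y: "y \<in> V" "y \<in> span S" "y \<in> Q" "z = \<phi> y" using Q(2) by auto
        have "M' (z - x) = \<psi> y" using y \<psi>S M'M by (simp add: \<phi>_def)
        moreover have "z \<in> span B" using y(4) MB xB by (auto simp: \<phi>_def intro: span_add)
        ultimately show "z \<in> U \<inter> span B \<inter> ((\<lambda>z. M' (z - x)) -` (\<psi> ` (V \<inter> Q)))"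
          using y \<phi>V by auto
      next
        fix z assume z: "z \<in> U \<inter> span B \<inter> ((\<lambda>z. M' (z - x)) -` (\<psi> ` (V \<inter> Q)))"
        then obtain y where y: "y \<in> V" "y \<in> Q" "M' (z - x) = \<psi> y" by auto
        have "y \<in> span S" using \<psi>S[OF y(1)] y(3) M'S[of "z - x"] by simp
        moreover have "\<phi> y = z"
          using MM'[of "z - x"] z xB by (auto simp: \<phi>_def y(3)[symmetric] span_diff)
        ultimately show "z \<in> \<phi> ` R" using y Q(2) by auto
      qed
      ultimately show ?thesis by (auto simp: openin_open)
    qed
    show "N \<subseteq> S" by (auto simp: N_def)
    show "card N = m" by (rule cardN)
    show "g (\<phi> y) = g x - (\<Sum>b\<in>N. (y \<bullet> b)\<^sup>2) + (\<Sum>b\<in>S - N. (y \<bullet> b)\<^sup>2)" if "y \<in> V \<inter> span S" for y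
    proof -
      have "g (\<phi> y) = g x + (\<Sum>b\<in>S. sgn (dir_deriv b (dir_deriv b G) 0) * (y \<bullet> b)\<^sup>2)"
        using V(10)[OF that] by (simp add: G_def \<phi>_def linear_0[OF M])
      also have "(\<Sum>b\<in>S. sgn (dir_deriv b (dir_deriv b G) 0) * (y \<bullet> b)\<^sup>2)
          = (\<Sum>b\<in>S. sgn (l (\<pi> b)) * (y \<bullet> b)\<^sup>2)"
        by (intro sum.cong refl) (simp add: d2')
      also have "\<dots> = (\<Sum>b\<in>S - N. sgn (l (\<pi> b)) * (y \<bullet> b)\<^sup>2) + (\<Sum>b\<in>N. sgn (l (\<pi> b)) * (y \<bullet> b)\<^sup>2)"
        using finS by (intro sum.subset_diff) (auto simp: N_def)
      also have "(\<Sum>b\<in>S - N. sgn (l (\<pi> b)) * (y \<bullet> b)\<^sup>2) = (\<Sum>b\<in>S - N. (y \<bullet> b)\<^sup>2)"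
        using lnz \<pi>E by (intro sum.cong) (fastforce simp: N_def sgn_if)+
      also have "(\<Sum>b\<in>N. sgn (l (\<pi> b)) * (y \<bullet> b)\<^sup>2) = - (\<Sum>b\<in>N. (y \<bullet> b)\<^sup>2)"
        unfolding sum_negf[symmetric] by (intro sum.cong) (auto simp: N_def sgn_if)
      finally show ?thesis by simp
    qed
  qed
qed

section \<open>Linkages and congruence\<close>

lemma affine_image_nth: "affine_image L a b p $ v = (if v \<in> vertices L then a * p $ v + b else 0)"
  by (simp add: affine_image_def)

lemma restriction_nth: "restriction L q $ v = (if v \<in> vertices L then q $ v else 0)"
  by (simp add: restriction_def)

lemma affine_image_compose:
  "affine_image L a b (affine_image L c d p) = affine_image L (a * c) (a * d + b) p"
  by (simp add: vec_eq_iff affine_image_nth algebra_simps)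

lemma edge_vertices: "(u, v, l) \<in> L \<Longrightarrow> u \<in> vertices L" "(u, v, l) \<in> L \<Longrightarrow> v \<in> vertices L"
  by (auto simp: vertices_def)

lemma configurations_dist: "p \<in> configurations L \<Longrightarrow> (u, v, l) \<in> L \<Longrightarrow> dist (p $ u) (p $ v) = l"
  by (auto simp: configurations_def)

lemma configurationsI:
  assumes "\<And>u v l. (u, v, l) \<in> L \<Longrightarrow> dist (p $ u) (p $ v) = l" "\<And>v. v \<notin> vertices L \<Longrightarrow> p $ v = 0"
  shows "p \<in> configurations L"
  using assms by (auto simp: configurations_def)

lemma configurations_outside: "p \<in> configurations L \<Longrightarrow> v \<notin> vertices L \<Longrightarrow> p $ v = 0"
  by (auto simp: configurations_def)

lemma affine_image_1_0: "p \<in> configurations L \<Longrightarrow> affine_image L 1 0 p = p"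
  by (auto simp: vec_eq_iff affine_image_nth configurations_outside)

lemma dist_affine: "norm a = 1 \<Longrightarrow> dist (a * z + b) (a * w + b) = dist z (w :: complex)"
  by (simp add: dist_norm right_diff_distrib[symmetric] norm_mult)

lemma affine_image_configurations:
  assumes p: "p \<in> configurations L" and a: "norm a = 1"
  shows "affine_image L a b p \<in> configurations L"
proof -
  have "dist (a * p $ u + b) (a * p $ v + b) = l \<and> u \<in> vertices L \<and> v \<in> vertices L"
    if "(u, v, l) \<in> L" for u v l
    using configurations_dist[OF p that] edge_vertices[OF that] dist_affine[OF a] by simp
  then show ?thesis by (intro configurationsI) (auto simp: affine_image_nth)
qed

lemma congruence_classI: "norm a = 1 \<Longrightarrow> affine_image L a b p \<in> congruence_class L p"
  unfolding congruence_class_def by blast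

lemma congruence_classE:
  assumes "q \<in> congruence_class L p"
  obtains a b where "norm a = 1" "q = affine_image L a b p"
  using assms unfolding congruence_class_def by blast

lemma congruence_class_self: "p \<in> configurations L \<Longrightarrow> p \<in> congruence_class L p"
  using congruence_classI[of 1 L 0 p] by (simp add: affine_image_1_0)

lemma congruence_class_affine:
  assumes a: "norm a = 1"
  shows "congruence_class L (affine_image L a b p) = congruence_class L p"
proof (intro equalityI subsetI)
  fix q assume "q \<in> congruence_class L (affine_image L a b p)"
  then obtain c d where "norm c = 1" "q = affine_image L c d (affine_image L a b p)"
    by (rule congruence_classE)
  then show "q \<in> congruence_class L p"
    using a by (simp add: affine_image_compose congruence_classI norm_mult)
next
  fix q assume "q \<in> congruence_class L p"
  then obtain c d where cd: "norm c = 1" "q = affine_image L c d p" by (rule congruence_classE)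
  have "a \<noteq> 0" using a by auto
  then have "q = affine_image L (c / a) (d - c / a * b) (affine_image L a b p)"
    by (simp add: affine_image_compose cd(2))
  moreover have "norm (c / a) = 1" using a cd(1) by (simp add: norm_divide)
  ultimately show "q \<in> congruence_class L (affine_image L a b p)"
    using congruence_classI by metis
qed

lemma congruence_class_eqI:
  assumes "q \<in> congruence_class L p"
  shows "congruence_class L q = congruence_class L p"
  using assms by (elim congruence_classE) (simp add: congruence_class_affine)

lemma vertices_mono: "L \<subseteq> L' \<Longrightarrow> vertices L \<subseteq> vertices L'"
  by (auto simp: vertices_def)

lemma restriction_configurations:
  assumes L: "L \<subseteq> L'" and q: "q \<in> configurations L'"
  shows "restriction L q \<in> configurations L"
proof -
  have "dist (q $ u) (q $ v) = l \<and> u \<in> vertices L \<and> v \<in> vertices L" if "(u, v, l) \<in> L" for u v l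
    using that L configurations_dist[OF q, of u v l] edge_vertices[OF that] by blast
  then show ?thesis by (auto simp: configurations_def restriction_nth)
qed

lemma restriction_affine:
  assumes "L \<subseteq> L'"
  shows "restriction L (affine_image L' a b q) = affine_image L a b (restriction L q)"
  using vertices_mono[OF assms] by (auto simp: vec_eq_iff restriction_nth affine_image_nth)

lemma restriction_congruence_class:
  assumes "L \<subseteq> L'" "q \<in> congruence_class L' p"
  shows "restriction L q \<in> congruence_class L (restriction L p)"
  using assms(2) by (elim congruence_classE) (simp add: restriction_affine[OF assms(1)] congruence_classI)

lemma vertices_chain_linkage:
  assumes "open_chain c"
  shows "vertices (chain_linkage c) = set (chain_vertices c)"
proof -
  define n where "n = length (chain_lengths c)"
  have n: "n > 0" "length (chain_vertices c) = Suc n" using assms by (auto simp: open_chain_def n_def)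
  have "vertices (chain_linkage c) = (\<Union>i<n. {chain_vertices c ! i, chain_vertices c ! Suc i})"
    by (auto simp: vertices_def chain_linkage_def n_def)
  also have "\<dots> = set (chain_vertices c)"
  proof
    show "set (chain_vertices c) \<subseteq> (\<Union>i<n. {chain_vertices c ! i, chain_vertices c ! Suc i})"
    proof
      fix v assume "v \<in> set (chain_vertices c)"
      then obtain i where i: "i < Suc n" "v = chain_vertices c ! i" using n by (auto simp: in_set_conv_nth)
      show "v \<in> (\<Union>i<n. {chain_vertices c ! i, chain_vertices c ! Suc i})"
      proof (cases "i < n")
        case False
        \<comment> \<open>The last vertex starts no edge, but it ends the last one, which exists
          because a chain has at least one edge.\<close>
        then have "i = Suc (n - 1)" "n - 1 < n" using i n by auto
        then show ?thesis using i by blast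
      qed (use i in auto)
    qed
  qed (use n in auto)
  finally show ?thesis .
qed

lemma vertices_Un: "vertices (L \<union> L') = vertices L \<union> vertices L'"
  by (auto simp: vertices_def)

section \<open>The oriented area: invariance under motions and smoothness\<close>

lemma set_cycle_vertices:
  assumes "open_chain A" "open_chain B"
  shows "set (cycle_vertices A B) \<subseteq> vertices (cycle_linkage A B)"
  unfolding cycle_linkage_def vertices_Un vertices_chain_linkage[OF assms(1)] vertices_chain_linkage[OF assms(2)]
proof -
  have "set (butlast (rev (chain_vertices B))) \<subseteq> set (chain_vertices B)"
    using in_set_butlastD[of _ "rev (chain_vertices B)"] by auto
  then show "set (cycle_vertices A B) \<subseteq> set (chain_vertices A) \<union> set (chain_vertices B)"
    using in_set_butlastD[of _ "chain_vertices A"] unfolding cycle_vertices_def set_append by blast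
qed

lemma sum_Suc_mod: "(\<Sum>i<n. f (Suc i mod n)) = (\<Sum>i<n. f i :: 'a::comm_monoid_add)"
proof (cases n)
  case (Suc k)
  have "(\<Sum>i<k. f (Suc i mod Suc k)) = (\<Sum>i<k. f (Suc i))" by (intro sum.cong) auto
  then show ?thesis unfolding Suc
    by (simp only: sum.lessThan_Suc[of "\<lambda>i. f (Suc i mod Suc k)"] sum.lessThan_Suc_shift[of f]
        mod_self add.commute)
qed simp

text \<open>In complex form each summand is \<open>Im (cnj z * w)\<close>. The rotation cancels
  through \<open>cnj a * a = 1\<close>, and the translation contributes differences that telescope
  around the cycle.\<close>

lemma oriented_area_affine:
  assumes a: "norm a = 1" and q: "\<And>v. v \<in> set vs \<Longrightarrow> q $ v = a * p $ v + b"
  shows "oriented_area vs q = oriented_area vs p"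
proof -
  let ?n = "length vs"
  let ?z = "\<lambda>i. p $ (vs ! i)" and ?f = "\<lambda>i. Im (cnj b * (a * p $ (vs ! i)))"
  have area: "oriented_area vs r = (\<Sum>i<?n. Im (cnj (r $ (vs ! i)) * r $ (vs ! (Suc i mod ?n)))) / 2" for r
    unfolding oriented_area_def Let_def by (intro arg_cong2[where f = "(/)"] sum.cong) auto
  have aa: "cnj a * a = 1" using a by (simp add: complex_norm_square[symmetric] mult.commute)
  have "Im (cnj (a * z + b) * (a * w + b)) = Im (cnj z * w) + (Im (cnj b * (a * w)) - Im (cnj b * (a * z)))" for z w
  proof -
    have "cnj (a * z + b) * (a * w + b) =
        (cnj a * a) * (cnj z * w) + cnj b * (a * w) + cnj (cnj b * (a * z)) + cnj b * b"
      by (simp add: algebra_simps)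
    moreover have "Im (cnj b * b) = 0" by simp
    moreover have "Im (cnj (cnj b * (a * z))) = - Im (cnj b * (a * z))" by (rule cnj.sel(2))
    ultimately show ?thesis by (simp only: aa plus_complex.sel mult_1)
  qed
  note step = this
  have qi: "q $ (vs ! i) = a * ?z i + b" "q $ (vs ! (Suc i mod ?n)) = a * ?z (Suc i mod ?n) + b"
    if "i < ?n" for i
    using that by (auto intro!: q nth_mem mod_less_divisor)
  have "(\<Sum>i<?n. Im (cnj (q $ (vs ! i)) * q $ (vs ! (Suc i mod ?n)))) =
      (\<Sum>i<?n. Im (cnj (?z i) * ?z (Suc i mod ?n)) + (?f (Suc i mod ?n) - ?f i))"
  proof (rule sum.cong[OF refl])
    fix i assume "i \<in> {..<?n}"
    then have "i < ?n" by simp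
    then show "Im (cnj (q $ (vs ! i)) * q $ (vs ! (Suc i mod ?n))) =
        Im (cnj (?z i) * ?z (Suc i mod ?n)) + (?f (Suc i mod ?n) - ?f i)"
      unfolding qi[OF \<open>i < ?n\<close>] by (intro step)
  qed
  also have "\<dots> = (\<Sum>i<?n. Im (cnj (?z i) * ?z (Suc i mod ?n)))"
    by (simp only: sum.distrib sum_subtractf sum_Suc_mod[of ?f] diff_self add_0_right)
  finally show ?thesis by (simp only: area)
qed

text \<open>The area is constant on the orbit, so \<open>the_elem\<close> is applied to a
  singleton.\<close>

lemma area_congruence_class:
  assumes "set (cycle_vertices A B) \<subseteq> vertices L"
  shows "area A B (congruence_class L p) = oriented_area (cycle_vertices A B) p"
proof -
  let ?S = "oriented_area (cycle_vertices A B)"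
  have eq: "?S (affine_image L a b p) = ?S p" if "norm a = 1" for a b
    using assms by (intro oriented_area_affine[OF that]) (auto simp: affine_image_nth)
  have const: "?S q = ?S p" if "q \<in> congruence_class L p" for q
    using that by (rule congruence_classE) (simp add: eq)
  \<comment> \<open>For an arbitrary \<open>p\<close> this copy is used in place of
    \<open>p\<close>, which lies in its class only if it vanishes off the vertices.\<close>
  have "affine_image L 1 0 p \<in> congruence_class L p"
    by (simp add: congruence_classI)
  then have "?S ` congruence_class L p = {?S p}"
    by (intro trans[OF image_cong[OF refl const] image_constant])
  then show ?thesis by (simp add: area_def)
qed

lemma smooth_on_oriented_area: "smooth_on (oriented_area vs) UNIV"
proof -
  have Re: "smooth_on (\<lambda>p. Re (p $ v)) UNIV" for v :: 'a
    by (rule smooth_on_bounded_linear[OF open_UNIV bounded_linear_compose[OF bounded_linear_Re bounded_linear_vec_nth]])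
  have Im: "smooth_on (\<lambda>p. Im (p $ v)) UNIV" for v :: 'a
    by (rule smooth_on_bounded_linear[OF open_UNIV bounded_linear_compose[OF bounded_linear_Im bounded_linear_vec_nth]])
  show ?thesis
    unfolding oriented_area_def[abs_def] Let_def
    by (intro smooth_on_divide smooth_on_sum smooth_on_diff smooth_on_mult Re Im smooth_on_const) auto
qed

section \<open>Moving charts to other coordinate vectors\<close>

text \<open>These vectors will carry the chart of the cycle; those of the remaining vertices stay
  free for the angles of the attached chain.\<close>

definition vertex_basis :: "'v::finite set \<Rightarrow> (complex^'v) set" where
  "vertex_basis X = (\<lambda>(v, c). axis v c) ` (X \<times> Basis)"

lemma vertex_basis_subset: "vertex_basis X \<subseteq> Basis"
  by (auto simp: vertex_basis_def Basis_vec_def)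

text \<open>Along \<open>span B\<close> the chart takes values in configurations, which vanish at
  \<open>w\<close>. Other directions may leave the configurations, hence the condition on
  \<open>v\<close>.\<close>

lemma local_coordinates_derivative_outside:
  fixes L :: "'v::finite linkage"
  assumes lc: "local_coordinates L B U \<sigma>" and x: "x \<in> U \<inter> span B" and v: "v \<in> span B"
    and w: "w \<notin> vertices L"
  shows "frechet_derivative \<sigma> (at x) v $ w = 0"
proof -
  have sm: "smooth_on \<sigma> U" and conf: "\<sigma> ` (U \<inter> span B) \<subseteq> configurations L"
    using lc by (auto simp: local_coordinates_def)
  let ?D = "frechet_derivative \<sigma> (at x)"
  have "((\<lambda>s. \<sigma> (x + s *\<^sub>R v)) has_vector_derivative ?D v) (at 0)"
    using smooth_on_line_derivative[OF sm, of x 0 v UNIV] x by (simp add: dir_deriv_def)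
  then have 1: "((\<lambda>s. \<sigma> (x + s *\<^sub>R v) $ w) has_vector_derivative ?D v $ w) (at 0)"
    by (rule bounded_linear.has_vector_derivative[OF bounded_linear_vec_nth])
  have o: "open ((\<lambda>s. x + s *\<^sub>R v) -` U)"
    using smooth_onD(2)[OF sm] by (intro continuous_open_vimage) (auto intro!: continuous_intros)
  have "((\<lambda>s. 0) has_vector_derivative ?D v $ w) (at 0)"
  proof (rule has_vector_derivative_transform_within_open[OF 1 o])
    fix s assume "s \<in> (\<lambda>s. x + s *\<^sub>R v) -` U"
    then have "x + s *\<^sub>R v \<in> U \<inter> span B" using x v by (auto intro: span_add span_scale)
    then show "\<sigma> (x + s *\<^sub>R v) $ w = 0" using conf configurations_outside[OF _ w] by blast
  qed (use x in auto)
  then show ?thesis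
    using vector_derivative_unique_at has_vector_derivative_const by metis
qed

text \<open>The zero vector is an infinitesimal motion, so the immersion clause makes the derivative
  injective on \<open>span B\<close>, and its values are supported on the vertices of
  \<open>L\<close>. Thus enough vectors of these vertices exist to rename the coordinates.\<close>

lemma local_coordinates_card_le:
  fixes L :: "'v::finite linkage"
  assumes lc: "local_coordinates L B U \<sigma>" and x: "x \<in> U \<inter> span B"
  shows "card B \<le> card (vertex_basis (vertices L))"
proof -
  have sm: "smooth_on \<sigma> U" and B: "B \<subseteq> Basis"
    and imm: "\<And>v. v \<in> span B \<Longrightarrow> frechet_derivative \<sigma> (at x) v \<in> infinitesimal_motions L (\<sigma> x) \<Longrightarrow> v = 0"
    using lc x by (auto simp: local_coordinates_def)
  let ?D = "frechet_derivative \<sigma> (at x)"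
  have lin: "linear ?D" using has_derivative_linear smooth_on_has_derivative[OF sm] x by blast
  have sub: "?D v \<in> span (vertex_basis (vertices L))" if v: "v \<in> span B" for v
    unfolding span_substd_basis[OF vertex_basis_subset]
  proof (intro CollectI ballI impI)
    fix b :: "complex^'v" assume b: "b \<in> Basis" "b \<notin> vertex_basis (vertices L)"
    then obtain w c where wc: "b = axis w c" "c \<in> Basis" by (auto simp: Basis_vec_def)
    then have w: "w \<notin> vertices L" using b by (auto simp: vertex_basis_def)
    then show "?D v \<bullet> b = 0"
      using local_coordinates_derivative_outside[OF lc x v w] by (simp add: wc(1) inner_axis)
  qed
  have "inj_on ?D (span B)"
  proof (rule inj_onI)
    fix u v assume uv: "u \<in> span B" "v \<in> span B" "?D u = ?D v"
    have "?D (u - v) = 0" using uv(3) by (simp add: linear_diff[OF lin])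
    moreover have "0 = affine_image L (\<i> * of_real 0) 0 (\<sigma> x)"
      by (simp add: vec_eq_iff affine_image_nth)
    ultimately have "?D (u - v) \<in> infinitesimal_motions L (\<sigma> x)"
      unfolding infinitesimal_motions_def by (simp only: mem_Collect_eq) metis
    then show "u = v" using imm[of "u - v"] uv by (simp add: span_diff)
  qed
  then have "dim (?D ` B) = dim B" using dim_image_eq[OF lin] by blast
  moreover have "dim B = card B" using dim_eq_card_independent[OF independent_substdbasis[OF B]] .
  moreover have "?D ` B \<subseteq> span (vertex_basis (vertices L))" using sub span_base by blast
  moreover have "finite (vertex_basis (vertices L))" by (simp add: vertex_basis_def)
  ultimately show ?thesis using dim_le_card by metis
qed

lemma local_coordinates_transform:
  assumes lc: "local_coordinates L B U \<sigma>" and S: "S \<subseteq> Basis"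
    and \<phi>: "smooth_on \<phi> V" "\<phi> ` V \<subseteq> U" "\<phi> ` (V \<inter> span S) \<subseteq> span B" "inj_on \<phi> (V \<inter> span S)"
    and d1: "\<And>y v. y \<in> V \<inter> span S \<Longrightarrow> v \<in> span S \<Longrightarrow> frechet_derivative \<phi> (at y) v \<in> span B"
    and d2: "\<And>y v. y \<in> V \<inter> span S \<Longrightarrow> v \<in> span S \<Longrightarrow> frechet_derivative \<phi> (at y) v = 0 \<Longrightarrow> v = 0"
    and op: "\<And>W. openin (top_of_set (V \<inter> span S)) W \<Longrightarrow> openin (top_of_set (U \<inter> span B)) (\<phi> ` W)"
  shows "local_coordinates L S V (\<lambda>y. \<sigma> (\<phi> y))"
proof -
  have sm: "smooth_on \<sigma> U" and conf: "\<sigma> ` (U \<inter> span B) \<subseteq> configurations L"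
    and imm: "\<And>x v. x \<in> U \<inter> span B \<Longrightarrow> v \<in> span B \<Longrightarrow>
      frechet_derivative \<sigma> (at x) v \<in> infinitesimal_motions L (\<sigma> x) \<Longrightarrow> v = 0"
    and inj: "inj_on (\<lambda>x. congruence_class L (\<sigma> x)) (U \<inter> span B)"
    and opn: "\<And>W. openin (top_of_set (U \<inter> span B)) W \<Longrightarrow>
        openin (top_of_set (configurations L)) (\<Union>x\<in>W. congruence_class L (\<sigma> x))"
    using lc by (auto simp: local_coordinates_def)
  have in': "\<phi> y \<in> U \<inter> span B" if "y \<in> V \<inter> span S" for y using that \<phi>(2,3) by auto
  have der: "frechet_derivative (\<lambda>y. \<sigma> (\<phi> y)) (at y) v =
      frechet_derivative \<sigma> (at (\<phi> y)) (frechet_derivative \<phi> (at y) v)" if "y \<in> V" for y v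
  proof -
    have "\<phi> y \<in> U" using that \<phi>(2) by auto
    from has_derivative_compose[OF smooth_on_has_derivative[OF \<phi>(1) that] smooth_on_has_derivative[OF sm this]]
    have "((\<lambda>y. \<sigma> (\<phi> y)) has_derivative
        (\<lambda>v. frechet_derivative \<sigma> (at (\<phi> y)) (frechet_derivative \<phi> (at y) v))) (at y)" .
    from frechet_derivative_at[OF this, symmetric] show ?thesis by (rule fun_cong)
  qed
  show ?thesis
    unfolding local_coordinates_def
  proof (intro conjI ballI allI impI)
    show "S \<subseteq> Basis" by (rule S)
    show "smooth_on (\<lambda>y. \<sigma> (\<phi> y)) V" by (rule smooth_on_compose[OF \<phi>(1) sm \<phi>(2)])
    show "(\<lambda>y. \<sigma> (\<phi> y)) ` (V \<inter> span S) \<subseteq> configurations L" using conf in' by auto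
    show "v = 0" if "y \<in> V \<inter> span S" "v \<in> span S"
      "frechet_derivative (\<lambda>y. \<sigma> (\<phi> y)) (at y) v \<in> infinitesimal_motions L (\<sigma> (\<phi> y))" for y v
      using that der[of y v] imm[OF in'[OF that(1)] d1[OF that(1,2)]] d2[OF that(1,2)] by simp
    show "inj_on (\<lambda>x. congruence_class L (\<sigma> (\<phi> x))) (V \<inter> span S)"
      using inj \<phi>(4) in' unfolding inj_on_def by meson
    show "openin (top_of_set (configurations L)) (\<Union>x\<in>W. congruence_class L (\<sigma> (\<phi> x)))"
      if "openin (top_of_set (V \<inter> span S)) W" for W
      using opn[OF op[OF that]] by simp
  qed
qed

text \<open>\<open>F\<close> lifts \<open>f\<close> to placements; its smoothness makes
  \<open>f\<close> smooth in the given chart, as the Morse lemma requires. The dimension bound then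
  allows the new coordinates to be taken from vectors of the vertices of \<open>L\<close>.\<close>

lemma has_morse_index_normal_form:
  fixes L :: "'v::finite linkage"
  assumes mi: "has_morse_index L f P m"
    and f: "\<And>p. f (congruence_class L p) = F p" and F: "smooth_on F UNIV"
  obtains S V \<sigma> N where "S \<subseteq> vertex_basis (vertices L)" "local_coordinates L S V \<sigma>" "0 \<in> V"
    "congruence_class L (\<sigma> 0) = P" "N \<subseteq> S" "card N = m"
    "\<And>y. y \<in> V \<inter> span S \<Longrightarrow>
       f (congruence_class L (\<sigma> y)) = f P - (\<Sum>b\<in>N. (y \<bullet> b)\<^sup>2) + (\<Sum>b\<in>S - N. (y \<bullet> b)\<^sup>2)"
proof -
  obtain B U \<sigma> x where lc: "local_coordinates L B U \<sigma>" and x: "x \<in> U \<inter> span B"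
    and P: "congruence_class L (\<sigma> x) = P"
    and nd: "nondegenerate_critical_at B (\<lambda>y. f (congruence_class L (\<sigma> y))) x"
    and m: "negative_eigenvalues B (\<lambda>y. f (congruence_class L (\<sigma> y))) x = m"
    using mi unfolding has_morse_index_def by blast
  have B: "B \<subseteq> Basis" and sm: "smooth_on \<sigma> U" using lc by (auto simp: local_coordinates_def)
  have g: "smooth_on (\<lambda>y. F (\<sigma> y)) U" by (rule smooth_on_compose[OF sm F subset_UNIV])
  obtain S where S: "S \<subseteq> vertex_basis (vertices L)" "card S = card B"
    by (rule obtain_subset_with_card_n[OF local_coordinates_card_le[OF lc x]])
  have SB: "S \<subseteq> Basis" using S(1) vertex_basis_subset by blast
  obtain V \<phi> N where V: "open V" "0 \<in> V" "smooth_on \<phi> V" "\<phi> ` V \<subseteq> U" "\<phi> 0 = x"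
    "\<phi> ` (V \<inter> span S) \<subseteq> span B" "inj_on \<phi> (V \<inter> span S)"
    "\<And>y v. y \<in> V \<inter> span S \<Longrightarrow> v \<in> span S \<Longrightarrow> frechet_derivative \<phi> (at y) v \<in> span B"
    "\<And>y v. y \<in> V \<inter> span S \<Longrightarrow> v \<in> span S \<Longrightarrow> frechet_derivative \<phi> (at y) v = 0 \<Longrightarrow> v = 0"
    "\<And>W. openin (top_of_set (V \<inter> span S)) W \<Longrightarrow> openin (top_of_set (U \<inter> span B)) (\<phi> ` W)"
    "N \<subseteq> S" "card N = m"
    "\<And>y. y \<in> V \<inter> span S \<Longrightarrow> F (\<sigma> (\<phi> y)) = F (\<sigma> x) - (\<Sum>b\<in>N. (y \<bullet> b)\<^sup>2) + (\<Sum>b\<in>S - N. (y \<bullet> b)\<^sup>2)"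
    by (rule morse_coordinates[OF g x B nd[unfolded f] m[unfolded f] SB S(2)]) blast
  have "local_coordinates L S V (\<lambda>y. \<sigma> (\<phi> y))"
    by (rule local_coordinates_transform[OF lc SB V(3,4,6,7,8,9,10)])
  then show ?thesis
  proof (rule that[OF S(1) _ V(2) _ V(11,12)])
    show "congruence_class L (\<sigma> (\<phi> 0)) = P" using V(5) P by simp
    show "f (congruence_class L (\<sigma> (\<phi> y))) = f P - (\<Sum>b\<in>N. (y \<bullet> b)\<^sup>2) + (\<Sum>b\<in>S - N. (y \<bullet> b)\<^sup>2)"
      if "y \<in> V \<inter> span S" for y
      using V(13)[OF that] f[of "\<sigma> x"] P by (simp add: f)
  qed
qed

section \<open>Attaching a chain\<close>

text \<open>
  The side of length \<open>l\<close> of a triangle over the directed base \<open>u\<close> whose other side has length \<open>l'\<close>;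
  the sign \<open>s\<close> selects the side of the base on which the apex lies.
\<close>

definition pivot :: "real \<Rightarrow> real \<Rightarrow> real \<Rightarrow> complex \<Rightarrow> complex" where
  "pivot s l l' u = u * Complex ((u \<bullet> u + l\<^sup>2 - l'\<^sup>2) / 2)
     (s * sqrt (l\<^sup>2 * (u \<bullet> u) - ((u \<bullet> u + l\<^sup>2 - l'\<^sup>2) / 2)\<^sup>2)) / of_real (u \<bullet> u)"

text \<open>By the law of cosines the right side minus the left side is four times the squared area
  of the triangle; so these are the bases of non-degenerate triangles.\<close>

definition pivot_domain :: "real \<Rightarrow> real \<Rightarrow> complex set" where
  "pivot_domain l l' = {u. ((u \<bullet> u + l\<^sup>2 - l'\<^sup>2) / 2)\<^sup>2 < l\<^sup>2 * (u \<bullet> u)}"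

lemma open_pivot_domain: "open (pivot_domain l l')"
  unfolding pivot_domain_def by (intro open_Collect_less continuous_intros) auto

lemma pivot_domain_pos:
  assumes "u \<in> pivot_domain l l'"
  shows "0 < l\<^sup>2 * (u \<bullet> u) - ((u \<bullet> u + l\<^sup>2 - l'\<^sup>2) / 2)\<^sup>2" "u \<noteq> 0"
proof -
  show "0 < l\<^sup>2 * (u \<bullet> u) - ((u \<bullet> u + l\<^sup>2 - l'\<^sup>2) / 2)\<^sup>2"
    using assms by (simp add: pivot_domain_def)
  then have "0 < l\<^sup>2 * (u \<bullet> u)" using zero_le_power2[of "(u \<bullet> u + l\<^sup>2 - l'\<^sup>2) / 2"] by linarith
  then show "u \<noteq> 0" by auto
qed

lemma smooth_on_pivot: "smooth_on (pivot s l l') (pivot_domain l l')"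
proof -
  note o = open_pivot_domain[of l l']
  have sq: "smooth_on (\<lambda>u::complex. u \<bullet> u) (pivot_domain l l')"
    using o by (simp add: smooth_on_def Ck_on_inner Ck_on_id)
  have ofr: "smooth_on (\<lambda>u. complex_of_real (f u)) (pivot_domain l l')"
    if "smooth_on f (pivot_domain l l')" for f :: "complex \<Rightarrow> real"
    using that by (simp add: smooth_on_def Ck_on_bounded_linear_compose[OF _ bounded_linear_of_real])
  have id: "smooth_on (\<lambda>u. u) (pivot_domain l l')"
    using o by (simp add: smooth_on_def Ck_on_id)
  have A: "smooth_on (\<lambda>u. (u \<bullet> u + l\<^sup>2 - l'\<^sup>2) / 2) (pivot_domain l l')"
    using o by (intro smooth_on_divide smooth_on_diff smooth_on_add sq smooth_on_const) auto
  have R: "smooth_on (\<lambda>u. l\<^sup>2 * (u \<bullet> u) - ((u \<bullet> u + l\<^sup>2 - l'\<^sup>2) / 2) * ((u \<bullet> u + l\<^sup>2 - l'\<^sup>2) / 2)) (pivot_domain l l')"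
    using o by (intro smooth_on_diff smooth_on_mult A sq smooth_on_const)
  \<comment> \<open>The square under the root becomes a product and \<open>Complex\<close> a sum, so
    that the closure lemmas for smooth maps apply.\<close>
  have eq: "pivot s l l' = (\<lambda>u. u * (of_real ((u \<bullet> u + l\<^sup>2 - l'\<^sup>2) / 2) +
     \<i> * of_real (s * sqrt (l\<^sup>2 * (u \<bullet> u) - ((u \<bullet> u + l\<^sup>2 - l'\<^sup>2) / 2) * ((u \<bullet> u + l\<^sup>2 - l'\<^sup>2) / 2)))) / of_real (u \<bullet> u))"
    by (simp only: pivot_def[abs_def] power2_eq_square[of "(_ + _ - _) / 2"] complex_eq complex.sel)
       (simp only: Complex_eq power2_eq_square)
  have pos: "0 < l\<^sup>2 * (u \<bullet> u) - ((u \<bullet> u + l\<^sup>2 - l'\<^sup>2) / 2) * ((u \<bullet> u + l\<^sup>2 - l'\<^sup>2) / 2)"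
    and nz: "complex_of_real (u \<bullet> u) \<noteq> 0" if u: "u \<in> pivot_domain l l'" for u
    using pivot_domain_pos[OF u] by (simp_all only: power2_eq_square[of "(_ + _ - _) / 2"] of_real_eq_0_iff
        inner_eq_zero_iff not_False_eq_True)
  show ?thesis
    unfolding eq
    by (rule smooth_on_divide[OF smooth_on_mult[OF id smooth_on_add[OF ofr[OF A] smooth_on_mult[OF
          smooth_on_const[OF o] ofr[OF smooth_on_mult[OF smooth_on_const[OF o] smooth_on_sqrt[OF R pos]]]]]]
          ofr[OF sq] nz])
qed

lemma cnj_mult_self: "cnj u * u = of_real (u \<bullet> u)" for u :: complex
  by (simp add: complex_eq_iff inner_complex_def)

text \<open>For any \<open>z\<close> the number \<open>cnj u * z\<close> has the inner product of
  \<open>u\<close> and \<open>z\<close> as real part and their determinant as imaginary part; it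
  describes the side in the frame of the base.\<close>

lemma cnj_mult_pivot:
  assumes "u \<in> pivot_domain l l'"
  shows "cnj u * pivot s l l' u = Complex ((u \<bullet> u + l\<^sup>2 - l'\<^sup>2) / 2)
     (s * sqrt (l\<^sup>2 * (u \<bullet> u) - ((u \<bullet> u + l\<^sup>2 - l'\<^sup>2) / 2)\<^sup>2))" (is "_ = ?C")
proof -
  have "cnj u * pivot s l l' u = (cnj u * u) * ?C / of_real (u \<bullet> u)" by (simp add: pivot_def)
  then show ?thesis
    using pivot_domain_pos(2)[OF assms] by (simp add: cnj_mult_self)
qed

lemma norm_eq_if_inner: "(x::'a::real_inner) \<bullet> x = l\<^sup>2 \<Longrightarrow> l > 0 \<Longrightarrow> norm x = l"
  by (simp add: norm_eq_sqrt_inner real_sqrt_unique)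

text \<open>Inner product squared plus determinant squared is the product of the squared lengths
  (Lagrange), which gives the first length. The inner product prescribed by the law of cosines gives
  the second, and the determinant has the sign \<open>s\<close>.\<close>

lemma pivot_properties:
  assumes u: "u \<in> pivot_domain l l'" and s: "s * s = 1" and l: "l > 0" "l' > 0"
  shows "norm (pivot s l l' u) = l" "norm (u - pivot s l l' u) = l'"
    "s * Im (cnj u * pivot s l l' u) > 0"
proof -
  define z where "z = pivot s l l' u"
  define A where "A = (u \<bullet> u + l\<^sup>2 - l'\<^sup>2) / 2"
  define R where "R = l\<^sup>2 * (u \<bullet> u) - A\<^sup>2"
  have R: "R > 0" and u0: "u \<bullet> u > 0"
    using pivot_domain_pos[OF u] by (auto simp: R_def A_def)
  have c: "cnj u * z = Complex A (s * sqrt R)"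
    using cnj_mult_pivot[OF u] by (simp add: z_def A_def R_def)
  have "(u \<bullet> u) * (z \<bullet> z) = (cnj u * z) \<bullet> (cnj u * z)"
    by (simp add: inner_complex_def algebra_simps)
  also have "\<dots> = A\<^sup>2 + (s * s) * R"
    unfolding c using R by (simp add: inner_complex_def power2_eq_square algebra_simps)
  also have "\<dots> = (u \<bullet> u) * l\<^sup>2" using s by (simp add: R_def)
  finally have zz: "z \<bullet> z = l\<^sup>2" using u0 by simp
  show "norm (pivot s l l' u) = l" using norm_eq_if_inner[OF zz l(1)] by (simp add: z_def)
  have "u \<bullet> z = Re (cnj u * z)" by (simp add: inner_complex_def)
  then have "u \<bullet> z = A" by (simp add: c)
  then have "(u - z) \<bullet> (u - z) = l'\<^sup>2"
    using zz by (simp add: inner_diff_left inner_diff_right inner_commute[of z u] A_def field_simps)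
  then show "norm (u - pivot s l l' u) = l'" using norm_eq_if_inner l(2) by (simp add: z_def)
  have "s * Im (cnj u * z) = (s * s) * sqrt R" by (simp only: c complex.sel mult.assoc)
  then show "s * Im (cnj u * pivot s l l' u) > 0" using R s by (simp add: z_def)
qed

text \<open>The two lengths fix the inner product and, up to sign, the determinant; the condition on
  \<open>s\<close> selects one of the two mirror images.\<close>

lemma pivot_unique:
  assumes n: "norm z = l" "norm (u - z) = l'" and s: "s * s = 1" and pos: "s * Im (cnj u * z) > 0"
  shows "u \<in> pivot_domain l l'" "pivot s l l' u = z"
proof -
  define A where "A = (u \<bullet> u + l\<^sup>2 - l'\<^sup>2) / 2"
  have zz: "z \<bullet> z = l\<^sup>2" using n(1) by (simp add: power2_norm_eq_inner[symmetric])
  have "(u - z) \<bullet> (u - z) = l'\<^sup>2" using n(2) by (simp add: power2_norm_eq_inner[symmetric])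
  then have "u \<bullet> z = A"
    using zz by (simp add: inner_diff_left inner_diff_right inner_commute[of z u] A_def field_simps)
  then have Re: "Re (cnj u * z) = A" by (simp add: inner_complex_def)
  define b where "b = Im (cnj u * z)"
  have "l\<^sup>2 * (u \<bullet> u) = (cnj u * z) \<bullet> (cnj u * z)"
    unfolding zz[symmetric] by (simp add: inner_complex_def algebra_simps)
  also have "\<dots> = A\<^sup>2 + b\<^sup>2" using Re by (simp add: inner_complex_def b_def power2_eq_square del: complex_cnj_mult times_complex.sel)
  finally have b2: "l\<^sup>2 * (u \<bullet> u) - A\<^sup>2 = b\<^sup>2" by simp
  have sb: "s * b > 0" using pos by (simp add: b_def)
  then have "b \<noteq> 0" by auto
  then have "b\<^sup>2 > 0" by simp
  then have "A\<^sup>2 < l\<^sup>2 * (u \<bullet> u)" using b2 by linarith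
  then show dom: "u \<in> pivot_domain l l'" unfolding pivot_domain_def A_def by simp
  have "(s * b)\<^sup>2 = b\<^sup>2" using s by (simp add: power_mult_distrib power2_eq_square)
  then have "sqrt (b\<^sup>2) = s * b" using sb by (metis less_imp_le real_sqrt_unique)
  then have "s * sqrt (l\<^sup>2 * (u \<bullet> u) - A\<^sup>2) = b" using s by (simp add: b2 mult.assoc[symmetric])
  then have "cnj u * pivot s l l' u = Complex A b"
    using cnj_mult_pivot[OF dom, of s] by (simp add: A_def)
  also have "\<dots> = cnj u * z" by (rule complex_eqI) (simp_all only: Re b_def complex.sel)
  finally show "pivot s l l' u = z" using pivot_domain_pos(2)[OF dom] by simp
qed

section \<open>Edge vectors of a chain\<close>

definition chain_edge :: "'v chain \<Rightarrow> complex^'v::finite \<Rightarrow> nat \<Rightarrow> complex" where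
  "chain_edge Z p n = p $ (chain_vertices Z ! Suc n) - p $ (chain_vertices Z ! n)"

lemma sum_chain_edge: "(\<Sum>n<i. chain_edge Z p n) = p $ (chain_vertices Z ! i) - p $ (chain_vertices Z ! 0)"
  unfolding chain_edge_def by (rule sum_lessThan_telescope)

lemma norm_chain_edge:
  assumes "p \<in> configurations L" "chain_linkage Z \<subseteq> L" "n < length (chain_lengths Z)"
  shows "norm (chain_edge Z p n) = chain_lengths Z ! n"
proof -
  have "(chain_vertices Z ! n, chain_vertices Z ! Suc n, chain_lengths Z ! n) \<in> L"
    using assms(2,3) by (auto simp: chain_linkage_def)
  from configurations_dist[OF assms(1) this] show ?thesis
    by (simp add: chain_edge_def dist_norm norm_minus_commute)
qed

text \<open>The first edge is non-zero. Were all edges real multiples of it, all vertices would lie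
  on the line through it; so the first edge can serve as one of the pair.\<close>

lemma nonparallel_edges:
  fixes p :: "complex^'v::finite"
  assumes Z: "open_chain Z" and na: "\<not> aligned (chain_linkage Z) p" and p: "p \<in> configurations L" "chain_linkage Z \<subseteq> L"
  obtains j j' where "j < length (chain_lengths Z)" "j' < length (chain_lengths Z)" "j \<noteq> j'"
    "Im (cnj (chain_edge Z p j') * chain_edge Z p j) \<noteq> 0"
proof -
  let ?k = "length (chain_lengths Z)" and ?e = "chain_edge Z p"
  have k: "?k > 0" "length (chain_vertices Z) = Suc ?k" using Z by (auto simp: open_chain_def)
  have "\<exists>j<?k. Im (cnj (?e 0) * ?e j) \<noteq> 0"
  proof (rule ccontr)
    assume "\<not> ?thesis"
    then have par: "Im (cnj (?e 0) * ?e j) = 0" if "j < ?k" for j using that by blast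
    have "chain_lengths Z ! 0 > 0" using Z k(1) by (auto simp: open_chain_def)
    then have e0: "?e 0 \<noteq> 0" using norm_chain_edge[OF p k(1)] by auto
    have "\<exists>r. ?e j = r *\<^sub>R ?e 0" if "j < ?k" for j
    proof -
      define r where "r = Re (cnj (?e 0) * ?e j) / (?e 0 \<bullet> ?e 0)"
      have "cnj (?e 0) * ?e j = of_real (Re (cnj (?e 0) * ?e j))"
        using par[OF that] by (simp add: complex_eq_iff)
      also have "\<dots> = cnj (?e 0) * ?e 0 * of_real r"
        using e0 by (simp add: cnj_mult_self r_def)
      finally have "?e j = ?e 0 * of_real r" using e0 by simp
      then show ?thesis by (auto simp: scaleR_conv_of_real mult.commute)
    qed
    then obtain r where r: "\<And>j. j < ?k \<Longrightarrow> ?e j = r j *\<^sub>R ?e 0" by metis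
    have pos: "p $ (chain_vertices Z ! i) = p $ (chain_vertices Z ! 0) + (\<Sum>n<i. r n) *\<^sub>R ?e 0" if "i \<le> ?k" for i
    proof -
      have "(\<Sum>n<i. ?e n) = (\<Sum>n<i. r n *\<^sub>R ?e 0)" using that by (intro sum.cong refl r) auto
      then show ?thesis using sum_chain_edge[where i=i and Z=Z and p=p] by (simp add: scaleR_sum_left[symmetric] algebra_simps)
    qed
    have "collinear (($) p ` set (chain_vertices Z))"
      unfolding collinear_def
    proof (intro exI[of _ "?e 0"] ballI)
      fix x y assume "x \<in> ($) p ` set (chain_vertices Z)" "y \<in> ($) p ` set (chain_vertices Z)"
      then obtain a b where "a \<le> ?k" "b \<le> ?k" "x = p $ (chain_vertices Z ! a)" "y = p $ (chain_vertices Z ! b)"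
        using k(2) by (auto simp: in_set_conv_nth less_Suc_eq_le)
      then have "x - y = ((\<Sum>n<a. r n) - (\<Sum>n<b. r n)) *\<^sub>R ?e 0"
        by (simp only: pos[of a] pos[of b] scaleR_diff_left) simp
      then show "\<exists>c. x - y = c *\<^sub>R ?e 0" by blast
    qed
    then show False using na by (simp add: aligned_def vertices_chain_linkage[OF Z])
  qed
  then obtain j where j: "j < ?k" "Im (cnj (?e 0) * ?e j) \<noteq> 0" by blast
  have "Im (cnj (?e 0) * ?e 0) = 0" by (simp only: cnj_mult_self Im_complex_of_real)
  with j(2) have "j \<noteq> 0" by metis
  then show ?thesis using that[OF j(1) k(1) _ j(2)] by blast
qed

text \<open>The openness clause of \<open>local_coordinates\<close> says that preimages under the
  inverse chart are open, read on configurations instead of orbits; injectivity on orbits makes the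
  choice of \<open>\<kappa>\<close> unique.\<close>

lemma local_coordinates_inverse:
  fixes L :: "'v::finite linkage"
  assumes lc: "local_coordinates L S V \<sigma>"
  obtains E \<kappa> where "openin (top_of_set (configurations L)) E" "continuous_on E \<kappa>"
    "\<And>r. r \<in> E \<Longrightarrow> \<kappa> r \<in> V \<inter> span S" "\<And>r. r \<in> E \<Longrightarrow> r \<in> congruence_class L (\<sigma> (\<kappa> r))"
    "\<And>y r. y \<in> V \<inter> span S \<Longrightarrow> r \<in> congruence_class L (\<sigma> y) \<Longrightarrow> r \<in> E"
    "\<And>y r. y \<in> V \<inter> span S \<Longrightarrow> r \<in> congruence_class L (\<sigma> y) \<Longrightarrow> \<kappa> r = y"
proof -
  have inj: "inj_on (\<lambda>x. congruence_class L (\<sigma> x)) (V \<inter> span S)"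
    and opn: "\<And>W. openin (top_of_set (V \<inter> span S)) W \<Longrightarrow>
        openin (top_of_set (configurations L)) (\<Union>x\<in>W. congruence_class L (\<sigma> x))"
    using lc by (auto simp: local_coordinates_def)
  define E where "E = (\<Union>x\<in>V \<inter> span S. congruence_class L (\<sigma> x))"
  define \<kappa> where "\<kappa> r = (SOME y. y \<in> V \<inter> span S \<and> r \<in> congruence_class L (\<sigma> y))" for r
  have \<kappa>: "\<kappa> r \<in> V \<inter> span S \<and> r \<in> congruence_class L (\<sigma> (\<kappa> r))" if "r \<in> E" for r
    unfolding \<kappa>_def by (rule someI_ex) (use that in \<open>auto simp: E_def\<close>)
  have uniq: "\<kappa> r = y" if y: "y \<in> V \<inter> span S" "r \<in> congruence_class L (\<sigma> y)" for y r
  proof -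
    have "r \<in> E" using y by (auto simp: E_def)
    note k = \<kappa>[OF this]
    have "congruence_class L (\<sigma> (\<kappa> r)) = congruence_class L (\<sigma> y)"
      using congruence_class_eqI[OF y(2)] congruence_class_eqI[of r L "\<sigma> (\<kappa> r)"] k by simp
    then show ?thesis using inj_onD[OF inj] k y(1) by blast
  qed
  have E: "openin (top_of_set (configurations L)) E" unfolding E_def by (rule opn) simp
  have "continuous_on E \<kappa>"
    unfolding continuous_openin_preimage_eq
  proof (intro allI impI)
    fix T :: "(complex^'v) set" assume "open T"
    then have "openin (top_of_set (V \<inter> span S)) (V \<inter> span S \<inter> T)" by (simp add: openin_open_Int)
    from opn[OF this]
    have "openin (top_of_set (configurations L)) (\<Union>x\<in>V \<inter> span S \<inter> T. congruence_class L (\<sigma> x))" .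
    moreover have "(\<Union>x\<in>V \<inter> span S \<inter> T. congruence_class L (\<sigma> x)) = E \<inter> \<kappa> -` T"
    proof (intro equalityI subsetI)
      fix r assume "r \<in> (\<Union>x\<in>V \<inter> span S \<inter> T. congruence_class L (\<sigma> x))"
      then obtain y where "y \<in> V \<inter> span S" "y \<in> T" "r \<in> congruence_class L (\<sigma> y)" by blast
      then show "r \<in> E \<inter> \<kappa> -` T" using uniq[of y r] by (auto simp: E_def)
    next
      fix r assume "r \<in> E \<inter> \<kappa> -` T"
      then show "r \<in> (\<Union>x\<in>V \<inter> span S \<inter> T. congruence_class L (\<sigma> x))" using \<kappa>[of r] by blast
    qed
    ultimately have "openin (top_of_set (configurations L)) (E \<inter> \<kappa> -` T)" by simp
    then show "openin (top_of_set E) (E \<inter> \<kappa> -` T)"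
      by (rule openin_subset_trans[OF _ Int_lower1 openin_imp_subset[OF E]])
  qed
  then show ?thesis
    using that[of E \<kappa>] E \<kappa> uniq by (auto simp: E_def)
qed

section \<open>The extended chart of a linkage with an attached chain\<close>

text \<open>The vector \<open>c n\<close> carries the angle of the free edge \<open>n\<close> and
  avoids the vectors \<open>S\<close> of the given chart; the edges \<open>j\<close> and
  \<open>j'\<close> close the chain. The edge from \<open>v1\<close> to \<open>v2\<close> has
  distinct ends, so the rotational part of a motion can be read off from it.\<close>

locale chain_extension =
  fixes L :: "'v::finite linkage" and Z :: "'v chain"
    and S V :: "(complex^'v) set" and \<sigma> :: "complex^'v \<Rightarrow> complex^'v" and q :: "complex^'v"
    and v1 v2 :: 'v and l0 :: real and j j' :: nat and c :: "nat \<Rightarrow> complex^'v"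
  assumes Z: "open_chain Z"
    and ends: "hd (chain_vertices Z) \<in> vertices L" "last (chain_vertices Z) \<in> vertices L"
    and interior: "set (chain_vertices Z) \<inter> vertices L \<subseteq> {hd (chain_vertices Z), last (chain_vertices Z)}"
    and base_edge: "(v1, v2, l0) \<in> L" "0 < l0"
    and lc: "local_coordinates L S V \<sigma>" and zeroV: "0 \<in> V"
    and q: "q \<in> configurations (L \<union> chain_linkage Z)" and restr_q: "restriction L q = \<sigma> 0"
    and jk: "j < length (chain_lengths Z)" "j' < length (chain_lengths Z)" "j \<noteq> j'"
    and nonpar: "Im (cnj (chain_edge Z q j') * chain_edge Z q j) \<noteq> 0"
    and c_inj: "inj_on c ({..<length (chain_lengths Z)} - {j, j'})"
    and c_Basis: "c ` ({..<length (chain_lengths Z)} - {j, j'}) \<subseteq> Basis - S"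
begin

abbreviation "L3 \<equiv> L \<union> chain_linkage Z"
abbreviation "zs \<equiv> chain_vertices Z"
abbreviation "ls \<equiv> chain_lengths Z"
abbreviation "k \<equiv> length (chain_lengths Z)"

definition "F = {..<k} - {j, j'}"
definition "B3 = S \<union> c ` F"
definition "sg = sgn (Im (cnj (chain_edge Z q j') * chain_edge Z q j))"
definition proj :: "complex^'v \<Rightarrow> complex^'v" where "proj w = (\<Sum>b\<in>S. (w \<bullet> b) *\<^sub>R b)"
text \<open>The angle is measured from the direction of the edge in \<open>q\<close>, which places
  \<open>q\<close> at the origin of the chart.\<close>

definition free_edge :: "complex^'v \<Rightarrow> nat \<Rightarrow> complex" where
  "free_edge w n = chain_edge Z q n * cis (w \<bullet> c n)"
text \<open>The sum that the edges \<open>j\<close> and \<open>j'\<close> must have. They need not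
  be adjacent: edge vectors add up in any order, so after translation they are two sides of a
  triangle over this base.\<close>

definition span_vector :: "complex^'v \<Rightarrow> complex" where
  "span_vector w = \<sigma> (proj w) $ (zs ! k) - \<sigma> (proj w) $ (zs ! 0) - (\<Sum>n\<in>F. free_edge w n)"
definition edge :: "complex^'v \<Rightarrow> nat \<Rightarrow> complex" where
  "edge w n = (if n = j then pivot sg (ls ! j) (ls ! j') (span_vector w)
     else if n = j' then span_vector w - pivot sg (ls ! j) (ls ! j') (span_vector w)
     else free_edge w n)"
definition position :: "'v \<Rightarrow> nat" where "position v = (THE i. i \<le> k \<and> zs ! i = v)"
definition \<tau> :: "complex^'v \<Rightarrow> complex^'v" where
  "\<tau> w = (\<chi> v. if v \<in> vertices L then \<sigma> (proj w) $ v
     else if v \<in> set zs then \<sigma> (proj w) $ (zs ! 0) + (\<Sum>n<position v. edge w n) else 0)"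
text \<open>With angles below \<open>pi / 2\<close> the ratio of a free edge to its original in
  \<open>q\<close> has positive real part, and the principal argument recovers the angle.\<close>

definition W :: "(complex^'v) set" where
  "W = {w. proj w \<in> V \<and> span_vector w \<in> pivot_domain (ls ! j) (ls ! j') \<and> (\<forall>n\<in>F. \<bar>w \<bullet> c n\<bar> < pi / 2)}"

lemma len: "length zs = Suc k" and dist_zs: "distinct zs"
  and ls_pos: "\<And>n. n < k \<Longrightarrow> ls ! n > 0"
  using Z by (auto simp: open_chain_def)

lemma FF: "F \<subseteq> {..<k}" "j \<notin> F" "j' \<notin> F" "finite F"
  by (auto simp: F_def)

lemma S_Basis: "S \<subseteq> Basis" and smooth_\<sigma>: "smooth_on \<sigma> V"
  and \<sigma>_conf: "\<And>y. y \<in> V \<inter> span S \<Longrightarrow> \<sigma> y \<in> configurations L"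
  and \<sigma>_imm: "\<And>y v. y \<in> V \<inter> span S \<Longrightarrow> v \<in> span S \<Longrightarrow>
      frechet_derivative \<sigma> (at y) v \<in> infinitesimal_motions L (\<sigma> y) \<Longrightarrow> v = 0"
  using lc by (auto simp: local_coordinates_def)

lemma finS: "finite S" using S_Basis finite_Basis finite_subset by blast

lemma cB: "n \<in> F \<Longrightarrow> c n \<in> Basis" "n \<in> F \<Longrightarrow> c n \<notin> S"
  and cF_inj: "inj_on c F"
  using c_Basis c_inj by (auto simp: F_def)

lemma B3_Basis: "B3 \<subseteq> Basis" using S_Basis cB by (auto simp: B3_def)

lemma c_ip: "n \<in> F \<Longrightarrow> m \<in> F \<Longrightarrow> c n \<bullet> c m = (if n = m then 1 else 0)"
  using cB cF_inj by (auto simp: inner_Basis inj_on_eq_iff)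

lemma linear_proj: "linear proj"
  unfolding proj_def
  by (rule linearI) (simp_all add: inner_add_left scaleR_add_left sum.distrib scaleR_sum_right)

lemma bounded_linear_proj: "bounded_linear proj"
  using linear_proj by (simp add: linear_conv_bounded_linear)

lemma proj_span: "proj w \<in> span S"
  unfolding proj_def by (intro span_sum span_scale span_base)

lemma proj_id: "w \<in> span S \<Longrightarrow> proj w = w"
  using span_Basis_representation[OF S_Basis] by (simp add: proj_def)

lemma proj_c: "n \<in> F \<Longrightarrow> proj (c n) = 0"
  unfolding proj_def using cB[of n] S_Basis by (intro sum.neutral) (auto simp: inner_Basis)

lemma span_S_c: "w \<in> span S \<Longrightarrow> n \<in> F \<Longrightarrow> w \<bullet> c n = 0"
  using cB[of n] unfolding span_substd_basis[OF S_Basis] by auto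

lemma B3_representation:
  assumes "w \<in> span B3"
  shows "w = proj w + (\<Sum>n\<in>F. (w \<bullet> c n) *\<^sub>R c n)"
proof -
  have "w = (\<Sum>b\<in>S \<union> c ` F. (w \<bullet> b) *\<^sub>R b)"
    using span_Basis_representation[OF B3_Basis assms] by (simp add: B3_def)
  also have "\<dots> = proj w + (\<Sum>b\<in>c ` F. (w \<bullet> b) *\<^sub>R b)"
    unfolding proj_def using finS FF(4) cB(2) by (intro sum.union_disjoint) auto
  also have "(\<Sum>b\<in>c ` F. (w \<bullet> b) *\<^sub>R b) = (\<Sum>n\<in>F. (w \<bullet> c n) *\<^sub>R c n)"
    using sum.reindex[OF cF_inj] by simp
  finally show ?thesis .
qed

lemma free_coordinates:
  assumes y: "y \<in> span S"
  shows "y + (\<Sum>n\<in>F. r n *\<^sub>R c n) \<in> span B3" "proj (y + (\<Sum>n\<in>F. r n *\<^sub>R c n)) = y"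
    "m \<in> F \<Longrightarrow> (y + (\<Sum>n\<in>F. r n *\<^sub>R c n)) \<bullet> c m = r m"
proof -
  show "y + (\<Sum>n\<in>F. r n *\<^sub>R c n) \<in> span B3"
    using y span_mono[of S B3] by (intro span_add span_sum span_scale) (auto simp: B3_def intro: span_base)
  show "proj (y + (\<Sum>n\<in>F. r n *\<^sub>R c n)) = y"
    by (simp add: linear_add[OF linear_proj] linear_sum[OF linear_proj] linear_cmul[OF linear_proj] proj_c proj_id[OF y])
  assume m: "m \<in> F"
  have "(\<Sum>n\<in>F. r n *\<^sub>R c n) \<bullet> c m = (\<Sum>n\<in>F. if n = m then r n else 0)"
    unfolding inner_sum_left using m by (intro sum.cong) (auto simp: c_ip)
  then show "(y + (\<Sum>n\<in>F. r n *\<^sub>R c n)) \<bullet> c m = r m"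
    using m FF(4) span_S_c[OF y m] by (simp add: inner_add_left)
qed

lemma zs_L: "zs ! 0 \<in> vertices L" "zs ! k \<in> vertices L"
  and zs_interior: "0 < i \<Longrightarrow> i < k \<Longrightarrow> zs ! i \<notin> vertices L"
proof -
  have ne: "zs \<noteq> []" using len by auto
  have h: "hd zs = zs ! 0" and l: "last zs = zs ! k"
    using ne len by (simp_all add: hd_conv_nth last_conv_nth)
  show "zs ! 0 \<in> vertices L" "zs ! k \<in> vertices L" using ends h l by simp_all
  assume i: "0 < i" "i < k"
  have "zs ! i \<noteq> zs ! 0" "zs ! i \<noteq> zs ! k"
    using dist_zs len i by (simp_all add: nth_eq_iff_index_eq)
  moreover have "zs ! i \<in> set zs" using i len by simp
  ultimately show "zs ! i \<notin> vertices L" using interior h l by auto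
qed

lemma position: "i \<le> k \<Longrightarrow> position (zs ! i) = i"
  unfolding position_def using dist_zs len by (intro the_equality) (auto simp: nth_eq_iff_index_eq)

lemma sum_edges: "(\<Sum>n<k. f n) = f j + f j' + (\<Sum>n\<in>F. f n)" for f :: "nat \<Rightarrow> complex"
proof -
  have "{..<k} = insert j (insert j' F)" using jk by (auto simp: F_def)
  then show ?thesis using FF jk(3) by simp
qed

lemma edge_F: "n \<in> F \<Longrightarrow> edge w n = free_edge w n"
  using FF by (auto simp: edge_def)

lemma sum_edge: "(\<Sum>n<k. edge w n) = \<sigma> (proj w) $ (zs ! k) - \<sigma> (proj w) $ (zs ! 0)"
proof -
  have "(\<Sum>n<k. edge w n) = edge w j + edge w j' + (\<Sum>n\<in>F. free_edge w n)"
    by (simp add: sum_edges edge_F)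
  then show ?thesis using jk(3) by (simp add: edge_def span_vector_def)
qed

lemma \<tau>_L: "v \<in> vertices L \<Longrightarrow> \<tau> w $ v = \<sigma> (proj w) $ v"
  by (simp add: \<tau>_def)

text \<open>For interior vertices this is how \<open>\<tau>\<close> is built. At the terminal
  vertex, where \<open>\<tau>\<close> is prescribed by \<open>\<sigma>\<close>, it holds because the
  edges close up.\<close>

lemma \<tau>_zs:
  assumes "i \<le> k"
  shows "\<tau> w $ (zs ! i) = \<sigma> (proj w) $ (zs ! 0) + (\<Sum>n<i. edge w n)"
proof (cases "0 < i \<and> i < k")
  case True
  then show ?thesis using assms len zs_interior[of i] position[OF assms] by (simp add: \<tau>_def)
next
  case False
  then have "i = 0 \<or> i = k" using assms by auto
  then show ?thesis using zs_L by (auto simp: \<tau>_L sum_edge)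
qed

lemma chain_edge_\<tau>: "n < k \<Longrightarrow> chain_edge Z (\<tau> w) n = edge w n"
  by (simp add: chain_edge_def \<tau>_zs)

lemma vertices_L3: "vertices L3 = vertices L \<union> set zs"
  by (simp add: vertices_Un vertices_chain_linkage[OF Z])

lemma \<tau>_outside: "v \<notin> vertices L3 \<Longrightarrow> \<tau> w $ v = 0"
  by (simp add: vertices_L3 \<tau>_def)

lemma sg: "sg * sg = 1" "sg * Im (cnj (chain_edge Z q j') * chain_edge Z q j) > 0"
  using nonpar by (auto simp: sg_def sgn_if)

text \<open>As \<open>cnj a * a\<close> is real, a side has the same determinant against the base of
  the triangle as against the other side.\<close>

lemma Im_cnj_sum: "Im (cnj (a + b) * a) = Im (cnj b * a)"
  by (simp add: algebra_simps)

lemma norm_e0: "n < k \<Longrightarrow> norm (chain_edge Z q n) = ls ! n"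
  by (rule norm_chain_edge[OF q]) auto

lemma e0_nz: "n < k \<Longrightarrow> chain_edge Z q n \<noteq> 0"
  using norm_e0[of n] ls_pos[of n] by auto

lemma norm_edge:
  assumes "w \<in> W" "n < k"
  shows "norm (edge w n) = ls ! n"
proof -
  have "span_vector w \<in> pivot_domain (ls ! j) (ls ! j')" using assms(1) by (simp add: W_def)
  from pivot_properties(1,2)[OF this sg(1) ls_pos[OF jk(1)] ls_pos[OF jk(2)]]
  show ?thesis using norm_e0[OF assms(2)] by (simp add: edge_def free_edge_def norm_mult)
qed

lemma \<sigma>0: "v \<in> vertices L \<Longrightarrow> \<sigma> 0 $ v = q $ v"
  using restr_q by (metis restriction_nth)

text \<open>At the origin the free edges are those of \<open>q\<close>, so the base is the sum of
  its edges \<open>j\<close> and \<open>j'\<close>; uniqueness of the triangle with orientation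
  \<open>sg\<close> returns exactly these edges.\<close>

lemma span_vector_0:
  "span_vector 0 \<in> pivot_domain (ls ! j) (ls ! j')" "n < k \<Longrightarrow> edge 0 n = chain_edge Z q n"
proof -
  let ?e = "chain_edge Z q"
  have "(\<Sum>n<k. ?e n) = q $ (zs ! k) - q $ (zs ! 0)" by (rule sum_chain_edge)
  then have sv: "span_vector 0 = ?e j + ?e j'"
    using sum_edges[of ?e] zs_L by (simp add: span_vector_def linear_0[OF linear_proj] \<sigma>0 free_edge_def algebra_simps)
  have "sg * Im (cnj (span_vector 0) * ?e j) > 0"
    unfolding sv Im_cnj_sum by (rule sg(2))
  from pivot_unique[OF norm_e0[OF jk(1)] _ sg(1) this, of "ls ! j'"]
  have *: "span_vector 0 \<in> pivot_domain (ls ! j) (ls ! j')"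
     "pivot sg (ls ! j) (ls ! j') (span_vector 0) = ?e j"
    using norm_e0[OF jk(2)] by (simp_all add: sv)
  show "span_vector 0 \<in> pivot_domain (ls ! j) (ls ! j')" by (rule *(1))
  assume "n < k"
  then show "edge 0 n = ?e n" by (simp add: edge_def *(2)) (simp add: sv free_edge_def)
qed

lemma zeroW: "0 \<in> W"
  using span_vector_0(1) zeroV by (simp add: W_def linear_0[OF linear_proj])

lemma set_zs: "v \<in> set zs \<Longrightarrow> \<exists>i\<le>k. v = zs ! i"
  using len by (auto simp: in_set_conv_nth less_Suc_eq_le)

lemma \<tau>_0: "\<tau> 0 = q"
proof (rule vec_eq_iff[THEN iffD2], rule allI)
  fix v
  consider "v \<in> vertices L" | "v \<in> set zs" | "v \<notin> vertices L3" by (auto simp: vertices_L3)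
  then show "\<tau> 0 $ v = q $ v"
  proof cases
    case 1 then show ?thesis by (simp add: \<tau>_L linear_0[OF linear_proj] \<sigma>0)
  next
    case 2
    then obtain i where i: "i \<le> k" "v = zs ! i" using set_zs by blast
    have "(\<Sum>n<i. edge 0 n) = (\<Sum>n<i. chain_edge Z q n)"
      using i(1) by (intro sum.cong refl span_vector_0(2)) auto
    then show ?thesis unfolding i(2) \<tau>_zs[OF i(1)] sum_chain_edge
      using zs_L by (simp add: linear_0[OF linear_proj] \<sigma>0)
  next
    case 3 then show ?thesis using configurations_outside[OF q] by (simp add: \<tau>_outside)
  qed
qed

lemma \<tau>_conf:
  assumes w: "w \<in> W"
  shows "\<tau> w \<in> configurations L3"
proof (rule configurationsI)
  have \<sigma>: "\<sigma> (proj w) \<in> configurations L" using w proj_span by (intro \<sigma>_conf) (auto simp: W_def)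
  fix u v l assume "(u, v, l) \<in> L3"
  then consider "(u, v, l) \<in> L" | "(u, v, l) \<in> chain_linkage Z" by blast
  then show "dist (\<tau> w $ u) (\<tau> w $ v) = l"
  proof cases
    case 1
    then show ?thesis using configurations_dist[OF \<sigma> 1] edge_vertices[OF 1] by (simp add: \<tau>_L)
  next
    case 2
    then obtain n where n: "n < k" "u = zs ! n" "v = zs ! Suc n" "l = ls ! n"
      by (auto simp: chain_linkage_def)
    have "dist (\<tau> w $ v) (\<tau> w $ u) = l"
      using norm_edge[OF w n(1)] chain_edge_\<tau>[OF n(1), of w]
      by (simp add: chain_edge_def dist_norm n)
    then show ?thesis by (simp only: dist_commute)
  qed
qed (rule \<tau>_outside)

lemma restriction_\<tau>:
  assumes w: "w \<in> W"
  shows "restriction L (\<tau> w) = \<sigma> (proj w)"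
proof -
  have "\<sigma> (proj w) \<in> configurations L" using w proj_span by (intro \<sigma>_conf) (auto simp: W_def)
  then show ?thesis by (auto simp: vec_eq_iff restriction_nth \<tau>_L configurations_outside)
qed

lemma smooth_proj: "open O' \<Longrightarrow> smooth_on proj O'"
  by (rule smooth_on_bounded_linear[OF _ bounded_linear_proj])

lemma open_projV: "open (proj -` V)"
  using smooth_onD(2)[OF smooth_\<sigma>] linear_continuous_on[OF bounded_linear_proj] by (intro open_vimage)

lemma smooth_\<sigma>_proj: "smooth_on (\<lambda>w. \<sigma> (proj w) $ v) (proj -` V)"
proof -
  have "smooth_on (\<lambda>w. \<sigma> (proj w)) (proj -` V)"
    by (rule smooth_on_compose[OF smooth_proj[OF open_projV] smooth_\<sigma>]) auto
  then show ?thesis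
    by (simp add: smooth_on_def Ck_on_bounded_linear_compose[OF _ bounded_linear_vec_nth])
qed

lemma smooth_free_edge:
  assumes "open O'"
  shows "smooth_on (\<lambda>w. free_edge w n) O'"
proof -
  have "smooth_on (\<lambda>w. cis (w \<bullet> c n)) O'"
    using smooth_on_inner_const[OF assms] by (simp add: smooth_on_def Ck_on_cis)
  then show ?thesis
    unfolding free_edge_def using assms by (intro smooth_on_mult smooth_on_const)
qed

lemma smooth_span_vector: "smooth_on span_vector (proj -` V)"
  unfolding span_vector_def[abs_def]
  by (intro smooth_on_diff smooth_on_sum smooth_\<sigma>_proj smooth_free_edge open_projV)

lemma open_W: "open W"
proof -
  have 1: "open (proj -` V \<inter> span_vector -` pivot_domain (ls ! j) (ls ! j'))"
    by (rule continuous_open_preimage[OF smooth_on_continuous_on[OF smooth_span_vector] open_projV open_pivot_domain])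
  have 2: "open (\<Inter>n\<in>F. {w. \<bar>w \<bullet> c n\<bar> < pi / 2})"
    using FF(4) by (intro open_INT ballI open_Collect_less continuous_intros)
  have "W = (proj -` V \<inter> span_vector -` pivot_domain (ls ! j) (ls ! j')) \<inter> (\<Inter>n\<in>F. {w. \<bar>w \<bullet> c n\<bar> < pi / 2})"
    by (auto simp: W_def)
  then show ?thesis using open_Int[OF 1 2] by simp
qed

lemma W_sub: "W \<subseteq> proj -` V" by (auto simp: W_def)

lemma smooth_edge: "smooth_on (\<lambda>w. edge w n) W"
proof -
  have sv: "smooth_on span_vector W" by (rule smooth_on_subset[OF smooth_span_vector W_sub open_W])
  have pv: "smooth_on (\<lambda>w. pivot sg (ls ! j) (ls ! j') (span_vector w)) W"
    by (rule smooth_on_compose[OF sv smooth_on_pivot]) (auto simp: W_def)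
  show ?thesis
    unfolding edge_def using pv smooth_on_diff[OF sv pv] smooth_free_edge[OF open_W]
    by (cases "n = j"; cases "n = j'") simp_all
qed

lemma smooth_\<tau>: "smooth_on \<tau> W"
proof -
  have comp: "smooth_on (\<lambda>w. \<tau> w $ v) W" for v
  proof -
    have s: "smooth_on (\<lambda>w. \<sigma> (proj w) $ v) W" for v
      by (rule smooth_on_subset[OF smooth_\<sigma>_proj W_sub open_W])
    have "smooth_on (\<lambda>w. \<sigma> (proj w) $ (zs ! 0) + (\<Sum>n<position v. edge w n)) W"
      by (intro smooth_on_add smooth_on_sum s smooth_edge open_W)
    then show ?thesis
      using s[of v] smooth_on_const[OF open_W, of "0 :: complex"]
      by (cases "v \<in> vertices L"; cases "v \<in> set zs") (simp_all add: \<tau>_def)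
  qed
  then show ?thesis by (simp add: smooth_on_def Ck_on_vec)
qed

text \<open>A complex affine map of the plane that vanishes at two distinct points, here the ends of
  the base edge, is zero.\<close>

lemma infinitesimal_motion_edges:
  assumes x: "x \<in> configurations L3"
    and z: "\<And>v. v \<in> vertices L \<Longrightarrow> affine_image L3 (\<i> * of_real t) b x $ v = 0"
  shows "t = 0" "b = 0"
proof -
  have "(v1, v2, l0) \<in> L3" using base_edge(1) by simp
  from configurations_dist[OF x this] have ne: "x $ v1 \<noteq> x $ v2" using base_edge(2) by auto
  have v: "v1 \<in> vertices L" "v2 \<in> vertices L" using edge_vertices[OF base_edge(1)] by auto
  then have *: "\<i> * of_real t * x $ v1 + b = 0" "\<i> * of_real t * x $ v2 + b = 0"
    using z[of v1] z[of v2] by (auto simp: affine_image_nth vertices_L3)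
  then have "\<i> * of_real t * x $ v1 = \<i> * of_real t * x $ v2" by (metis add_right_imp_eq)
  then show "t = 0" using ne by simp
  then show "b = 0" using * by simp
qed

text \<open>On the vertices of \<open>L\<close> the hypothesis reduces to the immersion property of
  \<open>\<sigma>\<close>, which kills the part of \<open>v\<close> along \<open>S\<close>. The
  motion then vanishes on \<open>L\<close> and hence is zero, and the velocity of a free edge is a
  non-zero vector times its angular velocity \<open>v \<bullet> c n\<close>.\<close>

lemma \<tau>_immersion:
  assumes w: "w \<in> W \<inter> span B3" and v: "v \<in> span B3"
    and D: "frechet_derivative \<tau> (at w) v \<in> infinitesimal_motions L3 (\<tau> w)"
  shows "v = 0"
proof -
  let ?D = "frechet_derivative \<tau> (at w)" and ?y = "proj w" and ?D' = "frechet_derivative \<sigma> (at (proj w))"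
  have wW: "w \<in> W" and y: "?y \<in> V \<inter> span S" using w proj_span by (auto simp: W_def)
  have der\<tau>: "(\<tau> has_derivative ?D) (at w)" by (rule smooth_on_has_derivative[OF smooth_\<tau> wW])
  obtain t b where tb: "?D v = affine_image L3 (\<i> * of_real t) b (\<tau> w)"
    using D by (auto simp: infinitesimal_motions_def)
  have DL: "?D v $ x = ?D' (proj v) $ x" if x: "x \<in> vertices L" for x
  proof -
    have "((\<lambda>w. \<sigma> (proj w)) has_derivative (\<lambda>v. ?D' (proj v))) (at w)"
      using has_derivative_compose[OF bounded_linear_imp_has_derivative[OF bounded_linear_proj]
          smooth_on_has_derivative[OF smooth_\<sigma>, of ?y]] y by simp
    from bounded_linear.has_derivative[OF bounded_linear_vec_nth this]
    have "((\<lambda>w. \<tau> w $ x) has_derivative (\<lambda>v. ?D' (proj v) $ x)) (at w)"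
      using x by (simp add: \<tau>_L)
    moreover have "((\<lambda>w. \<tau> w $ x) has_derivative (\<lambda>v. ?D v $ x)) (at w)"
      by (rule bounded_linear.has_derivative[OF bounded_linear_vec_nth der\<tau>])
    ultimately show ?thesis using has_derivative_unique by metis
  qed
  have "?D' (proj v) = affine_image L (\<i> * of_real t) b (\<sigma> ?y)"
  proof (rule vec_eq_iff[THEN iffD2], rule allI)
    fix x show "?D' (proj v) $ x = affine_image L (\<i> * of_real t) b (\<sigma> ?y) $ x"
    proof (cases "x \<in> vertices L")
      case True
      then show ?thesis using DL[OF True] by (simp add: tb affine_image_nth vertices_L3 \<tau>_L)
    next
      case False
      then show ?thesis
        using local_coordinates_derivative_outside[OF lc y proj_span False] by (simp add: affine_image_nth)
    qed
  qed
  then have "?D' (proj v) \<in> infinitesimal_motions L (\<sigma> ?y)"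
    unfolding infinitesimal_motions_def by blast
  then have pv: "proj v = 0" by (rule \<sigma>_imm[OF y proj_span])
  have "?D' 0 = 0" using linear_0 has_derivative_linear smooth_on_has_derivative[OF smooth_\<sigma>] y by blast
  then have "t = 0" "b = 0"
    using infinitesimal_motion_edges[OF \<tau>_conf[OF wW], of t b] DL pv by (simp_all add: tb)
  then have D0: "?D v = 0" by (simp add: tb vec_eq_iff affine_image_nth)
  have vc: "v \<bullet> c n = 0" if n: "n \<in> F" for n
  proof -
    have nk: "n < k" using n FF(1) by auto
    have "bounded_linear (\<lambda>x::complex^'v. x $ (zs ! Suc n) - x $ (zs ! n))"
      by (intro bounded_linear_sub bounded_linear_vec_nth)
    from bounded_linear.has_derivative[OF this der\<tau>]
    have "((\<lambda>w. chain_edge Z (\<tau> w) n) has_derivative (\<lambda>v. ?D v $ (zs ! Suc n) - ?D v $ (zs ! n))) (at w)"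
      by (simp add: chain_edge_def)
    then have 1: "((\<lambda>w. free_edge w n) has_derivative (\<lambda>v. ?D v $ (zs ! Suc n) - ?D v $ (zs ! n))) (at w)"
      by (simp add: chain_edge_\<tau>[OF nk] edge_F[OF n])
    have i: "((\<lambda>w. w \<bullet> c n) has_derivative (\<lambda>v. v \<bullet> c n)) (at w)"
      by (intro has_derivative_inner_left has_derivative_ident)
    from has_derivative_mult_right[OF has_derivative_compose[OF i has_derivative_cis], of "chain_edge Z q n"]
    have 2: "((\<lambda>w. free_edge w n) has_derivative
        (\<lambda>v. chain_edge Z q n * ((v \<bullet> c n) *\<^sub>R (\<i> * cis (w \<bullet> c n))))) (at w)"
      by (simp add: free_edge_def)
    have "?D v $ (zs ! Suc n) - ?D v $ (zs ! n) =
        chain_edge Z q n * ((v \<bullet> c n) *\<^sub>R (\<i> * cis (w \<bullet> c n)))"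
      by (rule fun_cong[OF has_derivative_unique[OF 1 2]])
    then show ?thesis using D0 e0_nz[OF nk] by (simp add: cis_neq_zero)
  qed
  show "v = 0" using B3_representation[OF v] pv vc by simp
qed

end

context chain_extension begin

text \<open>Injectivity and openness both come from an explicit inverse: \<open>coord\<close> is
  continuous on the relatively open set \<open>D\<close> of configurations, returns \<open>w\<close>
  on the orbit of \<open>\<tau> w\<close>, and every point of \<open>D\<close> is congruent to the
  value of \<open>\<tau>\<close> at its coordinates.\<close>

lemma local_coordinates_\<tau>: "local_coordinates L3 B3 W \<tau>"
proof -
  obtain E \<kappa> where E: "openin (top_of_set (configurations L)) E" and cont\<kappa>: "continuous_on E \<kappa>"
    and \<kappa>V: "\<And>r. r \<in> E \<Longrightarrow> \<kappa> r \<in> V \<inter> span S"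
    and \<kappa>c: "\<And>r. r \<in> E \<Longrightarrow> r \<in> congruence_class L (\<sigma> (\<kappa> r))"
    and inE: "\<And>y r. y \<in> V \<inter> span S \<Longrightarrow> r \<in> congruence_class L (\<sigma> y) \<Longrightarrow> r \<in> E"
    and \<kappa>u: "\<And>y r. y \<in> V \<inter> span S \<Longrightarrow> r \<in> congruence_class L (\<sigma> y) \<Longrightarrow> \<kappa> r = y"
    using local_coordinates_inverse[OF lc] by blast
  \<comment> \<open>On \<open>D1\<close> the part on \<open>L\<close> lies in the range of the given
    chart. \<open>K\<close> is its coordinate there, \<open>rot\<close> the rotation from the
    representative \<open>\<sigma> (K q')\<close> to it, and \<open>en\<close> lists the edges of
    \<open>Z\<close> with this rotation undone.\<close>
  define D1 where "D1 = configurations L3 \<inter> restriction L -` E"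
  define K where "K q' = \<kappa> (restriction L q')" for q'
  define rot where "rot q' = (q' $ v1 - q' $ v2) / (\<sigma> (K q') $ v1 - \<sigma> (K q') $ v2)" for q'
  define en where "en q' n = chain_edge Z q' n / rot q'" for q' n
  \<comment> \<open>These inequalities select the branch of the chart: free edges close in direction
    to those of \<open>q\<close>, and the closing triangle oriented as in \<open>q\<close>.\<close>
  define D where "D = {q' \<in> D1. (\<forall>n\<in>F. 0 < Re (en q' n / chain_edge Z q n)) \<and>
      0 < sg * Im (cnj (en q' j + en q' j') * en q' j)}"
  define coord where "coord q' = K q' + (\<Sum>n\<in>F. Arg (en q' n / chain_edge Z q n) *\<^sub>R c n)" for q'
  have cr: "continuous_on X (restriction L)" for X
  proof -
    have "linear (restriction L)"
      by (rule linearI) (simp_all add: vec_eq_iff restriction_nth)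
    then show ?thesis by (intro linear_continuous_on) (simp add: linear_conv_bounded_linear)
  qed
  have D1: "openin (top_of_set (configurations L3)) D1"
    unfolding D1_def
    by (rule continuous_openin_preimage[OF cr _ E]) (auto intro: restriction_configurations)
  have D1E: "restriction L q' \<in> E" "q' \<in> configurations L3" if "q' \<in> D1" for q'
    using that by (auto simp: D1_def)
  have KV: "K q' \<in> V \<inter> span S" if "q' \<in> D1" for q'
    using \<kappa>V[OF D1E(1)[OF that]] by (simp add: K_def)
  have vL: "v1 \<in> vertices L" "v2 \<in> vertices L" using edge_vertices[OF base_edge(1)] by auto
  have ne: "\<sigma> y $ v1 - \<sigma> y $ v2 \<noteq> 0" if "y \<in> V \<inter> span S" for y
    using configurations_dist[OF \<sigma>_conf[OF that] base_edge(1)] base_edge(2) by auto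
  \<comment> \<open>Taking the difference along the base edge eliminates the translation.\<close>
  have rot_eq: "rot q' = a" if q': "q' \<in> D1" and r: "restriction L q' = affine_image L a b (\<sigma> (K q'))" for q' a b
  proof -
    have "q' $ v = a * \<sigma> (K q') $ v + b" if v: "v \<in> vertices L" for v
      using arg_cong[OF r, of "\<lambda>p. p $ v"] v by (simp add: restriction_nth affine_image_nth)
    then have "q' $ v1 - q' $ v2 = a * (\<sigma> (K q') $ v1 - \<sigma> (K q') $ v2)"
      using vL by (simp add: algebra_simps)
    then show ?thesis using ne[OF KV[OF q']] by (simp add: rot_def)
  qed
  have rot: "norm (rot q') = 1 \<and> (\<exists>b. restriction L q' = affine_image L (rot q') b (\<sigma> (K q')))"
    if q': "q' \<in> D1" for q'
  proof -
    obtain a b where ab: "norm a = 1" "restriction L q' = affine_image L a b (\<sigma> (K q'))"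
      using \<kappa>c[OF D1E(1)[OF q']] by (auto simp: K_def elim: congruence_classE)
    then show ?thesis using rot_eq[OF q' ab(2)] by auto
  qed
  have contK: "continuous_on D1 K"
    unfolding K_def using D1E by (intro continuous_on_compose2[OF cont\<kappa> cr]) auto
  have cont_rot: "continuous_on D1 rot"
  proof -
    have s: "continuous_on D1 (\<lambda>q'. \<sigma> (K q') $ v)" for v
      using KV by (intro continuous_intros continuous_on_compose2[OF smooth_on_continuous_on[OF smooth_\<sigma>] contK]) auto
    show ?thesis
      unfolding rot_def[abs_def] using ne[OF KV] by (intro continuous_intros s) auto
  qed
  have cont_en: "continuous_on D1 (\<lambda>q'. en q' n)" for n
    unfolding en_def chain_edge_def using rot by (intro continuous_intros cont_rot) fastforce
  have cont_ratio: "continuous_on D1 (\<lambda>q'. en q' n / chain_edge Z q n)" if "n \<in> F" for n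
    using e0_nz[of n] that FF(1) by (intro continuous_intros cont_en) auto
  have D: "openin (top_of_set (configurations L3)) D"
  proof -
    have 1: "openin (top_of_set D1) (D1 \<inter> (\<lambda>q'. Re (en q' n / chain_edge Z q n)) -` {0<..})" if "n \<in> F" for n
      by (rule continuous_openin_preimage_gen[OF continuous_on_Re[OF cont_ratio[OF that]] open_greaterThan])
    have 2: "openin (top_of_set D1) (D1 \<inter> (\<lambda>q'. sg * Im (cnj (en q' j + en q' j') * en q' j)) -` {0<..})"
      by (rule continuous_openin_preimage_gen[OF _ open_greaterThan]) (intro continuous_intros cont_en)
    \<comment> \<open>The extra intersection with \<open>D1\<close> covers the case without free
      edges, where the empty intersection is the whole type.\<close>
    have "openin (top_of_set D1) ((\<Inter>n\<in>F. D1 \<inter> (\<lambda>q'. Re (en q' n / chain_edge Z q n)) -` {0<..}) \<inter> D1)"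
    proof (cases "F = {}")
      case False
      have "openin (top_of_set D1) (\<Inter>n\<in>F. D1 \<inter> (\<lambda>q'. Re (en q' n / chain_edge Z q n)) -` {0<..})"
        by (rule openin_INT2[OF FF(4) False 1])
      then show ?thesis by (rule openin_Int) simp
    qed simp
    from openin_Int[OF this 2] have "openin (top_of_set D1) D"
      by (rule back_subst[of "openin (top_of_set D1)"]) (auto simp: D_def)
    then show ?thesis using D1 openin_trans by blast
  qed
  have DD1: "q' \<in> D1" if "q' \<in> D" for q' using that by (simp add: D_def)
  have cont_coord: "continuous_on D coord"
  proof -
    have sub: "D \<subseteq> D1" using DD1 by blast
    \<comment> \<open>The positive real part keeps the ratio off the branch cut of
      \<open>Arg\<close>.\<close>
    have ca: "continuous_on D (\<lambda>q'. Arg (en q' n / chain_edge Z q n))" if n: "n \<in> F" for n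
    proof (rule continuous_on_Arg'[OF continuous_on_subset[OF cont_ratio[OF n] sub]])
      fix q' assume "q' \<in> D"
      then show "en q' n / chain_edge Z q n \<notin> \<real>\<^sub>\<le>\<^sub>0"
        using n by (auto simp: D_def complex_nonpos_Reals_iff)
    qed
    show ?thesis
      unfolding coord_def[abs_def]
      by (intro continuous_on_add continuous_on_sum continuous_on_scaleR continuous_on_const
          continuous_on_subset[OF contK sub] ca)
  qed
  \<comment> \<open>Dividing by \<open>rot\<close> restores the edges of \<open>\<tau> w\<close>;
    the ratios are then \<open>cis\<close> of angles small enough for \<open>Arg\<close> to return
    them.\<close>
  have coord_\<tau>: "q' \<in> D \<and> coord q' = w" if w: "w \<in> W \<inter> span B3" and q': "q' \<in> congruence_class L3 (\<tau> w)" for w q'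
  proof -
    have wW: "w \<in> W" and y: "proj w \<in> V \<inter> span S" using w proj_span by (auto simp: W_def)
    obtain a b where ab: "norm a = 1" "q' = affine_image L3 a b (\<tau> w)" using q' by (rule congruence_classE)
    have r: "restriction L q' = affine_image L a b (\<sigma> (proj w))"
      using restriction_affine[of L L3 a b "\<tau> w"] restriction_\<tau>[OF wW] ab(2) by simp
    then have rc: "restriction L q' \<in> congruence_class L (\<sigma> (proj w))"
      by (simp add: congruence_classI ab(1))
    have q'D1: "q' \<in> D1"
      using inE[OF y rc] affine_image_configurations[OF \<tau>_conf[OF wW] ab(1)] ab(2) by (simp add: D1_def)
    have Kq: "K q' = proj w" using \<kappa>u[OF y rc] by (simp add: K_def)
    have ra: "rot q' = a" using rot_eq[OF q'D1, of a b] r Kq by simp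
    have en: "en q' n = edge w n" if n: "n < k" for n
    proof -
      have "zs ! n \<in> vertices L3" "zs ! Suc n \<in> vertices L3" using n len by (auto simp: vertices_L3)
      then have "chain_edge Z q' n = a * chain_edge Z (\<tau> w) n"
        by (simp add: chain_edge_def ab(2) affine_image_nth algebra_simps)
      then show ?thesis using ab(1) chain_edge_\<tau>[OF n, of w] by (auto simp: en_def ra)
    qed
    have ratio: "en q' n / chain_edge Z q n = cis (w \<bullet> c n)" if n: "n \<in> F" for n
      using en[of n] n FF(1) edge_F[OF n, of w] e0_nz[of n] by (auto simp: free_edge_def)
    have ang: "\<bar>w \<bullet> c n\<bar> < pi / 2" if "n \<in> F" for n using wW that by (auto simp: W_def)
    have "0 < Re (en q' n / chain_edge Z q n)" if n: "n \<in> F" for n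
      using ang[OF n] by (simp add: ratio[OF n] cos_gt_zero_pi abs_less_iff)
    moreover have "0 < sg * Im (cnj (en q' j + en q' j') * en q' j)"
    proof -
      have "span_vector w \<in> pivot_domain (ls ! j) (ls ! j')" using wW by (simp add: W_def)
      from pivot_properties(3)[OF this sg(1) ls_pos[OF jk(1)] ls_pos[OF jk(2)]]
      show ?thesis using en[OF jk(1)] en[OF jk(2)] jk(3) by (simp add: edge_def)
    qed
    ultimately have "q' \<in> D" using q'D1 by (simp add: D_def)
    moreover have "Arg (en q' n / chain_edge Z q n) = w \<bullet> c n" if n: "n \<in> F" for n
      using ang[OF n] pi_gt_zero unfolding ratio[OF n] by (intro Arg_cis) (auto simp: abs_less_iff)
    then have "coord q' = proj w + (\<Sum>n\<in>F. (w \<bullet> c n) *\<^sub>R c n)"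
      by (simp add: coord_def Kq)
    then have "coord q' = w" using B3_representation[of w] w by simp
    ultimately show ?thesis by simp
  qed
  have coord_span: "coord q' \<in> span B3" "proj (coord q') = K q'"
      "n \<in> F \<Longrightarrow> coord q' \<bullet> c n = Arg (en q' n / chain_edge Z q n)" if q': "q' \<in> D" for q' n
    using free_coordinates[of "K q'"] KV[OF DD1[OF q']] by (auto simp: coord_def)
  \<comment> \<open>The free edges are recovered from their arguments because their lengths are
    prescribed, and the two closing edges by uniqueness of the triangle.\<close>
  have \<tau>_coord: "q' \<in> congruence_class L3 (\<tau> (coord q'))" if q': "q' \<in> D" for q'
  proof -
    let ?w = "coord q'" and ?a = "rot q'"
    note d1 = DD1[OF q'] and pw = coord_span(2)[OF q']
    obtain b where a1: "norm ?a = 1" and r: "restriction L q' = affine_image L ?a b (\<sigma> (K q'))"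
      using rot[OF d1] by blast
    have a0: "?a \<noteq> 0" using a1 by auto
    have L: "q' $ v = ?a * \<sigma> (K q') $ v + b" if "v \<in> vertices L" for v
      using arg_cong[OF r, of "\<lambda>p. p $ v"] that by (simp add: restriction_nth affine_image_nth)
    have ce: "chain_edge Z q' n = ?a * en q' n" for n using a0 by (simp add: en_def)
    have nen: "norm (en q' n) = ls ! n" if "n < k" for n
      using norm_chain_edge[OF D1E(2)[OF d1] _ that] a1 by (simp add: en_def norm_divide)
    have enF: "en q' n = free_edge ?w n" if n: "n \<in> F" for n
    proof -
      let ?z = "en q' n / chain_edge Z q n"
      have nk: "n < k" using n FF(1) by auto
      have "norm ?z = 1" using nen[OF nk] norm_e0[OF nk] ls_pos[OF nk] by (simp add: norm_divide)
      then have "cis (Arg ?z) = ?z" by (subst cis_Arg) (auto simp: sgn_eq)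
      then show ?thesis
        using e0_nz[OF nk] coord_span(3)[OF q' n] by (simp add: free_edge_def field_simps)
    qed
    have "?a * (\<Sum>n<k. en q' n) = q' $ (zs ! k) - q' $ (zs ! 0)"
      using sum_chain_edge[where i=k and Z=Z and p=q'] by (simp add: ce sum_distrib_left)
    also have "\<dots> = ?a * (\<sigma> (K q') $ (zs ! k) - \<sigma> (K q') $ (zs ! 0))"
      using zs_L by (simp add: L algebra_simps)
    finally have "(\<Sum>n<k. en q' n) = \<sigma> (K q') $ (zs ! k) - \<sigma> (K q') $ (zs ! 0)"
      using a0 by simp
    then have sv: "span_vector ?w = en q' j + en q' j'"
      using sum_edges[of "en q'"] enF by (simp add: span_vector_def pw algebra_simps)
    have "0 < sg * Im (cnj (span_vector ?w) * en q' j)"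
      using q' unfolding sv by (simp add: D_def)
    from pivot_unique(2)[OF nen[OF jk(1)] _ sg(1) this, of "ls ! j'"]
    have pv: "pivot sg (ls ! j) (ls ! j') (span_vector ?w) = en q' j"
      using nen[OF jk(2)] by (simp add: sv)
    have edge: "edge ?w n = en q' n" if n: "n < k" for n
    proof -
      consider "n = j" | "n = j'" | "n \<in> F" using n by (auto simp: F_def)
      then show ?thesis
      proof cases
        case 1 then show ?thesis by (simp add: edge_def pv)
      next
        case 2 then show ?thesis using jk(3) by (simp add: edge_def pv) (simp add: sv)
      next
        case 3 then show ?thesis by (simp add: edge_F enF)
      qed
    qed
    have "q' = affine_image L3 ?a b (\<tau> ?w)"
    proof (rule vec_eq_iff[THEN iffD2], rule allI)
      fix v
      consider "v \<in> vertices L" | "v \<in> set zs" | "v \<notin> vertices L3" by (auto simp: vertices_L3)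
      then show "q' $ v = affine_image L3 ?a b (\<tau> ?w) $ v"
      proof cases
        case 1
        then show ?thesis by (simp add: affine_image_nth vertices_L3 \<tau>_L pw L)
      next
        case 2
        then obtain i where i: "i \<le> k" "v = zs ! i" using set_zs by blast
        have "q' $ (zs ! i) = q' $ (zs ! 0) + ?a * (\<Sum>n<i. en q' n)"
          using sum_chain_edge[where i=i and Z=Z and p=q'] by (simp add: ce sum_distrib_left)
        moreover have "(\<Sum>n<i. en q' n) = (\<Sum>n<i. edge ?w n)"
          using i(1) by (intro sum.cong refl edge[symmetric]) auto
        ultimately show ?thesis
          using 2 zs_L by (simp add: affine_image_nth vertices_L3 i(2) \<tau>_zs[OF i(1)] pw L algebra_simps)
      next
        case 3
        then show ?thesis using configurations_outside[OF D1E(2)[OF d1]] by (simp add: affine_image_nth)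
      qed
    qed
    then show ?thesis using congruence_classI[OF a1] by metis
  qed
  show ?thesis
    unfolding local_coordinates_def
  proof (intro conjI ballI allI impI)
    show "B3 \<subseteq> Basis" by (rule B3_Basis)
    show "smooth_on \<tau> W" by (rule smooth_\<tau>)
    show "\<tau> ` (W \<inter> span B3) \<subseteq> configurations L3" using \<tau>_conf by blast
    show "v = 0" if "w \<in> W \<inter> span B3" "v \<in> span B3"
      "frechet_derivative \<tau> (at w) v \<in> infinitesimal_motions L3 (\<tau> w)" for w v
      using \<tau>_immersion[OF that] .
    show "inj_on (\<lambda>w. congruence_class L3 (\<tau> w)) (W \<inter> span B3)"
    proof (rule inj_onI)
      fix w w' assume w: "w \<in> W \<inter> span B3" "w' \<in> W \<inter> span B3"
        and eq: "congruence_class L3 (\<tau> w) = congruence_class L3 (\<tau> w')"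
      have "\<tau> w \<in> congruence_class L3 (\<tau> w)" using w(1) \<tau>_conf by (intro congruence_class_self) auto
      then show "w = w'" using coord_\<tau>[OF w(1)] coord_\<tau>[OF w(2)] eq by metis
    qed
    show "openin (top_of_set (configurations L3)) (\<Union>w\<in>R. congruence_class L3 (\<tau> w))"
      if R: "openin (top_of_set (W \<inter> span B3)) R" for R
    proof -
      obtain O' where O': "open O'" "R = W \<inter> span B3 \<inter> O'" using R by (auto simp: openin_open)
      \<comment> \<open>The union of orbits is a preimage under the continuous \<open>coord\<close>;
        membership in \<open>span B3\<close> is automatic for its values.\<close>
      have "(\<Union>w\<in>R. congruence_class L3 (\<tau> w)) = D \<inter> coord -` (W \<inter> O')"
      proof (intro equalityI subsetI)
        fix q' assume "q' \<in> (\<Union>w\<in>R. congruence_class L3 (\<tau> w))"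
        then obtain w where "w \<in> W \<inter> span B3" "w \<in> O'" "q' \<in> congruence_class L3 (\<tau> w)" using O'(2) by blast
        then show "q' \<in> D \<inter> coord -` (W \<inter> O')" using coord_\<tau>[of w q'] by auto
      next
        fix q' assume "q' \<in> D \<inter> coord -` (W \<inter> O')"
        then have "coord q' \<in> R" "q' \<in> D" using coord_span(1) O'(2) by auto
        then show "q' \<in> (\<Union>w\<in>R. congruence_class L3 (\<tau> w))" using \<tau>_coord by blast
      qed
      moreover have "openin (top_of_set D) (D \<inter> coord -` (W \<inter> O'))"
        by (rule continuous_openin_preimage_gen[OF cont_coord open_Int[OF open_W O'(1)]])
      ultimately show ?thesis using D openin_trans by metis
    qed
  qed
qed

end

text \<open>Room for the angles: a chain with k edges has at least k - 1 vertices outside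
  \<open>L\<close>, as at most two are shared, while only k - 2 edges are free. One vector
  \<open>axis v 1\<close> for each of sufficiently many such vertices serves as the family
  \<open>c\<close>; these vectors avoid \<open>S\<close>, which belongs to vertices of
  \<open>L\<close>.\<close>

lemma chain_extension_coordinates:
  fixes L :: "'v::finite linkage"
  assumes Z: "open_chain Z"
    and ends: "hd (chain_vertices Z) \<in> vertices L" "last (chain_vertices Z) \<in> vertices L"
    and interior: "set (chain_vertices Z) \<inter> vertices L = {hd (chain_vertices Z), last (chain_vertices Z)}"
    and base_edge: "(v1, v2, l0) \<in> L" "0 < l0"
    and lc: "local_coordinates L S V \<sigma>" and zeroV: "0 \<in> V" and S: "S \<subseteq> vertex_basis (vertices L)"
    and q: "q \<in> configurations (L \<union> chain_linkage Z)" and restr_q: "restriction L q = \<sigma> 0"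
    and na: "\<not> aligned (chain_linkage Z) q"
  obtains B W \<tau> where "S \<subseteq> B" "local_coordinates (L \<union> chain_linkage Z) B W \<tau>" "0 \<in> W" "\<tau> 0 = q"
    "\<And>w. w \<in> W \<Longrightarrow> (\<Sum>b\<in>S. (w \<bullet> b) *\<^sub>R b) \<in> V \<inter> span S"
    "\<And>w. w \<in> W \<Longrightarrow> restriction L (\<tau> w) = \<sigma> (\<Sum>b\<in>S. (w \<bullet> b) *\<^sub>R b)"
proof -
  let ?k = "length (chain_lengths Z)" and ?zs = "chain_vertices Z"
  obtain j j' where jj: "j < ?k" "j' < ?k" "j \<noteq> j'"
    "Im (cnj (chain_edge Z q j') * chain_edge Z q j) \<noteq> 0"
    by (rule nonparallel_edges[OF Z na q]) auto
  define F where "F = {..<?k} - {j, j'}"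
  have cardF: "card F = ?k - 2" using jj(1-3) by (simp add: F_def card_Diff_subset)
  define I where "I = set ?zs - vertices L"
  have "card (set ?zs) = Suc ?k" using Z by (auto simp: open_chain_def distinct_card)
  moreover have "card (set ?zs \<inter> vertices L) \<le> 2"
    unfolding interior by (rule order_trans[OF card_insert_le_m1]) auto
  moreover have "card I = card (set ?zs) - card (set ?zs \<inter> vertices L)"
    unfolding I_def by (rule card_Diff_subset_Int) simp
  ultimately have "card F \<le> card I" using cardF by linarith
  moreover have "card ((\<lambda>v. axis v (1::complex)) ` I) = card I"
    by (rule card_image) (auto simp: inj_on_def axis_eq_axis)
  ultimately obtain C where C: "C \<subseteq> (\<lambda>v. axis v (1::complex)) ` I" "card C = card F"
    using obtain_subset_with_card_n[of "card F" "(\<lambda>v. axis v (1::complex)) ` I"] by metis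
  have "finite C" using C(1) by (rule finite_subset) (simp add: I_def)
  then obtain c where c: "bij_betw c F C"
    using finite_same_card_bij[of F C] C(2) by (auto simp: F_def)
  have CB: "C \<subseteq> Basis - S"
  proof
    fix x assume "x \<in> C"
    then obtain v where v: "v \<notin> vertices L" "x = axis v (1::complex)" using C(1) by (auto simp: I_def)
    have "x \<in> Basis" by (auto simp: v(2) Basis_vec_def Basis_complex_def)
    moreover have "x \<notin> vertex_basis (vertices L)"
      using v by (auto simp: vertex_basis_def axis_eq_axis Basis_complex_def)
    ultimately show "x \<in> Basis - S" using S by blast
  qed
  interpret chain_extension L Z S V \<sigma> q v1 v2 l0 j j' c
  proof
    show "inj_on c ({..<?k} - {j, j'})" "c ` ({..<?k} - {j, j'}) \<subseteq> Basis - S"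
      using c CB by (auto simp: bij_betw_def F_def)
  qed (use Z ends interior base_edge lc zeroV q restr_q jj in auto)
  show ?thesis
  proof (rule that[of B3 W \<tau>])
    show "S \<subseteq> B3" by (auto simp: B3_def)
    show "(\<Sum>b\<in>S. (w \<bullet> b) *\<^sub>R b) \<in> V \<inter> span S" if "w \<in> W" for w
      using that proj_span[of w] by (auto simp: W_def proj_def)
    show "restriction L (\<tau> w) = \<sigma> (\<Sum>b\<in>S. (w \<bullet> b) *\<^sub>R b)" if "w \<in> W" for w
      using restriction_\<tau>[OF that] by (simp add: proj_def)
  qed (rule local_coordinates_\<tau> zeroW \<tau>_0)+
qed

section \<open>The Bott-Morse normal form along the critical manifold\<close>

theorem theorem6:
  fixes A B Z :: "'v::finite chain" and p :: "complex^'v" and m :: nat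
  assumes "three_chain A B Z"
    and "generic A B Z"
    and "\<forall>p\<in>configurations (cycle_linkage A B). \<not> aligned (cycle_linkage A B) p"
    and "\<forall>p\<in>configurations (cycle_linkage A Z). \<not> aligned (cycle_linkage A Z) p"
    and "\<forall>p\<in>configurations (cycle_linkage B Z). \<not> aligned (cycle_linkage B Z) p"
    and "p \<in> configurations (cycle_linkage A B)"
    and "cyclic (cycle_linkage A B) p"
    and "circular_manifold A B Z (congruence_class (cycle_linkage A B) p) \<noteq> {}"
    and "has_morse_index (cycle_linkage A B) (area A B)
           (congruence_class (cycle_linkage A B) p) m"
  shows "has_bott_morse_index (three_chain_linkage A B Z) (area A B)
           (circular_manifold A B Z (congruence_class (cycle_linkage A B) p)) m"
proof -
  let ?L = "cycle_linkage A B" and ?L3 = "three_chain_linkage A B Z" and ?vs = "cycle_vertices A B"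
  let ?P = "congruence_class ?L p"
  have L3: "?L3 = ?L \<union> chain_linkage Z" by (simp add: three_chain_linkage_def cycle_linkage_def)
  have sub: "?L \<subseteq> ?L3" by (auto simp: L3)
  have A: "open_chain A" and B: "open_chain B" and Z: "open_chain Z"
    and gAZ: "glued A Z" and gBZ: "glued B Z"
    using assms(1) by (auto simp: three_chain_def)
  have vL: "vertices ?L = set (chain_vertices A) \<union> set (chain_vertices B)"
    by (simp add: cycle_linkage_def vertices_Un vertices_chain_linkage A B)
  have interior: "set (chain_vertices Z) \<inter> vertices ?L = {hd (chain_vertices Z), last (chain_vertices Z)}"
  proof -
    have "set (chain_vertices A) \<inter> set (chain_vertices Z) = {hd (chain_vertices Z), last (chain_vertices Z)}"
      using gAZ unfolding glued_def by metis
    moreover have "set (chain_vertices B) \<inter> set (chain_vertices Z) = {hd (chain_vertices Z), last (chain_vertices Z)}"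
      using gBZ unfolding glued_def by metis
    ultimately show ?thesis unfolding vL by blast
  qed
  have ends: "hd (chain_vertices Z) \<in> vertices ?L" "last (chain_vertices Z) \<in> vertices ?L"
    using equalityD2[OF interior] by blast+
  have kA: "0 < length (chain_lengths A)" and lA: "\<forall>l\<in>set (chain_lengths A). 0 < l"
    using A by (simp_all add: open_chain_def)
  \<comment> \<open>The first edge of \<open>A\<close> is the reference edge for rotations; its
    positive length separates its ends.\<close>
  have base_edge: "(chain_vertices A ! 0, chain_vertices A ! Suc 0, chain_lengths A ! 0) \<in> ?L"
    unfolding cycle_linkage_def chain_linkage_def using kA by blast
  have base_pos: "0 < chain_lengths A ! 0" using lA nth_mem[OF kA] by blast
  have vsL: "set ?vs \<subseteq> vertices ?L" by (rule set_cycle_vertices[OF A B])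
  have vsL3: "set ?vs \<subseteq> vertices ?L3" using vsL vertices_mono[OF sub] by blast
  \<comment> \<open>The area reads only vertices of the cycle, where restriction acts as the trivial
    motion.\<close>
  have area_restr: "oriented_area ?vs (restriction ?L x) = oriented_area ?vs x" for x
    using vsL by (intro oriented_area_affine[of 1 _ _ _ 0]) (auto simp: restriction_nth)
  obtain S V \<sigma> N where S: "S \<subseteq> vertex_basis (vertices ?L)" and lc: "local_coordinates ?L S V \<sigma>"
    and V0: "0 \<in> V" and \<sigma>0: "congruence_class ?L (\<sigma> 0) = ?P" and N: "N \<subseteq> S" "card N = m"
    and nf: "\<And>y. y \<in> V \<inter> span S \<Longrightarrow> area A B (congruence_class ?L (\<sigma> y)) =
        area A B ?P - (\<Sum>b\<in>N. (y \<bullet> b)\<^sup>2) + (\<Sum>b\<in>S - N. (y \<bullet> b)\<^sup>2)"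
    by (rule has_morse_index_normal_form[OF assms(9) area_congruence_class[OF vsL] smooth_on_oriented_area]) blast
  have inj: "inj_on (\<lambda>x. congruence_class ?L (\<sigma> x)) (V \<inter> span S)"
    and confS: "\<sigma> ` (V \<inter> span S) \<subseteq> configurations ?L" and SB: "S \<subseteq> Basis"
    using lc unfolding local_coordinates_def by blast+
  have finS: "finite S" using SB finite_Basis finite_subset by blast
  have \<sigma>0c: "\<sigma> 0 \<in> configurations ?L" using confS V0 span_zero by blast
  show ?thesis
    unfolding has_bott_morse_index_def
  proof
    fix X assume "X \<in> circular_manifold A B Z ?P"
    then obtain q1 where q1: "q1 \<in> configurations ?L3" "restriction ?L q1 \<in> ?P" "X = congruence_class ?L3 q1"
      by (auto simp: circular_manifold_def)
    \<comment> \<open>The restriction of \<open>q1\<close> is only congruent to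
      \<open>\<sigma> 0\<close>. Applying the matching motion to all of \<open>q1\<close> gives a
      representative \<open>q\<close> of the same class that restricts to \<open>\<sigma> 0\<close>
      exactly.\<close>
    have "\<sigma> 0 \<in> congruence_class ?L (restriction ?L q1)"
      using congruence_class_self[OF \<sigma>0c] \<sigma>0 congruence_class_eqI[OF q1(2)] by simp
    then obtain a b where ab: "norm a = 1" "\<sigma> 0 = affine_image ?L a b (restriction ?L q1)"
      by (rule congruence_classE)
    define q where "q = affine_image ?L3 a b q1"
    have q: "q \<in> configurations ?L3" unfolding q_def by (rule affine_image_configurations[OF q1(1) ab(1)])
    have Xq: "X = congruence_class ?L3 q" unfolding q_def q1(3) by (rule congruence_class_affine[OF ab(1), symmetric])
    have rq: "restriction ?L q = \<sigma> 0" by (simp add: q_def ab(2) restriction_affine[OF sub])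
    \<comment> \<open>On the cycle \<open>q\<close> is a congruent copy of the cyclic
      \<open>p\<close>, so genericity rules out an aligned \<open>Z\<close>.\<close>
    have "\<not> aligned (chain_linkage Z) q"
    proof -
      obtain ctr r where r: "0 < r" "\<And>v. v \<in> vertices ?L \<Longrightarrow> dist ctr (p $ v) = r"
        using assms(7) unfolding cyclic_def by blast
      have "\<sigma> 0 \<in> ?P" using congruence_class_self[OF \<sigma>0c] \<sigma>0 by simp
      then obtain a' b' where ab': "norm a' = 1" "\<sigma> 0 = affine_image ?L a' b' p" by (rule congruence_classE)
      have "dist (a' * ctr + b') (q $ v) = r" if v: "v \<in> vertices ?L" for v
      proof -
        have "q $ v = a' * p $ v + b'"
          using arg_cong[OF rq, of "\<lambda>x. x $ v"] v by (simp add: restriction_nth ab'(2) affine_image_nth)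
        then show ?thesis using r(2)[OF v] dist_affine[OF ab'(1), of ctr b' "p $ v"] by metis
      qed
      then have "cyclic ?L q" using r(1) unfolding cyclic_def by blast
      then show ?thesis using assms(2) q unfolding generic_def by blast
    qed
    from chain_extension_coordinates[OF Z ends interior base_edge base_pos lc V0 S q[unfolded L3] rq this]
    obtain B3 W \<tau> where SB3: "S \<subseteq> B3" and lc3: "local_coordinates ?L3 B3 W \<tau>" and W0: "0 \<in> W" and \<tau>0: "\<tau> 0 = q"
      and pr: "\<And>w. w \<in> W \<Longrightarrow> (\<Sum>b\<in>S. (w \<bullet> b) *\<^sub>R b) \<in> V \<inter> span S"
      and r\<tau>: "\<And>w. w \<in> W \<Longrightarrow> restriction ?L (\<tau> w) = \<sigma> (\<Sum>b\<in>S. (w \<bullet> b) *\<^sub>R b)"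
      unfolding L3 by blast
    have XP: "area A B X = area A B ?P"
      using area_congruence_class[OF vsL3, of q] area_congruence_class[OF vsL, of "\<sigma> 0"] area_restr[of q]
      by (simp add: Xq \<sigma>0 rq)
    have conf3: "\<tau> ` (W \<inter> span B3) \<subseteq> configurations ?L3"
      using lc3 unfolding local_coordinates_def by blast
    have NQ: "N \<union> (S - N) = S" using N(1) by blast
    show "\<exists>B' U \<sigma> N Q. local_coordinates ?L3 B' U \<sigma> \<and> 0 \<in> U \<and> congruence_class ?L3 (\<sigma> 0) = X \<and>
        N \<union> Q \<subseteq> B' \<and> N \<inter> Q = {} \<and> card N = m \<and>
        (\<forall>x\<in>U \<inter> span B'.
           area A B (congruence_class ?L3 (\<sigma> x)) =
             area A B X - (\<Sum>b\<in>N. (x \<bullet> b)\<^sup>2) + (\<Sum>b\<in>Q. (x \<bullet> b)\<^sup>2) \<and>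
           (congruence_class ?L3 (\<sigma> x) \<in> circular_manifold A B Z ?P \<longleftrightarrow> (\<forall>b\<in>N \<union> Q. x \<bullet> b = 0)))"
    \<comment> \<open>The negative and positive directions are those of the chart of the cycle; the
      vectors of \<open>B3\<close> outside \<open>S\<close> are the angles, which run along the
      critical manifold.\<close>
    proof (rule exI[of _ B3], rule exI[of _ W], rule exI[of _ \<tau>], rule exI[of _ N],
        rule exI[of _ "S - N"], intro conjI ballI)
      show "local_coordinates ?L3 B3 W \<tau>" by (rule lc3)
      show "0 \<in> W" by (rule W0)
      show "congruence_class ?L3 (\<tau> 0) = X" by (simp add: \<tau>0 Xq)
      show "N \<union> (S - N) \<subseteq> B3" using SB3 NQ by simp
      show "N \<inter> (S - N) = {}" by blast
      show "card N = m" by (rule N(2))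
    next
      fix w assume w: "w \<in> W \<inter> span B3"
      \<comment> \<open>Area and membership depend on \<open>w\<close> only through this component,
        the chart coordinate of the restriction to the cycle.\<close>
      define y where "y = (\<Sum>b\<in>S. (w \<bullet> b) *\<^sub>R b)"
      have y: "y \<in> V \<inter> span S" and r: "restriction ?L (\<tau> w) = \<sigma> y"
        using pr r\<tau> w by (auto simp: y_def)
      have yb: "y \<bullet> b = w \<bullet> b" if "b \<in> S" for b
      proof -
        have "y \<bullet> b = (\<Sum>b'\<in>S. if b' = b then w \<bullet> b else 0)"
          unfolding y_def inner_sum_left using SB that by (intro sum.cong) (auto simp: inner_Basis subset_iff)
        then show ?thesis using finS that by simp
      qed
      have "area A B (congruence_class ?L3 (\<tau> w)) = area A B (congruence_class ?L (\<sigma> y))"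
        using area_congruence_class[OF vsL3, of "\<tau> w"] area_congruence_class[OF vsL, of "\<sigma> y"]
          area_restr[of "\<tau> w"] r by simp
      also have "\<dots> = area A B X - (\<Sum>b\<in>N. (y \<bullet> b)\<^sup>2) + (\<Sum>b\<in>S - N. (y \<bullet> b)\<^sup>2)"
        using nf[OF y] XP by simp
      also have "(\<Sum>b\<in>N. (y \<bullet> b)\<^sup>2) = (\<Sum>b\<in>N. (w \<bullet> b)\<^sup>2)"
        using N(1) yb by (intro sum.cong) auto
      also have "(\<Sum>b\<in>S - N. (y \<bullet> b)\<^sup>2) = (\<Sum>b\<in>S - N. (w \<bullet> b)\<^sup>2)"
        using yb by (intro sum.cong) auto
      finally show "area A B (congruence_class ?L3 (\<tau> w)) =
          area A B X - (\<Sum>b\<in>N. (w \<bullet> b)\<^sup>2) + (\<Sum>b\<in>S - N. (w \<bullet> b)\<^sup>2)" .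
      \<comment> \<open>The manifold is defined through some representative; restriction respects
        congruence, so any representative decides membership.\<close>
      have "congruence_class ?L3 (\<tau> w) \<in> circular_manifold A B Z ?P \<longleftrightarrow> \<sigma> y \<in> ?P"
      proof
        assume "\<sigma> y \<in> ?P"
        then show "congruence_class ?L3 (\<tau> w) \<in> circular_manifold A B Z ?P"
          using conf3 w r unfolding circular_manifold_def by auto
      next
        assume "congruence_class ?L3 (\<tau> w) \<in> circular_manifold A B Z ?P"
        then obtain q2 where q2: "q2 \<in> configurations ?L3" "restriction ?L q2 \<in> ?P"
          "congruence_class ?L3 (\<tau> w) = congruence_class ?L3 q2" by (auto simp: circular_manifold_def)
        have "\<tau> w \<in> congruence_class ?L3 q2"
          using congruence_class_self[of "\<tau> w" ?L3] conf3 w q2(3) by auto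
        from restriction_congruence_class[OF sub this]
        show "\<sigma> y \<in> ?P" using congruence_class_eqI[OF q2(2)] r by simp
      qed
      \<comment> \<open>The chart of the cycle is injective on classes, so it meets the critical
        class only at the origin.\<close>
      also have "\<dots> \<longleftrightarrow> y = 0"
      proof
        assume "\<sigma> y \<in> ?P"
        then have "congruence_class ?L (\<sigma> y) = congruence_class ?L (\<sigma> 0)"
          using congruence_class_eqI \<sigma>0 by metis
        then show "y = 0" using inj_onD[OF inj] y V0 span_zero by blast
      next
        assume "y = 0"
        then show "\<sigma> y \<in> ?P" using congruence_class_self[OF \<sigma>0c] \<sigma>0 by simp
      qed
      also have "\<dots> \<longleftrightarrow> (\<forall>b\<in>S. w \<bullet> b = 0)"
        using yb by (auto simp: y_def)
      finally show "congruence_class ?L3 (\<tau> w) \<in> circular_manifold A B Z ?P \<longleftrightarrow>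
          (\<forall>b\<in>N \<union> (S - N). w \<bullet> b = 0)" unfolding NQ .
    qed
  qed
qed

end
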